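(* (Converse construction for $\mathrm{CD}_{1S}$.) Let $G$ be a finite innately transitive group on $\Omega$ with non-abelian plinth $M$, let $T_1,\ldots,T_k$ be the simple normal subgroups of $M$, and let $\omega\in\Omega$. Assume that $M_\omega$ is a direct product of pairwise disjoint strips, each of length $2$, and let $\mathcal Y=\{Y_1,\dots,Y_{k/2}\}$ denote the set of strips involved in $M_\omega$. Let $X_1,A_1,B_1$ be subgroups of $M$ such that (i) $X_1$ is a full strip of length $2$; (ii) $A_1$ is a proper subgroup of $T_{\min X_1}$ and $B_1$ is a proper subgroup of $T_{\max X_1}$; (iii) $A_1$ and $B_1$ are conjugate under $G_\omega$; (iv) $X_1(A_1\times B_1)=T_{\min X_1}\times T_{\max X_1}$ and $X_1\cap(A_1\times B_1)=\sigma_{\mathrm{Supp}\,X_1}(M_\omega)$; (v) $N_{G_\omega}(T_{\min X_1}\times T_{\max X_1})=N_{G_\omega}(X_1)=N_{G_\omega}(A_1\times B_1)$. Let $\Gamma=(V\cup\mathcal Y,E_1\cup E_2)$ be a bipartite graph with bipartition $V,\mathcal Y$, and suppose that $G_\omega$ (acting on $\mathcal Y$ by conjugation) induces a group of automorphisms of $\Gamma$ such that $V$, $\mathcal Y$, $E_1$ and $E_2$ are $G_\omega$-orbits. Suppose that each element of $\mathcal Y$ is adjacent to one edge or two edges from $E_1$, and to one edge of $E_2$; and that if the elements of $\mathcal Y$ are adjacent to two elements of $E_1$ then the following also holds: if $\{v,Y\}\in E_1$, for some $v\in V$ and $Y\in\mathcal Y$, then $(G_\omega)_{\{v,Y\}}=N_{G_\omega}(T_{\min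 Y})\cap N_{G_\omega}(T_{\max Y})$. Then $\mathrm{Supp}\,X_1=\mathrm{Supp}\,Y_j$ for some $j\in\{1,\dots,k/2\}$; assume without loss of generality that $j=1$. Let $v_1,v_2\in V$ be such that $\{v_1,Y_1\}\in E_1$ and $\{v_2,Y_1\}\in E_2$. Put $K_{v_1,Y_1}=A_1\times T_{\max Y_1}$ if $Y_1$ is adjacent to two edges of $E_1$, and $K_{v_1,Y_1}=A_1\times B_1$ otherwise. For $v\in V$, $Y\in\mathcal Y$ put $$K_{v,Y}=\begin{cases}(K_{v_1,Y_1})^g&\text{if }\{v,Y\}\in E_1,\text{ and } g\in G_\omega\text{ is such that } \{v_1,Y_1\}^g=\{v,Y\};\\ X_1^g&\text{if }\{v,Y\}\in E_2,\text{ and } g\in G_\omega\text{ is such that } \{v_2,Y_1\}^g=\{v,Y\};\\ T_{\min Y}\times T_{\max Y}&\text{otherwise,}\end{cases}$$ and $K_v=\prod_{Y\in\mathcal Y}K_{v,Y}$. Then the definition of $K_{v,Y}$ is independent of the chosen $g$; the set $\mathcal K=\{K_v: v\in V\}$ is a $G_\omega$-invariant Cartesian system of subgroups for $M$ with respect to $\omega$; the actions of $G_\omega$ on $\mathcal K$ and on $V$ are equivalent, and so $G_\omega$ is transitive on $\mathcal K$; $\mathcal E(\mathcal K)\in\mathrm{CD}_{1S}(G)$; and $\Gamma=\Gamma(G,\mathcal E(\mathcal K))$, under the identification of $v\in V$ with $K_v$ and of $Y\in\mathcal Y$ with the non-trivial full strip involved in $\mathcal K$ having the same support as $Y$.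
   Context: All groups act on the right. A permutation group $G\le \mathrm{Sym}\,\Omega$ is *innately transitive* if it has a transitive minimal normal subgroup, called a *plinth*. A *Cartesian decomposition* of $\Omega$ is a set $\{\Gamma_1,\dots,\Gamma_\ell\}$ of proper partitions of $\Omega$ with $|\gamma_1\cap\dots\cap\gamma_\ell|=1$ for all $\gamma_1\in\Gamma_1,\dots,\gamma_\ell\in\Gamma_\ell$. It is *$G$-invariant* if $G$ permutes the $\Gamma_i$. $\mathrm{CD}_{\mathrm{tr}}(G)$ is the set of $G$-invariant Cartesian decompositions on which $G$ acts transitively. For a transitive group $M$ on $\Omega$ and $\omega\in\Omega$, a set $\{K_1,\dots,K_\ell\}$ of proper subgroups of $M$ is a *Cartesian system of subgroups for $M$ with respect to $\omega$* if $\bigcap_i K_i=M_\omega$ and $K_i(\bigcap_{j\ne i}K_j)=M$ for all $i$. Let $G$ be innately transitive with plinth $M$. If $\mathcal E=\{\Gamma_1,\dots,\Gamma_\ell\}$ is a $G$-invariant Cartesian decomposition, it is known that each $\Gamma_i$ is $M$-invariant; let $\gamma_i\in\Gamma_i$ be the block containing $\omega$ and $\mathcal K_\omega(\mathcal E)=\{K_1,\dots,K_\ell\}$ with $K_i=M_{\gamma_i}$ (setwise stabiliser). It is known that $\mathcal E\mapsto\mathcal K_\omega(\mathcal E)$ is a bijection from $G$-invariant Cartesian decompositions to $G_\omega$-invariant (under conjugation) Cartesian systems for $M$ with respect to $\omega$; the inverse is $\mathcal K\mapsto \mathcal E(\mathcal K)=\{\{(\omega^K)^m: m\in M\}: K\in\mathcal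 K\}$. Let $M=T_1\times\dots\times T_k$ with $T_i$ non-abelian finite simple. For $I\subseteq\{T_1,\dots,T_k\}$, $\sigma_I:M\to\prod_{T_i\in I}T_i$ is the projection, and $\sigma_i=\sigma_{\{T_i\}}$. A subgroup $X\le M$ is a *strip* if for each $i$ either $\sigma_i(X)=1$ or $\sigma_i(X)\cong X$; $\mathrm{Supp}\,X=\{T_i:\sigma_i(X)\ne1\}$; its *length* is $|\mathrm{Supp}\,X|$. Strips are *disjoint* if their supports are. $X$ is *full* if $\sigma_i(X)=T_i$ for all $T_i\in\mathrm{Supp}\,X$, and *non-trivial* if $|\mathrm{Supp}\,X|\ge2$. A strip $X$ is *involved* in $K\le M$ if $K=X\times\sigma_{\{T_1,\dots,T_k\}\setminus\mathrm{Supp}\,X}(K)$, and involved in a Cartesian system if involved in one of its members. For a strip $X$ put $\min X=\min\{i: T_i\in\mathrm{Supp}\,X\}$, $\max X=\max\{i:T_i\in\mathrm{Supp}\,X\}$. Put $\mathcal F_i(\mathcal E,M,\omega)=\{\sigma_i(K_j): \sigma_i(K_j)\neq T_i\}$. $\mathrm{CD}_{1S}(G)$ is the set of $\mathcal E\in\mathrm{CD}_{\mathrm{tr}}(G)$ such that $|\mathcal F_i|=1$ for each $i$ and $\mathcal K_\omega(\mathcal E)$ involves non-trivial full strips. For $\mathcal E\in\mathrm{CD}_{1S}(G)$, let $\mathcal X$ be the set of non-trivial full strips involved in $\mathcal K_\omega(\mathcal E)$ (it is known that these are $k/2$ pairwise disjoint strips of length 2). $\Gamma(G,\mathcal E)$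 is the graph with vertex set $\mathcal K_\omega(\mathcal E)\cup\mathcal X$ and edge set $E_1\cup E_2$, where for $K\in\mathcal K_\omega(\mathcal E)$, $X\in\mathcal X$: $\{K,X\}\in E_1$ if $\sigma_{\min X}(K)<T_{\min X}$ or $\sigma_{\max X}(K)<T_{\max X}$; and $\{K,X\}\in E_2$ if $X$ is involved in $K$. A vertex is adjacent to the edges containing it. $N_H(L)$ denotes the normaliser of $L$ in $H$, and $(G_\omega)_{\{v,Y\}}$ the stabiliser in $G_\omega$ of the edge $\{v,Y\}$. *)

theory Defs
  imports "HOL-Algebra.Group_Action" "HOL-Algebra.Generated_Groups" "HOL-Algebra.SimpleGroups"
    "HOL-Library.Disjoint_Sets"
begin

text \<open>
  \<^term>\<open>BijGroup \<Omega>\<close> composes from right to left, so in right-action notation the image of a point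
  \<open>\<omega>\<close> under \<open>g\<close> is \<open>g \<omega>\<close>, and \<open>L\<close> conjugated by \<open>g\<close> is \<open>g L (inv g)\<close>.
\<close>

abbreviation Sym :: "'a set \<Rightarrow> ('a \<Rightarrow> 'a) monoid"
  where "Sym \<Omega> \<equiv> BijGroup \<Omega>"

definition conj_by :: "('g, 'm) monoid_scheme \<Rightarrow> 'g \<Rightarrow> 'g set \<Rightarrow> 'g set"
  where "conj_by S g L = g <#\<^bsub>S\<^esub> L #>\<^bsub>S\<^esub> (inv\<^bsub>S\<^esub> g)"

text \<open>\<^const>\<open>normalizer\<close> is only meaningful for subsets of the group it is formed in; the
  normaliser \<open>N\<^sub>H(L)\<close> is needed for \<open>L\<close> not contained in \<open>H\<close>.\<close>

definition normalizer_in :: "('g, 'm) monoid_scheme \<Rightarrow> 'g set \<Rightarrow> 'g set \<Rightarrow> 'g set"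
  where "normalizer_in S H L = H \<inter> normalizer S L"

definition point_stab :: "'a set \<Rightarrow> ('a \<Rightarrow> 'a) set \<Rightarrow> 'a \<Rightarrow> ('a \<Rightarrow> 'a) set"
  where "point_stab \<Omega> G \<omega> = stabilizer (Sym \<Omega>\<lparr>carrier := G\<rparr>) (\<lambda>g. g) \<omega>"

definition set_stab :: "'a set \<Rightarrow> ('a \<Rightarrow> 'a) set \<Rightarrow> 'a set \<Rightarrow> ('a \<Rightarrow> 'a) set"
  where "set_stab \<Omega> G \<gamma> = stabilizer (Sym \<Omega>\<lparr>carrier := G\<rparr>) (\<lambda>g. image g) \<gamma>"

definition transitive_on :: "'a set \<Rightarrow> ('a \<Rightarrow> 'a) set \<Rightarrow> bool"
  where "transitive_on \<Omega> G \<longleftrightarrow> (\<forall>x\<in>\<Omega>. \<forall>y\<in>\<Omega>. \<exists>g\<in>G. g x = y)"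

definition minimal_normal :: "('g, 'm) monoid_scheme \<Rightarrow> 'g set \<Rightarrow> bool"
  where "minimal_normal S M \<longleftrightarrow> M \<lhd> S \<and> M \<noteq> {\<one>\<^bsub>S\<^esub>} \<and>
    (\<forall>N. N \<lhd> S \<and> N \<subseteq> M \<longrightarrow> N = {\<one>\<^bsub>S\<^esub>} \<or> N = M)"

definition plinth :: "'a set \<Rightarrow> ('a \<Rightarrow> 'a) set \<Rightarrow> ('a \<Rightarrow> 'a) set \<Rightarrow> bool"
  where "plinth \<Omega> G M \<longleftrightarrow> minimal_normal (Sym \<Omega>\<lparr>carrier := G\<rparr>) M \<and> transitive_on \<Omega> M"


subsection \<open>Cartesian decompositions\<close>

text \<open>A partition is proper if it has more than one block; the partition into singletons is
  allowed.\<close>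

definition cartesian_decomposition :: "'a set \<Rightarrow> 'a set set set \<Rightarrow> bool"
  where "cartesian_decomposition \<Omega> \<E> \<longleftrightarrow> finite \<E> \<and> \<E> \<noteq> {} \<and>
    (\<forall>\<Gamma>\<in>\<E>. partition_on \<Omega> \<Gamma> \<and> \<Gamma> \<noteq> {\<Omega>}) \<and>
    (\<forall>\<gamma>. (\<forall>\<Gamma>\<in>\<E>. \<gamma> \<Gamma> \<in> \<Gamma>) \<longrightarrow> card (\<Inter>\<Gamma>\<in>\<E>. \<gamma> \<Gamma>) = 1)"

definition CD_tr :: "'a set \<Rightarrow> ('a \<Rightarrow> 'a) set \<Rightarrow> 'a set set set set"
  where "CD_tr \<Omega> G = {\<E>. cartesian_decomposition \<Omega> \<E> \<and>
    (\<forall>g\<in>G. image (image (image g)) \<E> = \<E>) \<and>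
    (\<forall>\<Gamma>\<in>\<E>. \<forall>\<Delta>\<in>\<E>. \<exists>g\<in>G. image (image g) \<Gamma> = \<Delta>)}"

definition cartesian_system ::
    "'a set \<Rightarrow> ('a \<Rightarrow> 'a) set \<Rightarrow> 'a \<Rightarrow> ('a \<Rightarrow> 'a) set set \<Rightarrow> bool"
  where "cartesian_system \<Omega> M \<omega> \<K> \<longleftrightarrow> finite \<K> \<and> \<K> \<noteq> {} \<and>
    (\<forall>K\<in>\<K>. subgroup K (Sym \<Omega>) \<and> K \<subset> M) \<and>
    \<Inter>\<K> = point_stab \<Omega> M \<omega> \<and>
    (\<forall>K\<in>\<K>. K <#>\<^bsub>Sym \<Omega>\<^esub> (M \<inter> \<Inter>(\<K> - {K})) = M)"

text \<open>The maps \<open>\<E> \<mapsto> \<K>\<^sub>\<omega>(\<E>)\<close> and \<open>\<K> \<mapsto> \<E>(\<K>)\<close>.\<close>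

definition system_of ::
    "'a set \<Rightarrow> ('a \<Rightarrow> 'a) set \<Rightarrow> 'a \<Rightarrow> 'a set set set \<Rightarrow> ('a \<Rightarrow> 'a) set set"
  where "system_of \<Omega> M \<omega> \<E> = {set_stab \<Omega> M \<gamma> |\<gamma> \<Gamma>. \<Gamma> \<in> \<E> \<and> \<gamma> \<in> \<Gamma> \<and> \<omega> \<in> \<gamma>}"

definition decomp_of ::
    "('a \<Rightarrow> 'a) set \<Rightarrow> 'a \<Rightarrow> ('a \<Rightarrow> 'a) set set \<Rightarrow> 'a set set set"
  where "decomp_of M \<omega> \<K> = {{m ` {x \<omega> |x. x \<in> K} |m. m \<in> M} |K. K \<in> \<K>}"


subsection \<open>Direct products and strips\<close>

definition is_direct_product ::
    "('g, 'm) monoid_scheme \<Rightarrow> 'i set \<Rightarrow> ('i \<Rightarrow> 'g set) \<Rightarrow> 'g set \<Rightarrow> bool"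
  where "is_direct_product S I H P \<longleftrightarrow>
    (\<forall>i\<in>I. subgroup (H i) S) \<and>
    (\<forall>i\<in>I. \<forall>j\<in>I. i \<noteq> j \<longrightarrow> (\<forall>x\<in>H i. \<forall>y\<in>H j. x \<otimes>\<^bsub>S\<^esub> y = y \<otimes>\<^bsub>S\<^esub> x)) \<and>
    (\<forall>i\<in>I. H i \<inter> generate S (\<Union>j\<in>I - {i}. H j) = {\<one>\<^bsub>S\<^esub>}) \<and>
    P = generate S (\<Union>i\<in>I. H i)"

text \<open>Below, \<open>M\<close> is the direct product of \<open>T 1, \<dots>, T k\<close>, and sets of direct factors, such as
  supports, are represented by the corresponding sets of indices in \<open>{1..k}\<close>.\<close>

definition sigma ::
    "('g, 'm) monoid_scheme \<Rightarrow> (nat \<Rightarrow> 'g set) \<Rightarrow> nat \<Rightarrow> nat set \<Rightarrow> 'g \<Rightarrow> 'g"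
  where "sigma S T k I m = (THE a. a \<in> generate S (\<Union>i\<in>I. T i) \<and>
    (\<exists>b \<in> generate S (\<Union>i\<in>{1..k} - I. T i). m = a \<otimes>\<^bsub>S\<^esub> b))"

definition supp ::
    "('g, 'm) monoid_scheme \<Rightarrow> (nat \<Rightarrow> 'g set) \<Rightarrow> nat \<Rightarrow> 'g set \<Rightarrow> nat set"
  where "supp S T k X = {i \<in> {1..k}. sigma S T k {i} ` X \<noteq> {\<one>\<^bsub>S\<^esub>}}"

definition strip ::
    "('g, 'm) monoid_scheme \<Rightarrow> 'g set \<Rightarrow> (nat \<Rightarrow> 'g set) \<Rightarrow> nat \<Rightarrow> 'g set \<Rightarrow> bool"
  where "strip S M T k X \<longleftrightarrow> subgroup X S \<and> X \<subseteq> M \<and>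
    (\<forall>i\<in>{1..k}. sigma S T k {i} ` X = {\<one>\<^bsub>S\<^esub>} \<or>
       S\<lparr>carrier := sigma S T k {i} ` X\<rparr> \<cong> S\<lparr>carrier := X\<rparr>)"

definition full_strip ::
    "('g, 'm) monoid_scheme \<Rightarrow> 'g set \<Rightarrow> (nat \<Rightarrow> 'g set) \<Rightarrow> nat \<Rightarrow> 'g set \<Rightarrow> bool"
  where "full_strip S M T k X \<longleftrightarrow> strip S M T k X \<and>
    (\<forall>i \<in> supp S T k X. sigma S T k {i} ` X = T i)"

abbreviation T_min ::
    "('g, 'm) monoid_scheme \<Rightarrow> (nat \<Rightarrow> 'g set) \<Rightarrow> nat \<Rightarrow> 'g set \<Rightarrow> 'g set"
  where "T_min S T k X \<equiv> T (Min (supp S T k X))"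

abbreviation T_max ::
    "('g, 'm) monoid_scheme \<Rightarrow> (nat \<Rightarrow> 'g set) \<Rightarrow> nat \<Rightarrow> 'g set \<Rightarrow> 'g set"
  where "T_max S T k X \<equiv> T (Max (supp S T k X))"

text \<open>The product is direct because \<open>X\<close> lies in the product of the factors in its support.\<close>

definition involved_in ::
    "('g, 'm) monoid_scheme \<Rightarrow> (nat \<Rightarrow> 'g set) \<Rightarrow> nat \<Rightarrow> 'g set \<Rightarrow> 'g set \<Rightarrow> bool"
  where "involved_in S T k X K \<longleftrightarrow>
    K = X <#>\<^bsub>S\<^esub> (sigma S T k ({1..k} - supp S T k X) ` K)"

definition nontrivial_full_strips_in ::
    "('g, 'm) monoid_scheme \<Rightarrow> 'g set \<Rightarrow> (nat \<Rightarrow> 'g set) \<Rightarrow> nat \<Rightarrow> 'g set set \<Rightarrow> 'g set set"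
  where "nontrivial_full_strips_in S M T k \<K> = {X. full_strip S M T k X \<and>
    card (supp S T k X) \<ge> 2 \<and> (\<exists>K\<in>\<K>. involved_in S T k X K)}"

definition F_proj ::
    "'a set \<Rightarrow> ('a \<Rightarrow> 'a) set \<Rightarrow> (nat \<Rightarrow> ('a \<Rightarrow> 'a) set) \<Rightarrow> nat \<Rightarrow> 'a \<Rightarrow> 'a set set set \<Rightarrow> nat
      \<Rightarrow> ('a \<Rightarrow> 'a) set set"
  where "F_proj \<Omega> M T k \<omega> \<E> i = {sigma (Sym \<Omega>) T k {i} ` K |K.
    K \<in> system_of \<Omega> M \<omega> \<E> \<and> sigma (Sym \<Omega>) T k {i} ` K \<noteq> T i}"

definition CD_1S ::
    "'a set \<Rightarrow> ('a \<Rightarrow> 'a) set \<Rightarrow> ('a \<Rightarrow> 'a) set \<Rightarrow> (nat \<Rightarrow> ('a \<Rightarrow> 'a) set) \<Rightarrow> nat \<Rightarrow> 'a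
      \<Rightarrow> 'a set set set set"
  where "CD_1S \<Omega> G M T k \<omega> = {\<E> \<in> CD_tr \<Omega> G.
    (\<forall>i\<in>{1..k}. card (F_proj \<Omega> M T k \<omega> \<E> i) = 1) \<and>
    nontrivial_full_strips_in (Sym \<Omega>) M T k (system_of \<Omega> M \<omega> \<E>) \<noteq> {}}"


subsection \<open>Graphs\<close>

text \<open>A graph with two kinds of edges is a triple of its vertex set and its two edge sets; edges
  are unordered pairs.\<close>

type_synonym 'v graph2 = "'v set \<times> 'v set set \<times> 'v set set"

definition graph2_iso :: "('v \<Rightarrow> 'w) \<Rightarrow> 'v graph2 \<Rightarrow> 'w graph2 \<Rightarrow> bool"
  where "graph2_iso f \<Gamma> \<Delta> \<longleftrightarrow> (case \<Gamma> of (V, E1, E2) \<Rightarrow> case \<Delta> of (W, F1, F2) \<Rightarrow>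
    bij_betw f V W \<and> image f ` E1 = F1 \<and> image f ` E2 = F2)"

definition decomp_graph ::
    "'a set \<Rightarrow> ('a \<Rightarrow> 'a) set \<Rightarrow> (nat \<Rightarrow> ('a \<Rightarrow> 'a) set) \<Rightarrow> nat \<Rightarrow> 'a \<Rightarrow> 'a set set set
      \<Rightarrow> ('a \<Rightarrow> 'a) set graph2"
  where "decomp_graph \<Omega> M T k \<omega> \<E> =
    (let S = Sym \<Omega>; \<K> = system_of \<Omega> M \<omega> \<E>; XS = nontrivial_full_strips_in S M T k \<K> in
      (\<K> \<union> XS,
       {{K, X} |K X. K \<in> \<K> \<and> X \<in> XS \<and>
          (sigma S T k {Min (supp S T k X)} ` K \<subset> T_min S T k X \<or>
           sigma S T k {Max (supp S T k X)} ` K \<subset> T_max S T k X)},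
       {{K, X} |K X. K \<in> \<K> \<and> X \<in> XS \<and> involved_in S T k X K}))"

text \<open>The abstract bipartite graph has vertices \<open>Inl ` V \<union> Inr ` YS\<close>, where \<open>V\<close> is a set of any type and
  \<open>YS\<close> a set of subgroups.\<close>

definition edge :: "'v \<Rightarrow> 'y \<Rightarrow> ('v + 'y) set"
  where "edge v Y = {Inl v, Inr Y}"

definition incident_edges :: "('v + 'y) set set \<Rightarrow> 'y \<Rightarrow> ('v + 'y) set set"
  where "incident_edges E Y = {e \<in> E. Inr Y \<in> e}"

definition vertex_action ::
    "('g, 'm) monoid_scheme \<Rightarrow> ('g \<Rightarrow> 'v \<Rightarrow> 'v) \<Rightarrow> 'g \<Rightarrow> 'v + 'g set \<Rightarrow> 'v + 'g set"
  where "vertex_action S \<alpha> g = map_sum (\<alpha> g) (conj_by S g)"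

definition edge_action ::
    "('g, 'm) monoid_scheme \<Rightarrow> ('g \<Rightarrow> 'v \<Rightarrow> 'v) \<Rightarrow> 'g \<Rightarrow> ('v + 'g set) set \<Rightarrow> ('v + 'g set) set"
  where "edge_action S \<alpha> g = image (vertex_action S \<alpha> g)"


subsection \<open>The construction\<close>

text \<open>The subgroup \<open>K\<^bsub>v,Y\<^esub>\<close>, for base edges \<open>e1\<close>, \<open>e2\<close> with associated subgroups \<open>L1\<close>, \<open>L2\<close>.\<close>

definition K_part ::
    "('g, 'm) monoid_scheme \<Rightarrow> (nat \<Rightarrow> 'g set) \<Rightarrow> nat \<Rightarrow> 'g set \<Rightarrow> ('g \<Rightarrow> 'v \<Rightarrow> 'v)
      \<Rightarrow> ('v + 'g set) set set \<Rightarrow> ('v + 'g set) set set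
      \<Rightarrow> ('v + 'g set) set \<Rightarrow> 'g set \<Rightarrow> ('v + 'g set) set \<Rightarrow> 'g set \<Rightarrow> 'v \<Rightarrow> 'g set \<Rightarrow> 'g set"
  where "K_part S T k H \<alpha> E1 E2 e1 L1 e2 L2 v Y =
    (if edge v Y \<in> E1 then conj_by S (SOME g. g \<in> H \<and> edge_action S \<alpha> g e1 = edge v Y) L1
     else if edge v Y \<in> E2 then conj_by S (SOME g. g \<in> H \<and> edge_action S \<alpha> g e2 = edge v Y) L2
     else T_min S T k Y <#>\<^bsub>S\<^esub> T_max S T k Y)"

end

theory Submission
  imports Defs
begin

text \<open>
  Since \<open>G = M G\<^sub>\<omega>\<close> and \<open>M\<close> is minimal normal in \<open>G\<close>, the support of \<open>M\<^sub>\<omega>\<close> is \<open>{T\<^sub>1, \<dots>, T\<^sub>k}\<close>,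
  so the strips in \<open>\<Y>\<close> split the factors of \<open>M\<close> into blocks of size two, and each \<open>K\<^sub>v\<close> is a direct
  product of its components \<open>K\<^bsub>v,Y\<^esub>\<close> over these blocks.  Every assertion about the family \<open>K\<^sub>v\<close>
  (intersection, factorisation, projections to the \<open>T\<^sub>i\<close>, full strips) can be tested block by block,
  and by \<open>G\<^sub>\<omega>\<close>-equivariance of \<open>K\<^bsub>v,Y\<^esub>\<close> it suffices to do so at \<open>Y\<^sub>1\<close>.  There the components are
  \<open>X\<^sub>1\<close>, \<open>A\<^sub>1 \<times> B\<^sub>1\<close> (or \<open>A\<^sub>1 \<times> T\<^bsub>max\<^esub>\<close> and \<open>T\<^bsub>min\<^esub> \<times> B\<^sub>1\<close> if \<open>Y\<^sub>1\<close> lies on two edges of \<open>E\<^sub>1\<close>), and the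
  whole block otherwise.  A Cartesian system yields a Cartesian decomposition because cosets of its
  members can be intersected as in the Chinese remainder theorem.
\<close>

text \<open>Condition (v) makes the components well defined: an element of
  \<open>G\<^sub>\<omega>\<close> fixing \<open>Y1\<close> normalises the block, hence fixes
  \<open>X1\<close> and \<open>A1 <#> B1\<close>. If \<open>Y1\<close> lies on two edges of
  \<open>E1\<close>, the stabiliser of such an edge fixes both factors of the block, hence also
  \<open>A1\<close>, which is the part of \<open>A1 <#> B1\<close> in its factor. An element
  carrying \<open>v1\<close> to the other neighbour must then interchange the two factors, and by
  (v) it interchanges \<open>A1\<close> and \<open>B1\<close>; this is where the component of
  minimum factor times \<open>B1\<close> comes from. In that case the factorisation is not an
  instance of (iv), because only a part of \<open>X1\<close> remains in the intersection of the
  other components; \<open>diagonal_factorisation\<close> closes this gap. Identifying the graph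
  needs converses: edges of \<open>E1\<close> are recognised by proper projections, edges of
  \<open>E2\<close> by full strips. The latter rests on finiteness: a strip is then a subgroup on
  which every non-trivial coordinate is injective, so an involved strip cannot be spread over
  several blocks. The construction itself is carried out for abstract \<open>H\<close> and
  \<open>D\<close> in place of \<open>G\<^sub>\<omega>\<close> and \<open>M\<^sub>\<omega>\<close>;
  points return only with the partitions.\<close>

declare One_nat_def [simp del]

section \<open>Conjugation and internal direct products\<close>

context group begin

lemma set_mult_iff: "z \<in> H <#> K \<longleftrightarrow> (\<exists>x\<in>H. \<exists>y\<in>K. z = x \<otimes> y)"
  by (auto simp: set_mult_def)

lemma set_multI: "x \<in> H \<Longrightarrow> y \<in> K \<Longrightarrow> x \<otimes> y \<in> H <#> K"
  by (auto simp: set_mult_def)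

lemma conj_by_image: "conj_by G g L = (\<lambda>x. g \<otimes> x \<otimes> inv g) ` L"
  unfolding conj_by_def l_coset_def r_coset_def by auto

lemma conj_by_subset: "g \<in> carrier G \<Longrightarrow> L \<subseteq> carrier G \<Longrightarrow> conj_by G g L \<subseteq> carrier G"
  by (auto simp: conj_by_image)

lemma conj_mult:
  assumes "g \<in> carrier G" "x \<in> carrier G" "y \<in> carrier G"
  shows "g \<otimes> (x \<otimes> y) \<otimes> inv g = (g \<otimes> x \<otimes> inv g) \<otimes> (g \<otimes> y \<otimes> inv g)"
proof -
  have "inv g \<otimes> (g \<otimes> (y \<otimes> inv g)) = y \<otimes> inv g"
    using assms by (simp add: m_assoc[symmetric])
  then show ?thesis using assms by (simp add: m_assoc)
qed

lemma conj_comp: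
  assumes "g \<in> carrier G" "h \<in> carrier G" "x \<in> carrier G"
  shows "(g \<otimes> h) \<otimes> x \<otimes> inv (g \<otimes> h) = g \<otimes> (h \<otimes> x \<otimes> inv h) \<otimes> inv g"
  using assms by (simp add: m_assoc inv_mult_group)

lemma conj_group_hom: "g \<in> carrier G \<Longrightarrow> group_hom G G (\<lambda>x. g \<otimes> x \<otimes> inv g)"
  by unfold_locales (auto simp: hom_def conj_mult)

lemma conj_by_subgroup: "g \<in> carrier G \<Longrightarrow> subgroup L G \<Longrightarrow> subgroup (conj_by G g L) G"
  unfolding conj_by_image
  by (rule group_hom.subgroup_img_is_subgroup[OF conj_group_hom])

lemma conj_by_comp:
  "g \<in> carrier G \<Longrightarrow> h \<in> carrier G \<Longrightarrow> L \<subseteq> carrier G \<Longrightarrow>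
    conj_by G (g \<otimes> h) L = conj_by G g (conj_by G h L)"
  unfolding conj_by_image image_image by (rule image_cong) (auto simp: conj_comp)

lemma conj_by_one: "L \<subseteq> carrier G \<Longrightarrow> conj_by G \<one> L = L"
  unfolding conj_by_image by (force simp: subset_iff)

lemma conj_by_inv:
  "g \<in> carrier G \<Longrightarrow> L \<subseteq> carrier G \<Longrightarrow> conj_by G (inv g) (conj_by G g L) = L"
  by (simp add: conj_by_comp[symmetric] conj_by_one)

lemma conj_by_inv':
  "g \<in> carrier G \<Longrightarrow> L \<subseteq> carrier G \<Longrightarrow> conj_by G g (conj_by G (inv g) L) = L"
  by (simp add: conj_by_comp[symmetric] conj_by_one)

lemma conj_inj: "g \<in> carrier G \<Longrightarrow> inj_on (\<lambda>x. g \<otimes> x \<otimes> inv g) (carrier G)"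
  by (auto simp: inj_on_def)

lemma conj_by_set_mult:
  assumes "g \<in> carrier G" "A \<subseteq> carrier G" "B \<subseteq> carrier G"
  shows "conj_by G g (A <#> B) = conj_by G g A <#> conj_by G g B"
proof -
  have "g \<otimes> (a \<otimes> b) \<otimes> inv g = (g \<otimes> a \<otimes> inv g) \<otimes> (g \<otimes> b \<otimes> inv g)" if "a \<in> A" "b \<in> B" for a b
    using that assms by (intro conj_mult) auto
  then show ?thesis by (simp add: conj_by_image set_mult_def image_UN)
qed

lemma conj_by_generate:
  "g \<in> carrier G \<Longrightarrow> A \<subseteq> carrier G \<Longrightarrow> conj_by G g (generate G A) = generate G (conj_by G g A)"
  unfolding conj_by_image by (rule group_hom.generate_img[OF conj_group_hom, symmetric])

text \<open>The centraliser of a set is a subgroup. Used twice: \<open>generate G A\<close> lies in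
  the centraliser of \<open>B\<close>, so \<open>B\<close>, and with it \<open>generate G B\<close>,
  lies in the centraliser of \<open>generate G A\<close>.\<close>

lemma generate_commute:
  assumes "A \<subseteq> carrier G" "B \<subseteq> carrier G"
    and "\<And>x y. x \<in> A \<Longrightarrow> y \<in> B \<Longrightarrow> x \<otimes> y = y \<otimes> x"
    and "a \<in> generate G A" "b \<in> generate G B"
  shows "a \<otimes> b = b \<otimes> a"
proof -
  define C where "C X = {c \<in> carrier G. \<forall>x\<in>X. c \<otimes> x = x \<otimes> c}" for X
  have C: "subgroup (C X) G" if X: "X \<subseteq> carrier G" for X
  proof (rule subgroupI)
    show "C X \<subseteq> carrier G" "C X \<noteq> {}" using X by (force simp: C_def)+
  next
    fix c assume c: "c \<in> C X"
    have "inv c \<otimes> x = x \<otimes> inv c" if "x \<in> X" for x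
    proof -
      have *: "c \<otimes> x = x \<otimes> c" "x \<in> carrier G" "c \<in> carrier G" using c that X by (auto simp: C_def)
      then have "inv c \<otimes> (c \<otimes> x) \<otimes> inv c = inv c \<otimes> (x \<otimes> c) \<otimes> inv c" by simp
      then show ?thesis using * by (metis inv_closed inv_solve_left inv_solve_right m_assoc m_closed)
    qed
    then show "inv c \<in> C X" using c by (auto simp: C_def)
  next
    fix c d assume cd: "c \<in> C X" "d \<in> C X"
    have "(c \<otimes> d) \<otimes> x = x \<otimes> (c \<otimes> d)" if "x \<in> X" for x
    proof -
      have "c \<otimes> x = x \<otimes> c" "d \<otimes> x = x \<otimes> d" "x \<in> carrier G" "c \<in> carrier G" "d \<in> carrier G"
        using cd that X by (auto simp: C_def)
      then show ?thesis by (metis m_assoc)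
    qed
    then show "c \<otimes> d \<in> C X" using cd by (auto simp: C_def)
  qed
  have "generate G A \<subseteq> C B"
    using assms by (intro generate_subgroup_incl C) (auto simp: C_def)
  moreover have "generate G B \<subseteq> C (generate G A)"
    by (rule generate_subgroup_incl[OF _ C[OF generate_incl[OF assms(1)]]])
      (use calculation assms(2) in \<open>auto simp: C_def subset_iff\<close>)
  ultimately show ?thesis using assms(4,5) by (auto simp: C_def subset_iff)
qed

lemma commuting_set_mult_subgroup:
  assumes H: "subgroup H G" and K: "subgroup K G"
    and comm: "\<And>x y. x \<in> H \<Longrightarrow> y \<in> K \<Longrightarrow> x \<otimes> y = y \<otimes> x"
  shows "subgroup (H <#> K) G"
proof (rule subgroupI)
  note car = subgroup.mem_carrier[OF H] subgroup.mem_carrier[OF K]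
  show "H <#> K \<subseteq> carrier G" using car by (auto simp: set_mult_def)
  show "H <#> K \<noteq> {}"
    using subgroup.one_closed[OF H] subgroup.one_closed[OF K] by (auto simp: set_mult_def)
  show "inv a \<in> H <#> K" if a: "a \<in> H <#> K" for a
  proof -
    obtain h x where hx: "h \<in> H" "x \<in> K" "a = h \<otimes> x" using a unfolding set_mult_def by blast
    then have "inv a = inv h \<otimes> inv x"
      using car comm by (metis inv_mult_group)
    then show ?thesis using hx H K by (auto intro!: set_multI subgroup.m_inv_closed)
  qed
  show "a \<otimes> b \<in> H <#> K" if ab: "a \<in> H <#> K" "b \<in> H <#> K" for a b
  proof -
    obtain h x where hx: "h \<in> H" "x \<in> K" "a = h \<otimes> x" using ab unfolding set_mult_def by blast
    obtain h' x' where hx': "h' \<in> H" "x' \<in> K" "b = h' \<otimes> x'" using ab unfolding set_mult_def by blast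
    have "a \<otimes> b = h \<otimes> (x \<otimes> h') \<otimes> x'" using hx hx' car by (simp add: m_assoc)
    also have "\<dots> = h \<otimes> (h' \<otimes> x) \<otimes> x'" using comm[of h' x] hx hx' by simp
    also have "\<dots> = (h \<otimes> h') \<otimes> (x \<otimes> x')" using hx hx' car by (simp add: m_assoc)
    finally show ?thesis
      using hx hx' H K by (auto intro!: set_multI subgroup.m_closed)
  qed
qed

end

section \<open>Projections of an internal direct product\<close>

locale direct_factors = group S for S (structure) +
  fixes T :: "nat \<Rightarrow> 'a set" and k :: nat and M :: "'a set"
  assumes direct: "is_direct_product S {1..k} T M"
begin

text \<open>Spelled like the two generated subgroups in the definition of \<open>sigma\<close>, so
  that folding it there turns projections into splittings over \<open>P I\<close> and
  \<open>P ({1..k} - I)\<close>.\<close>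

definition P :: "nat set \<Rightarrow> 'a set" where "P I = generate S (\<Union>i\<in>I. T i)"

abbreviation "\<sigma> \<equiv> sigma S T k"
abbreviation "sp \<equiv> supp S T k"

lemma T_subgroup: "i \<in> {1..k} \<Longrightarrow> subgroup (T i) S"
  using direct by (simp add: is_direct_product_def)

lemma T_Un_carrier: "I \<subseteq> {1..k} \<Longrightarrow> (\<Union>i\<in>I. T i) \<subseteq> carrier S"
  using T_subgroup subgroup.subset by blast

lemma P_subgroup: "I \<subseteq> {1..k} \<Longrightarrow> subgroup (P I) S"
  unfolding P_def by (intro generate_is_subgroup T_Un_carrier)

lemma P_carrier: "I \<subseteq> {1..k} \<Longrightarrow> x \<in> P I \<Longrightarrow> x \<in> carrier S"
  using P_subgroup subgroup.subset by blast

lemma P_mono: "I \<subseteq> J \<Longrightarrow> P I \<subseteq> P J"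
  unfolding P_def by (rule mono_generate) auto

lemma P_top: "P {1..k} = M"
  using direct by (simp add: is_direct_product_def P_def)

lemma P_empty: "P {} = {\<one>}"
  unfolding P_def by (simp add: generate_empty)

lemma P_singleton: "i \<in> {1..k} \<Longrightarrow> P {i} = T i"
  unfolding P_def using T_subgroup[of i]
  by (simp add: generateI[symmetric])

lemma P_sub_M: "I \<subseteq> {1..k} \<Longrightarrow> P I \<subseteq> M"
  using P_mono P_top by blast

lemma M_subgroup: "subgroup M S"
  using P_subgroup[of "{1..k}"] P_top by simp

lemma M_carrier: "x \<in> M \<Longrightarrow> x \<in> carrier S"
  using M_subgroup subgroup.subset by blast

lemma T_sub_P: "i \<in> I \<Longrightarrow> T i \<subseteq> P I"
  unfolding P_def by (auto intro: generate.incl)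

lemma P_commute:
  assumes "I \<subseteq> {1..k}" "J \<subseteq> {1..k}" "I \<inter> J = {}" "x \<in> P I" "y \<in> P J"
  shows "x \<otimes> y = y \<otimes> x"
proof (rule generate_commute[OF T_Un_carrier[OF assms(1)] T_Un_carrier[OF assms(2)]])
  fix x y assume "x \<in> (\<Union>i\<in>I. T i)" "y \<in> (\<Union>i\<in>J. T i)"
  then obtain i j where ij: "i \<in> I" "j \<in> J" "x \<in> T i" "y \<in> T j" by auto
  then have "i \<in> {1..k}" "j \<in> {1..k}" "i \<noteq> j" using assms(1-3) by auto
  moreover have "\<forall>i\<in>{1..k}. \<forall>j\<in>{1..k}. i \<noteq> j \<longrightarrow> (\<forall>x\<in>T i. \<forall>y\<in>T j. x \<otimes> y = y \<otimes> x)"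
    using direct unfolding is_direct_product_def by (elim conjE)
  ultimately show "x \<otimes> y = y \<otimes> x" using ij by simp
qed (use assms in \<open>auto simp: P_def\<close>)

lemma P_Un_split:
  assumes "I \<subseteq> {1..k}" "J \<subseteq> {1..k}" "I \<inter> J = {}" "x \<in> P (I \<union> J)"
  obtains a b where "a \<in> P I" "b \<in> P J" "x = a \<otimes> b"
proof -
  note sI = P_subgroup[OF assms(1)] and sJ = P_subgroup[OF assms(2)]
  have sub: "subgroup (P I <#> P J) S"
    by (rule commuting_set_mult_subgroup[OF sI sJ P_commute[OF assms(1-3)]])
  have "T i \<subseteq> P I <#> P J" if "i \<in> I \<union> J" for i
  proof
    fix x assume x: "x \<in> T i"
    have one: "\<one> \<in> P I" "\<one> \<in> P J" using sI sJ by (auto intro: subgroup.one_closed)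
    show "x \<in> P I <#> P J"
    proof (cases "i \<in> I")
      case True
      then have "x \<in> P I" using x T_sub_P by blast
      then show ?thesis using set_multI[of x "P I" \<one> "P J"] one P_carrier[OF assms(1)] by simp
    next
      case False
      then have "x \<in> P J" using x T_sub_P that by blast
      then show ?thesis using set_multI[of \<one> "P I" x "P J"] one P_carrier[OF assms(2)] by simp
    qed
  qed
  then have "P (I \<union> J) \<subseteq> P I <#> P J"
    unfolding P_def[of "I \<union> J"] by (intro generate_subgroup_incl[OF _ sub]) auto
  then have "x \<in> P I <#> P J" using assms(4) by blast
  then show ?thesis using that unfolding set_mult_iff by blast
qed

text \<open>Directness only says that a single factor meets the product of all the others trivially.
  Induction on \<open>I\<close> lifts this: if \<open>x = t y\<close> with \<open>t\<close> in the
  new factor and \<open>y\<close> in \<open>P I\<close>, then \<open>t = x y^-1\<close> lies in a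
  product avoiding the new factor, so \<open>t\<close> is trivial and \<open>x\<close> already lies
  in \<open>P I\<close>.\<close>

lemma P_disjoint:
  assumes "I \<subseteq> {1..k}" "J \<subseteq> {1..k}" "I \<inter> J = {}"
  shows "P I \<inter> P J = {\<one>}"
proof -
  have "finite I" using assms(1) finite_subset by blast
  then have "P I \<inter> P J \<subseteq> {\<one>}" using assms
  proof (induction I)
    case empty
    then show ?case by (simp add: P_empty)
  next
    case (insert i I)
    show ?case
    proof
      fix x assume x: "x \<in> P (insert i I) \<inter> P J"
      obtain t y where ty: "t \<in> P {i}" "y \<in> P I" "x = t \<otimes> y"
        using P_Un_split[of "{i}" I x] x insert by auto
      note sIJ = P_subgroup[of "I \<union> J"]
      have c: "t \<in> carrier S" "y \<in> carrier S" "x \<in> carrier S"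
        using ty x insert.prems P_carrier[of "{i}"] P_carrier[of I] P_carrier[of J] by auto
      have "y \<in> P (I \<union> J)" "x \<in> P (I \<union> J)" using P_mono[of I "I \<union> J"] P_mono[of J "I \<union> J"] ty x by auto
      moreover have "t = x \<otimes> inv y" using ty c by (simp add: m_assoc)
      ultimately have "t \<in> P (I \<union> J)"
        using sIJ insert.prems by (simp add: subgroup.m_closed subgroup.m_inv_closed)
      moreover have "I \<union> J \<subseteq> {1..k} - {i}" using insert by auto
      ultimately have "t \<in> P ({1..k} - {i})" using P_mono by blast
      moreover have "T i \<inter> P ({1..k} - {i}) = {\<one>}"
        using direct insert.prems(1) unfolding is_direct_product_def P_def by auto
      moreover have "t \<in> T i" using ty P_singleton[of i] insert.prems by auto
      ultimately have "t = \<one>" by auto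
      then have "x = y" using ty c by simp
      then show "x \<in> {\<one>}" using insert ty x by auto
    qed
  qed
  then show ?thesis using subgroup.one_closed[OF P_subgroup] assms by blast
qed

text \<open>The splitting over \<open>I\<close> and its complement is unique by
  \<open>P_disjoint\<close>. This discharges the definite description in \<open>sigma\<close>; from
  here on projections are computed by exhibiting a splitting.\<close>

lemma sigma_eq:
  assumes "I \<subseteq> {1..k}" "a \<in> P I" "b \<in> P ({1..k} - I)"
  shows "\<sigma> I (a \<otimes> b) = a"
  unfolding sigma_def P_def[symmetric]
proof (rule the_equality)
  show "a \<in> P I \<and> (\<exists>c\<in>P ({1..k} - I). a \<otimes> b = a \<otimes> c)" using assms by auto
next
  fix a' assume "a' \<in> P I \<and> (\<exists>c\<in>P ({1..k} - I). a \<otimes> b = a' \<otimes> c)"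
  then obtain c where c: "a' \<in> P I" "c \<in> P ({1..k} - I)" "a \<otimes> b = a' \<otimes> c" by auto
  have car: "a \<in> carrier S" "a' \<in> carrier S" "b \<in> carrier S" "c \<in> carrier S"
    using assms c P_carrier[of I] P_carrier[of "{1..k} - I"] by auto
  have "inv a' \<otimes> a = c \<otimes> inv b"
    using c(3) car by (metis inv_closed inv_solve_left inv_solve_right m_assoc m_closed)
  moreover have "inv a' \<otimes> a \<in> P I"
    using P_subgroup[OF assms(1)] assms c by (simp add: subgroup.m_closed subgroup.m_inv_closed)
  moreover have "c \<otimes> inv b \<in> P ({1..k} - I)"
    using P_subgroup[of "{1..k} - I"] assms c by (simp add: subgroup.m_closed subgroup.m_inv_closed)
  ultimately have "inv a' \<otimes> a = \<one>" using P_disjoint[of I "{1..k} - I"] assms(1) by auto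
  then show "a' = a" using car by (metis inv_closed inv_equality inv_inv)
qed

lemma sigma_split:
  assumes "I \<subseteq> {1..k}" "m \<in> M"
  obtains b where "\<sigma> I m \<in> P I" "b \<in> P ({1..k} - I)" "m = \<sigma> I m \<otimes> b"
proof -
  have "m \<in> P (I \<union> ({1..k} - I))" using assms P_top by (simp add: Un_absorb1)
  then obtain a b where "a \<in> P I" "b \<in> P ({1..k} - I)" "m = a \<otimes> b"
    using P_Un_split[of I "{1..k} - I" m] assms by auto
  then show ?thesis using that sigma_eq[OF assms(1)] by auto
qed

lemma sigma_P: "I \<subseteq> {1..k} \<Longrightarrow> m \<in> M \<Longrightarrow> \<sigma> I m \<in> P I"
  using sigma_split by metis

lemma sigma_M: "I \<subseteq> {1..k} \<Longrightarrow> m \<in> M \<Longrightarrow> \<sigma> I m \<in> M"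
  using sigma_P P_sub_M by blast

lemma sigma_carrier: "I \<subseteq> {1..k} \<Longrightarrow> m \<in> M \<Longrightarrow> \<sigma> I m \<in> carrier S"
  using sigma_M M_carrier by blast

lemma sigma_mult:
  assumes I: "I \<subseteq> {1..k}" and "x \<in> M" "y \<in> M"
  shows "\<sigma> I (x \<otimes> y) = \<sigma> I x \<otimes> \<sigma> I y"
proof -
  obtain b where b: "\<sigma> I x \<in> P I" "b \<in> P ({1..k} - I)" "x = \<sigma> I x \<otimes> b"
    using sigma_split[OF I assms(2)] by metis
  obtain c where c: "\<sigma> I y \<in> P I" "c \<in> P ({1..k} - I)" "y = \<sigma> I y \<otimes> c"
    using sigma_split[OF I assms(3)] by metis
  have car: "\<sigma> I x \<in> carrier S" "\<sigma> I y \<in> carrier S" "b \<in> carrier S" "c \<in> carrier S"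
    using assms b c P_carrier[of "{1..k} - I"] sigma_carrier by auto
  have comm: "b \<otimes> \<sigma> I y = \<sigma> I y \<otimes> b"
    by (rule P_commute[of "{1..k} - I" I]) (use I b c in auto)
  have "x \<otimes> y = (\<sigma> I x \<otimes> b) \<otimes> (\<sigma> I y \<otimes> c)" using b c by simp
  also have "\<dots> = \<sigma> I x \<otimes> (b \<otimes> \<sigma> I y) \<otimes> c" using car by (simp add: m_assoc)
  also have "\<dots> = (\<sigma> I x \<otimes> \<sigma> I y) \<otimes> (b \<otimes> c)" using car by (simp add: m_assoc comm)
  finally have "\<sigma> I (x \<otimes> y) = \<sigma> I ((\<sigma> I x \<otimes> \<sigma> I y) \<otimes> (b \<otimes> c))" by simp
  also have "\<dots> = \<sigma> I x \<otimes> \<sigma> I y"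
    using b c I by (intro sigma_eq) (auto intro: subgroup.m_closed[OF P_subgroup])
  finally show ?thesis .
qed

lemma sigma_hom: "I \<subseteq> {1..k} \<Longrightarrow> group_hom (S\<lparr>carrier := M\<rparr>) S (\<sigma> I)"
  by (intro group_hom.intro subgroup_imp_group M_subgroup group_hom_axioms.intro group_axioms)
    (auto simp: hom_def sigma_mult sigma_carrier)

lemma sigma_one: "I \<subseteq> {1..k} \<Longrightarrow> \<sigma> I \<one> = \<one>"
  using group_hom.hom_one[OF sigma_hom] by simp

lemma sigma_inv: "I \<subseteq> {1..k} \<Longrightarrow> x \<in> M \<Longrightarrow> \<sigma> I (inv x) = inv (\<sigma> I x)"
  using group_hom.hom_inv[OF sigma_hom, of I x] M_subgroup by simp

lemma sigma_id: "I \<subseteq> {1..k} \<Longrightarrow> x \<in> P I \<Longrightarrow> \<sigma> I x = x"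
  using sigma_eq[of I x \<one>] P_carrier[of I x] subgroup.one_closed[OF P_subgroup, of "{1..k} - I"] by simp

text \<open>Split \<open>m\<close> over the three disjoint index sets \<open>I \<inter> J\<close>,
  \<open>J - I\<close> and the complement of \<open>J\<close>; both sides pick out the first
  part.\<close>

lemma sigma_sigma:
  assumes "I \<subseteq> {1..k}" "J \<subseteq> {1..k}" "m \<in> M"
  shows "\<sigma> I (\<sigma> J m) = \<sigma> (I \<inter> J) m"
proof -
  obtain b where b: "\<sigma> J m \<in> P J" "b \<in> P ({1..k} - J)" "m = \<sigma> J m \<otimes> b"
    using sigma_split[OF assms(2,3)] by metis
  have "(I \<inter> J) \<union> (J - I) = J" by auto
  then have "\<sigma> J m \<in> P ((I \<inter> J) \<union> (J - I))" using b by simp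
  then obtain a c where ac: "a \<in> P (I \<inter> J)" "c \<in> P (J - I)" "\<sigma> J m = a \<otimes> c"
    using P_Un_split[of "I \<inter> J" "J - I"] assms by blast
  have "\<sigma> I (\<sigma> J m) = a" unfolding ac(3)
    using ac assms P_mono[of "I \<inter> J" I] P_mono[of "J - I" "{1..k} - I"] by (intro sigma_eq) auto
  have car: "a \<in> carrier S" "c \<in> carrier S" "b \<in> carrier S"
    using ac(1,2) b(2) assms(1,2) P_carrier by blast+
  have "c \<in> P ({1..k} - I \<inter> J)" "b \<in> P ({1..k} - I \<inter> J)"
    using ac b assms P_mono[of "J - I" "{1..k} - I \<inter> J"] P_mono[of "{1..k} - J" "{1..k} - I \<inter> J"] by auto
  then have "c \<otimes> b \<in> P ({1..k} - I \<inter> J)" by (auto intro: subgroup.m_closed[OF P_subgroup])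
  then have "\<sigma> (I \<inter> J) (a \<otimes> (c \<otimes> b)) = a"
    using ac assms by (intro sigma_eq) auto
  moreover have "m = a \<otimes> (c \<otimes> b)" using b(3) ac(3) car by (simp add: m_assoc)
  ultimately show ?thesis using \<open>\<sigma> I (\<sigma> J m) = a\<close> by simp
qed

lemma sigma_empty: "m \<in> M \<Longrightarrow> \<sigma> {} m = \<one>"
  using sigma_P[of "{}" m] P_empty by simp

lemma sigma_top: "m \<in> M \<Longrightarrow> \<sigma> {1..k} m = m"
  using sigma_id[of "{1..k}" m] P_top by simp

lemma sigma_Un:
  assumes "I \<subseteq> {1..k}" "J \<subseteq> {1..k}" "I \<inter> J = {}" "m \<in> M"
  shows "\<sigma> (I \<union> J) m = \<sigma> I m \<otimes> \<sigma> J m"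
proof -
  have "\<sigma> (I \<union> J) m \<in> P (I \<union> J)" using assms by (intro sigma_P) auto
  then obtain a b where ab: "a \<in> P I" "b \<in> P J" "\<sigma> (I \<union> J) m = a \<otimes> b"
    using P_Un_split[OF assms(1-3)] by metis
  have "\<sigma> I (\<sigma> (I \<union> J) m) = a" unfolding ab(3)
    using ab assms P_mono[of J "{1..k} - I"] by (intro sigma_eq) auto
  moreover have "\<sigma> J (\<sigma> (I \<union> J) m) = b" unfolding ab(3) P_commute[OF assms(1-3) ab(1,2)]
    using ab assms P_mono[of I "{1..k} - J"] by (intro sigma_eq) auto
  moreover have "I \<inter> (I \<union> J) = I" "J \<inter> (I \<union> J) = J" by auto
  ultimately show ?thesis
    using ab sigma_sigma[of I "I \<union> J" m] sigma_sigma[of J "I \<union> J" m] assms by auto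
qed

lemma sigma_disjoint:
  assumes "I \<subseteq> {1..k}" "J \<subseteq> {1..k}" "I \<inter> J = {}" "m \<in> P J"
  shows "\<sigma> I m = \<one>"
proof -
  have "m \<in> M" using P_sub_M assms by blast
  then have "\<sigma> I (\<sigma> J m) = \<one>" using sigma_sigma[OF assms(1,2)] assms(3) sigma_empty by simp
  then show ?thesis using sigma_id[OF assms(2,4)] by simp
qed

lemma sigma_eqI:
  assumes "I \<subseteq> {1..k}" "x \<in> M" "y \<in> M" "\<And>i. i \<in> I \<Longrightarrow> \<sigma> {i} x = \<sigma> {i} y"
  shows "\<sigma> I x = \<sigma> I y"
proof -
  have "finite I" using assms(1) finite_subset by blast
  then show ?thesis using assms(1,4)
  proof (induction I)
    case empty
    then show ?case using assms sigma_empty by simp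
  next
    case (insert i I)
    then show ?case using sigma_Un[of "{i}" I] assms by simp
  qed
qed

lemma M_eqI:
  assumes "x \<in> M" "y \<in> M" "\<And>i. i \<in> {1..k} \<Longrightarrow> \<sigma> {i} x = \<sigma> {i} y"
  shows "x = y"
  using sigma_eqI[of "{1..k}" x y] assms sigma_top by simp

section \<open>Supports, strips and involvement\<close>

lemma supp_sub: "sp X \<subseteq> {1..k}" unfolding supp_def by auto

lemma sigma_supp:
  assumes "X \<subseteq> M" "x \<in> X"
  shows "x \<in> P (sp X)"
proof -
  have "\<sigma> (sp X) x = x"
  proof (rule M_eqI)
    fix i assume i: "i \<in> {1..k}"
    have *: "\<sigma> {i} (\<sigma> (sp X) x) = \<sigma> ({i} \<inter> sp X) x"
      using sigma_sigma[of "{i}" "sp X" x] i supp_sub assms by auto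
    show "\<sigma> {i} (\<sigma> (sp X) x) = \<sigma> {i} x"
    proof (cases "i \<in> sp X")
      case True then show ?thesis using * by simp
    next
      case False
      then have "\<sigma> {i} x = \<one>" using i assms unfolding supp_def by blast
      then show ?thesis using * False sigma_empty assms by auto
    qed
  qed (use assms supp_sub sigma_M in auto)
  then show ?thesis using sigma_P[OF supp_sub, of x X] assms by auto
qed

text \<open>The case of empty \<open>X\<close> is excluded because the image of the empty set under
  a projection is not \<open>{\<one>}\<close>, so \<open>supp\<close> assigns to it all of
  \<open>{1..k}\<close>.\<close>

lemma supp_subset_iff:
  assumes "X \<subseteq> M" "I \<subseteq> {1..k}" "X \<noteq> {}"
  shows "X \<subseteq> P I \<longleftrightarrow> sp X \<subseteq> I"
proof
  assume *: "X \<subseteq> P I"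
  show "sp X \<subseteq> I"
  proof
    fix i assume i: "i \<in> sp X"
    then have "i \<in> {1..k}" "\<sigma> {i} ` X \<noteq> {\<one>}" unfolding supp_def by auto
    then obtain x where "x \<in> X" "\<sigma> {i} x \<noteq> \<one>" using assms by force
    then show "i \<in> I" using sigma_disjoint[of "{i}" I x] * assms \<open>i \<in> {1..k}\<close> by auto
  qed
next
  assume "sp X \<subseteq> I"
  then show "X \<subseteq> P I" using sigma_supp[OF assms(1)] P_mono by blast
qed

lemma supp_iff:
  assumes "subgroup X S" "X \<subseteq> M"
  shows "i \<in> sp X \<longleftrightarrow> i \<in> {1..k} \<and> (\<exists>x\<in>X. \<sigma> {i} x \<noteq> \<one>)"
  using subgroup.one_closed[OF assms(1)] unfolding supp_def by force

lemma supp_empty_iff: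
  assumes "subgroup X S" "X \<subseteq> M"
  shows "sp X = {} \<longleftrightarrow> X = {\<one>}"
proof
  assume "sp X = {}"
  then have "x = \<one>" if "x \<in> X" for x using sigma_supp[OF assms(2) that] P_empty by simp
  then show "X = {\<one>}" using subgroup.one_closed[OF assms(1)] by blast
next
  assume "X = {\<one>}"
  then show "sp X = {}" using sigma_one by (auto simp: supp_def)
qed

text \<open>A strip is defined by an abstract isomorphism with its images. Such an isomorphism
  forces equal cardinalities, and by finiteness the projection itself is then injective. All later
  arguments about strips use this form.\<close>

lemma strip_iff_inj:
  assumes "finite M"
  shows "strip S M T k X \<longleftrightarrow> subgroup X S \<and> X \<subseteq> M \<and> (\<forall>i\<in>sp X. inj_on (\<sigma> {i}) X)"
proof -
  have "inj_on (\<sigma> {i}) X \<longleftrightarrow> S\<lparr>carrier := \<sigma> {i} ` X\<rparr> \<cong> S\<lparr>carrier := X\<rparr>"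
    if X: "subgroup X S" "X \<subseteq> M" and i: "i \<in> {1..k}" for i
  proof
    assume inj: "inj_on (\<sigma> {i}) X"
    have "\<sigma> {i} \<in> iso (S\<lparr>carrier := X\<rparr>) (S\<lparr>carrier := \<sigma> {i} ` X\<rparr>)"
      unfolding iso_def hom_def bij_betw_def using inj X i sigma_mult[of "{i}"] by (auto simp: subset_iff)
    then show "S\<lparr>carrier := \<sigma> {i} ` X\<rparr> \<cong> S\<lparr>carrier := X\<rparr>"
      using group.iso_sym[OF subgroup_imp_group[OF X(1)]] unfolding is_iso_def by blast
  next
    assume "S\<lparr>carrier := \<sigma> {i} ` X\<rparr> \<cong> S\<lparr>carrier := X\<rparr>"
    then obtain f where "bij_betw f (\<sigma> {i} ` X) X" unfolding is_iso_def iso_def by auto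
    then have "card (\<sigma> {i} ` X) = card X" by (rule bij_betw_same_card)
    then show "inj_on (\<sigma> {i}) X" using finite_subset[OF X(2) assms] by (intro eq_card_imp_inj_on)
  qed
  then show ?thesis unfolding strip_def supp_def by fast
qed

lemma involved_sigma:
  assumes "X \<subseteq> M" "K \<subseteq> M" "\<one> \<in> K" "involved_in S T k X K"
  shows "\<sigma> (sp X) ` K = X" "X \<subseteq> K"
proof -
  let ?J = "{1..k} - sp X"
  have K: "K = X <#> (\<sigma> ?J ` K)" using assms(4) by (simp add: involved_in_def)
  have X: "x \<in> carrier S" if "x \<in> X" for x using assms M_carrier that by auto
  have sx: "\<sigma> (sp X) (x \<otimes> \<sigma> ?J y) = x" if "x \<in> X" "y \<in> K" for x y
    using sigma_eq[OF supp_sub sigma_supp] assms that sigma_P[of ?J y] by auto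
  show "X \<subseteq> K"
  proof
    fix x assume x: "x \<in> X"
    have "x = x \<otimes> \<sigma> ?J \<one>" using X x sigma_one[of ?J] by simp
    then have "x \<in> X <#> (\<sigma> ?J ` K)" using x assms(3) unfolding set_mult_def by auto
    then show "x \<in> K" using K by simp
  qed
  show "\<sigma> (sp X) ` K = X"
  proof
    show "\<sigma> (sp X) ` K \<subseteq> X"
    proof
      fix a assume "a \<in> \<sigma> (sp X) ` K"
      then obtain y where "y \<in> K" "a = \<sigma> (sp X) y" by auto
      moreover obtain x z where "x \<in> X" "z \<in> K" "y = x \<otimes> \<sigma> ?J z"
        using \<open>y \<in> K\<close> K unfolding set_mult_def by blast
      ultimately show "a \<in> X" using sx by simp
    qed
    show "X \<subseteq> \<sigma> (sp X) ` K"
      using \<open>X \<subseteq> K\<close> sigma_id[OF supp_sub sigma_supp[OF assms(1)]] by force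
  qed
qed

text \<open>Once \<open>K\<close> contains its own projection \<open>X\<close>, it also contains the
  complementary projections, since each element is the product of its two projections; this gives
  the required product decomposition.\<close>

lemma involved_iff:
  assumes "subgroup X S" "X \<subseteq> M" "subgroup K S" "K \<subseteq> M"
  shows "involved_in S T k X K \<longleftrightarrow> \<sigma> (sp X) ` K = X \<and> X \<subseteq> K"
proof
  assume "involved_in S T k X K"
  then show "\<sigma> (sp X) ` K = X \<and> X \<subseteq> K"
    using involved_sigma assms subgroup.one_closed by metis
next
  let ?J = "{1..k} - sp X"
  assume *: "\<sigma> (sp X) ` K = X \<and> X \<subseteq> K"
  have split: "x = \<sigma> (sp X) x \<otimes> \<sigma> ?J x" if "x \<in> M" for x
    using sigma_Un[of "sp X" ?J x] supp_sub that sigma_top by (simp add: Un_absorb1)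
  have J: "\<sigma> ?J x \<in> K" if "x \<in> K" for x
  proof -
    have "x \<in> M" using that assms by auto
    then have "\<sigma> ?J x = inv (\<sigma> (sp X) x) \<otimes> x"
      using split[of x] sigma_carrier[OF supp_sub] sigma_carrier[of ?J x] M_carrier
      by (metis Diff_subset inv_solve_left)
    moreover have "\<sigma> (sp X) x \<in> K" using * that by auto
    ultimately show ?thesis using that assms(3) by (simp add: subgroup.m_closed subgroup.m_inv_closed)
  qed
  show "involved_in S T k X K" unfolding involved_in_def
  proof
    show "K \<subseteq> X <#> (\<sigma> ?J ` K)"
    proof
      fix y assume y: "y \<in> K"
      then have "\<sigma> (sp X) y \<otimes> \<sigma> ?J y \<in> X <#> (\<sigma> ?J ` K)" using * by (intro set_multI) auto
      moreover have "y \<in> M" using y assms by blast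
      ultimately show "y \<in> X <#> (\<sigma> ?J ` K)" using split[of y] by simp
    qed
    show "X <#> (\<sigma> ?J ` K) \<subseteq> K"
      using J * subgroup.m_closed[OF assms(3)] unfolding set_mult_def by blast
  qed
qed

end

section \<open>Permuting the factors, and grouping them into blocks\<close>

context direct_factors begin

text \<open>The induced permutation of indices is kept as an explicit witness, because supports are
  sets of indices and have to be transported along it.\<close>

definition permutes_factors :: "'a \<Rightarrow> (nat \<Rightarrow> nat) \<Rightarrow> bool" where
  "permutes_factors g \<pi> \<longleftrightarrow> g \<in> carrier S \<and> bij_betw \<pi> {1..k} {1..k} \<and>
    (\<forall>i\<in>{1..k}. conj_by S g (T i) = T (\<pi> i))"

context
  fixes g \<pi> assumes g: "permutes_factors g \<pi>"
begin

lemma perm_carrier: "g \<in> carrier S" and perm_bij: "bij_betw \<pi> {1..k} {1..k}"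
  and perm_T: "i \<in> {1..k} \<Longrightarrow> conj_by S g (T i) = T (\<pi> i)"
  using g unfolding permutes_factors_def by auto

lemma perm_inj: "inj_on \<pi> {1..k}" and perm_image: "\<pi> ` {1..k} = {1..k}"
  using perm_bij unfolding bij_betw_def by auto

lemma perm_in: "i \<in> {1..k} \<Longrightarrow> \<pi> i \<in> {1..k}"
  using perm_image by blast

lemma perm_sub: "I \<subseteq> {1..k} \<Longrightarrow> \<pi> ` I \<subseteq> {1..k}"
  using perm_in by blast

lemma conj_P:
  assumes "I \<subseteq> {1..k}"
  shows "conj_by S g (P I) = P (\<pi> ` I)"
proof -
  have "conj_by S g (\<Union>i\<in>I. T i) = (\<Union>i\<in>I. conj_by S g (T i))"
    unfolding conj_by_image by auto
  also have "\<dots> = (\<Union>i\<in>\<pi> ` I. T i)" using perm_T assms by (auto simp: subset_iff)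
  finally show ?thesis unfolding P_def
    using conj_by_generate[OF perm_carrier T_Un_carrier[OF assms]] by simp
qed

lemma conj_in_P: "I \<subseteq> {1..k} \<Longrightarrow> x \<in> P I \<Longrightarrow> g \<otimes> x \<otimes> inv g \<in> P (\<pi> ` I)"
  using conj_P[of I] unfolding conj_by_image by blast

lemma conj_M: "conj_by S g M = M"
  using conj_P[of "{1..k}"] P_top perm_image by simp

lemma conj_in_M: "x \<in> M \<Longrightarrow> g \<otimes> x \<otimes> inv g \<in> M"
  using conj_M unfolding conj_by_image by blast

text \<open>Conjugation sends the splitting of \<open>m\<close> over \<open>I\<close> and its
  complement to a splitting over the image of \<open>I\<close> under \<open>\<pi>\<close> and its
  complement, so \<open>sigma_eq\<close> applies.\<close>

lemma conj_sigma:
  assumes "I \<subseteq> {1..k}" "m \<in> M"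
  shows "\<sigma> (\<pi> ` I) (g \<otimes> m \<otimes> inv g) = g \<otimes> \<sigma> I m \<otimes> inv g"
proof -
  obtain b where b: "\<sigma> I m \<in> P I" "b \<in> P ({1..k} - I)" "m = \<sigma> I m \<otimes> b"
    using sigma_split[OF assms] by metis
  have "\<pi> ` ({1..k} - I) = {1..k} - \<pi> ` I"
    using inj_on_image_set_diff[OF perm_inj, of "{1..k}" I] assms(1) perm_image by auto
  then have c: "g \<otimes> b \<otimes> inv g \<in> P ({1..k} - \<pi> ` I)" using conj_in_P[OF _ b(2)] by simp
  have "b \<in> carrier S" using b(2) P_carrier by blast
  then have "g \<otimes> (\<sigma> I m \<otimes> b) \<otimes> inv g = (g \<otimes> \<sigma> I m \<otimes> inv g) \<otimes> (g \<otimes> b \<otimes> inv g)"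
    using conj_mult[OF perm_carrier] sigma_carrier[OF assms] by blast
  then have "\<sigma> (\<pi> ` I) (g \<otimes> (\<sigma> I m \<otimes> b) \<otimes> inv g) = g \<otimes> \<sigma> I m \<otimes> inv g"
    using sigma_eq[OF perm_sub[OF assms(1)] conj_in_P[OF assms(1) b(1)] c] by simp
  then show ?thesis using b(3) by simp
qed

lemma conj_sigma_image:
  assumes "I \<subseteq> {1..k}" "X \<subseteq> M"
  shows "\<sigma> (\<pi> ` I) ` conj_by S g X = conj_by S g (\<sigma> I ` X)"
  unfolding conj_by_image image_image using assms conj_sigma by (intro image_cong) auto

lemma conj_sub_M: "X \<subseteq> M \<Longrightarrow> conj_by S g X \<subseteq> M"
  using conj_in_M unfolding conj_by_image by blast

lemma conj_eq_one_iff: "x \<in> carrier S \<Longrightarrow> g \<otimes> x \<otimes> inv g = \<one> \<longleftrightarrow> x = \<one>"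
  using inj_onD[OF conj_inj[OF perm_carrier], of x \<one>] perm_carrier by auto

lemma conj_supp:
  assumes "subgroup X S" "X \<subseteq> M"
  shows "sp (conj_by S g X) = \<pi> ` sp X"
proof -
  have *: "\<pi> i \<in> sp (conj_by S g X) \<longleftrightarrow> i \<in> sp X" if i: "i \<in> {1..k}" for i
  proof -
    have "\<sigma> {\<pi> i} (g \<otimes> x \<otimes> inv g) = \<one> \<longleftrightarrow> \<sigma> {i} x = \<one>" if "x \<in> X" for x
      using conj_sigma[of "{i}" x] conj_eq_one_iff[of "\<sigma> {i} x"] sigma_carrier[of "{i}" x] i that assms by auto
    then show ?thesis
      unfolding supp_iff[OF assms] supp_iff[OF conj_by_subgroup[OF perm_carrier assms(1)] conj_sub_M[OF assms(2)]]
      using i perm_in[OF i] by (simp add: conj_by_image)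
  qed
  show ?thesis
  proof
    show "sp (conj_by S g X) \<subseteq> \<pi> ` sp X"
    proof
      fix j assume j: "j \<in> sp (conj_by S g X)"
      then obtain i where "i \<in> {1..k}" "j = \<pi> i" using supp_sub perm_image by blast
      then show "j \<in> \<pi> ` sp X" using * j by blast
    qed
    show "\<pi> ` sp X \<subseteq> sp (conj_by S g X)" using * supp_sub by blast
  qed
qed

lemma conj_strip:
  assumes "finite M" "strip S M T k X"
  shows "strip S M T k (conj_by S g X)"
proof -
  have X: "subgroup X S" "X \<subseteq> M" "\<And>i. i \<in> sp X \<Longrightarrow> inj_on (\<sigma> {i}) X"
    using assms strip_iff_inj by auto
  have "inj_on (\<sigma> {j}) (conj_by S g X)" if j: "j \<in> \<pi> ` sp X" for j
  proof -
    obtain i where i: "i \<in> sp X" "j = \<pi> i" "i \<in> {1..k}" using j supp_sub[of X] by blast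
    have eq: "\<sigma> {j} (g \<otimes> x \<otimes> inv g) = g \<otimes> \<sigma> {i} x \<otimes> inv g" if "x \<in> X" for x
      using conj_sigma[of "{i}" x] that X i by auto
    have car: "\<sigma> {i} x \<in> carrier S" if "x \<in> X" for x
      using sigma_carrier[of "{i}" x] that X i by auto
    show ?thesis unfolding conj_by_image
    proof (rule inj_onI, clarify)
      fix x y assume xy: "x \<in> X" "y \<in> X" "\<sigma> {j} (g \<otimes> x \<otimes> inv g) = \<sigma> {j} (g \<otimes> y \<otimes> inv g)"
      then have "\<sigma> {i} x = \<sigma> {i} y"
        using inj_onD[OF conj_inj[OF perm_carrier]] eq car by simp
      then have "x = y" using inj_onD[OF X(3)[OF i(1)]] xy(1,2) by blast
      then show "g \<otimes> x \<otimes> inv g = g \<otimes> y \<otimes> inv g" by simp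
    qed
  qed
  then show ?thesis
    using strip_iff_inj[OF assms(1)] X conj_by_subgroup[OF perm_carrier X(1)] conj_sub_M[OF X(2)]
      conj_supp[OF X(1,2)] by simp
qed

lemma conj_full_strip:
  assumes "finite M" "full_strip S M T k X"
  shows "full_strip S M T k (conj_by S g X)"
proof -
  have X: "strip S M T k X" "subgroup X S" "X \<subseteq> M" "\<And>i. i \<in> sp X \<Longrightarrow> \<sigma> {i} ` X = T i"
    using assms unfolding full_strip_def strip_def by auto
  have "\<sigma> {\<pi> i} ` conj_by S g X = T (\<pi> i)" if "i \<in> sp X" for i
  proof -
    have i: "i \<in> {1..k}" using that supp_sub by blast
    then show ?thesis using conj_sigma_image[of "{i}" X] X(3) X(4)[OF that] perm_T[OF i] by simp
  qed
  then show ?thesis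
    using conj_supp[OF X(2,3)] conj_strip[OF assms(1) X(1)] unfolding full_strip_def by auto
qed

end

text \<open>Any one coordinate in the support determines the elements of a strip. This rigidity is
  the source of all later identifications of strips.\<close>

lemma strip_subset_eq:
  assumes "finite M" "strip S M T k Z" "i \<in> sp Z" "Y \<subseteq> Z" "\<sigma> {i} ` Y = \<sigma> {i} ` Z"
  shows "Y = Z"
proof -
  have "inj_on (\<sigma> {i}) Z" using assms strip_iff_inj by auto
  then show ?thesis using assms(4,5) by (metis inj_on_image_eq_iff subset_refl)
qed

lemma sigma_image_sigma:
  assumes "I \<subseteq> J" "J \<subseteq> {1..k}" "X \<subseteq> M"
  shows "\<sigma> I ` \<sigma> J ` X = \<sigma> I ` X"
  unfolding image_image using assms sigma_sigma[of I J] by (intro image_cong) (auto simp: Int_absorb2)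

lemma sigma_image_id:
  assumes "I \<subseteq> {1..k}" "X \<subseteq> P I"
  shows "\<sigma> I ` X = X"
proof -
  have "\<sigma> I ` X = (\<lambda>x. x) ` X"
    by (rule image_cong[OF refl]) (use assms sigma_id in blast)
  then show ?thesis by simp
qed

end

text \<open>The blocks are indexed by an abstract set \<open>B\<close>; in the application the
  strips of the point stabiliser serve as indices and \<open>\<beta>\<close> is their
  support.\<close>

locale factor_blocks = direct_factors S T k M
  for S (structure) and T :: "nat \<Rightarrow> 'a set" and k and M +
  fixes B :: "'i set" and \<beta> :: "'i \<Rightarrow> nat set"
  assumes finite_B: "finite B" and cover: "(\<Union>b\<in>B. \<beta> b) = {1..k}"
    and block_disj: "\<And>b c. b \<in> B \<Longrightarrow> c \<in> B \<Longrightarrow> b \<noteq> c \<Longrightarrow> \<beta> b \<inter> \<beta> c = {}"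
begin

lemma block_sub: "b \<in> B \<Longrightarrow> \<beta> b \<subseteq> {1..k}" using cover by auto

text \<open>Coordinates over distinct blocks can be prescribed independently: multiply the
  components together one block at a time, each being invisible to the projections onto the other
  blocks.\<close>

lemma glue:
  assumes "\<And>b. b \<in> B \<Longrightarrow> f b \<in> P (\<beta> b)"
  obtains m where "m \<in> M" "\<And>b. b \<in> B \<Longrightarrow> \<sigma> (\<beta> b) m = f b"
proof -
  have "\<exists>m\<in>P (\<Union>b\<in>J. \<beta> b). \<forall>b\<in>J. \<sigma> (\<beta> b) m = f b" if "finite J" "J \<subseteq> B" for J
    using that
  proof (induction J)
    case empty
    then show ?case using P_empty by simp
  next
    case (insert c J)
    let ?U = "\<Union>b\<in>J. \<beta> b"
    obtain m where m: "m \<in> P ?U" "\<And>b. b \<in> J \<Longrightarrow> \<sigma> (\<beta> b) m = f b" using insert by auto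
    have c: "c \<in> B" "f c \<in> P (\<beta> c)" "\<beta> c \<subseteq> {1..k}" using insert.prems assms block_sub by auto
    have U: "?U \<subseteq> {1..k}" using insert.prems block_sub by blast
    have disj: "\<beta> c \<inter> \<beta> b = {}" if "b \<in> J" for b
      using block_disj[of c b] that insert by auto
    have Mm: "m \<in> M" "f c \<in> M" using m P_sub_M[OF U] c P_sub_M[OF c(3)] by auto
    have "f c \<otimes> m \<in> P (\<beta> c \<union> ?U)"
    proof (rule subgroup.m_closed[OF P_subgroup])
      show "\<beta> c \<union> ?U \<subseteq> {1..k}" using c U by auto
      show "f c \<in> P (\<beta> c \<union> ?U)" using c(2) P_mono[of "\<beta> c"] by blast
      show "m \<in> P (\<beta> c \<union> ?U)" using m(1) P_mono[of ?U] by blast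
    qed
    moreover have "\<sigma> (\<beta> c) (f c \<otimes> m) = f c"
    proof -
      have "\<sigma> (\<beta> c) m = \<one>" by (rule sigma_disjoint[OF c(3) U _ m(1)]) (use disj in auto)
      then show ?thesis
        using sigma_mult[OF c(3) Mm(2,1)] sigma_id[OF c(3,2)] M_carrier[OF Mm(2)] by simp
    qed
    moreover have "\<sigma> (\<beta> b) (f c \<otimes> m) = f b" if "b \<in> J" for b
    proof -
      have b: "\<beta> b \<subseteq> {1..k}" "b \<in> B" using that insert.prems block_sub by auto
      have "\<sigma> (\<beta> b) (f c) = \<one>" by (rule sigma_disjoint[OF b(1) c(3) _ c(2)]) (use disj that in auto)
      then show ?thesis
        using sigma_mult[OF b(1) Mm(2,1)] m(2)[OF that] P_carrier[OF b(1) assms[OF b(2)]] by simp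
    qed
    ultimately show ?case by (intro bexI[of _ "f c \<otimes> m"]) auto
  qed
  from this[OF finite_B] obtain m where "m \<in> M" "\<forall>b\<in>B. \<sigma> (\<beta> b) m = f b"
    unfolding cover P_top by blast
  then show ?thesis using that by blast
qed

lemma block_eqI:
  assumes "x \<in> M" "y \<in> M" "\<And>b. b \<in> B \<Longrightarrow> \<sigma> (\<beta> b) x = \<sigma> (\<beta> b) y"
  shows "x = y"
proof (rule M_eqI[OF assms(1,2)])
  fix i assume i: "i \<in> {1..k}"
  then obtain b where b: "b \<in> B" "i \<in> \<beta> b" using cover by blast
  then have "{i} \<inter> \<beta> b = {i}" by auto
  then have "\<sigma> {i} (\<sigma> (\<beta> b) z) = \<sigma> {i} z" if "z \<in> M" for z
    using sigma_sigma[of "{i}" "\<beta> b" z] i block_sub[OF b(1)] that by auto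
  then show "\<sigma> {i} x = \<sigma> {i} y" using assms b by metis
qed

text \<open>The product of the components, described by membership tests instead of generators: with
  this form intersections of several products are computed block by block.
  \<open>generate_eq_block_prod\<close> links it to the generated subgroup.\<close>

definition block_prod :: "('i \<Rightarrow> 'a set) \<Rightarrow> 'a set" where
  "block_prod K = {x \<in> M. \<forall>b\<in>B. \<sigma> (\<beta> b) x \<in> K b}"

lemma block_prod_sub_M: "block_prod K \<subseteq> M" unfolding block_prod_def by auto

lemma block_prod_subgroup:
  assumes "\<And>b. b \<in> B \<Longrightarrow> subgroup (K b) S"
  shows "subgroup (block_prod K) S"
proof (rule subgroupI)
  show "block_prod K \<subseteq> carrier S" using M_carrier unfolding block_prod_def by auto
  have "\<one> \<in> block_prod K" unfolding block_prod_def
    using sigma_one block_sub subgroup.one_closed[OF assms] subgroup.one_closed[OF M_subgroup] by simp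
  then show "block_prod K \<noteq> {}" by auto
next
  fix a assume "a \<in> block_prod K"
  then show "inv a \<in> block_prod K" unfolding block_prod_def
    using sigma_inv block_sub subgroup.m_inv_closed[OF assms] subgroup.m_inv_closed[OF M_subgroup] by auto
next
  fix a b assume "a \<in> block_prod K" "b \<in> block_prod K"
  then show "a \<otimes> b \<in> block_prod K" unfolding block_prod_def
    using sigma_mult block_sub subgroup.m_closed[OF assms] subgroup.m_closed[OF M_subgroup] by auto
qed

lemma part_sub_block_prod:
  assumes K: "\<And>b. b \<in> B \<Longrightarrow> subgroup (K b) S" "\<And>b. b \<in> B \<Longrightarrow> K b \<subseteq> P (\<beta> b)" and b: "b \<in> B"
  shows "K b \<subseteq> block_prod K"
proof
  fix x assume x: "x \<in> K b"
  have "\<sigma> (\<beta> c) x \<in> K c" if c: "c \<in> B" for c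
  proof (cases "c = b")
    case True
    then show ?thesis using x K(2)[OF b] sigma_id[OF block_sub[OF b]] by auto
  next
    case False
    then have "\<sigma> (\<beta> c) x = \<one>"
      using sigma_disjoint[OF block_sub[OF c] block_sub[OF b] block_disj[OF c b]] x K(2)[OF b] by auto
    then show ?thesis using subgroup.one_closed[OF K(1)[OF c]] by simp
  qed
  then show "x \<in> block_prod K" unfolding block_prod_def
    using x K(2)[OF b] P_sub_M[OF block_sub[OF b]] by auto
qed

text \<open>For the inclusion that is not immediate, an element is reassembled from its block
  projections by \<open>sigma_Un\<close>, adding one block at a time.\<close>

lemma generate_eq_block_prod:
  assumes K: "\<And>b. b \<in> B \<Longrightarrow> subgroup (K b) S" "\<And>b. b \<in> B \<Longrightarrow> K b \<subseteq> P (\<beta> b)"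
  shows "generate S (\<Union>b\<in>B. K b) = block_prod K"
proof
  show "generate S (\<Union>b\<in>B. K b) \<subseteq> block_prod K"
    using part_sub_block_prod[OF K] by (intro generate_subgroup_incl block_prod_subgroup K) auto
  show "block_prod K \<subseteq> generate S (\<Union>b\<in>B. K b)"
  proof
    fix x assume x: "x \<in> block_prod K"
    let ?H = "generate S (\<Union>b\<in>B. K b)"
    have H: "subgroup ?H S"
      using K(1) by (intro generate_is_subgroup UN_least subgroup.subset)
    have xM: "x \<in> M" using x block_prod_sub_M by auto
    have "\<sigma> (\<Union>b\<in>J. \<beta> b) x \<in> ?H" if "finite J" "J \<subseteq> B" for J
      using that
    proof (induction J)
      case empty
      then show ?case using sigma_empty xM subgroup.one_closed[OF H] by simp
    next
      case (insert c J)
      have "\<beta> c \<inter> (\<Union>b\<in>J. \<beta> b) = {}" using block_disj[of c] insert by blast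
      then have "\<sigma> (\<beta> c \<union> (\<Union>b\<in>J. \<beta> b)) x = \<sigma> (\<beta> c) x \<otimes> \<sigma> (\<Union>b\<in>J. \<beta> b) x"
        using insert.prems block_sub xM by (intro sigma_Un UN_least) (auto simp del: atLeastAtMost_iff)
      moreover have "\<sigma> (\<beta> c) x \<in> ?H"
        using x insert.prems unfolding block_prod_def by (auto intro: generate.incl)
      ultimately show ?case using insert subgroup.m_closed[OF H] by simp
    qed
    from this[OF finite_B] show "x \<in> ?H" using cover sigma_top[OF xM] by simp
  qed
qed

lemma sigma_block_prod:
  assumes K: "\<And>b. b \<in> B \<Longrightarrow> subgroup (K b) S" "\<And>b. b \<in> B \<Longrightarrow> K b \<subseteq> P (\<beta> b)" and b: "b \<in> B"
  shows "\<sigma> (\<beta> b) ` block_prod K = K b"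
proof
  show "\<sigma> (\<beta> b) ` block_prod K \<subseteq> K b" using b unfolding block_prod_def by auto
  show "K b \<subseteq> \<sigma> (\<beta> b) ` block_prod K"
    using part_sub_block_prod[OF K b] sigma_image_id[OF block_sub[OF b] K(2)[OF b]] by blast
qed

lemma sigma_block_prod_sub:
  assumes K: "\<And>b. b \<in> B \<Longrightarrow> subgroup (K b) S" "\<And>b. b \<in> B \<Longrightarrow> K b \<subseteq> P (\<beta> b)"
    and b: "b \<in> B" and I: "I \<subseteq> \<beta> b"
  shows "\<sigma> I ` block_prod K = \<sigma> I ` K b"
  using sigma_image_sigma[OF I block_sub[OF b] block_prod_sub_M, of K] sigma_block_prod[OF K b] by simp

text \<open>Factorise each block projection of \<open>m\<close> separately and glue the left parts
  and the right parts.\<close>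

lemma block_prod_mult_eq_M:
  assumes "\<And>b. b \<in> B \<Longrightarrow> K b \<subseteq> P (\<beta> b)" "\<And>b. b \<in> B \<Longrightarrow> L b \<subseteq> P (\<beta> b)"
    and KL: "\<And>b. b \<in> B \<Longrightarrow> K b <#> L b = P (\<beta> b)"
  shows "block_prod K <#> block_prod L = M"
proof
  show "block_prod K <#> block_prod L \<subseteq> M"
    unfolding set_mult_def using block_prod_sub_M subgroup.m_closed[OF M_subgroup] by blast
  show "M \<subseteq> block_prod K <#> block_prod L"
  proof
    fix m assume m: "m \<in> M"
    have "\<exists>p q. p \<in> K b \<and> q \<in> L b \<and> \<sigma> (\<beta> b) m = p \<otimes> q" if "b \<in> B" for b
      using sigma_P[OF block_sub[OF that] m] KL[OF that] set_mult_iff by blast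
    then obtain p q where pq: "\<And>b. b \<in> B \<Longrightarrow> p b \<in> K b \<and> q b \<in> L b \<and> \<sigma> (\<beta> b) m = p b \<otimes> q b"
      by metis
    obtain x where x: "x \<in> M" "\<And>b. b \<in> B \<Longrightarrow> \<sigma> (\<beta> b) x = p b"
      using glue[of p] pq assms(1) by blast
    obtain y where y: "y \<in> M" "\<And>b. b \<in> B \<Longrightarrow> \<sigma> (\<beta> b) y = q b"
      using glue[of q] pq assms(2) by blast
    have "m = x \<otimes> y"
      by (rule block_eqI[OF m]) (use x y pq sigma_mult block_sub subgroup.m_closed[OF M_subgroup] in auto)
    moreover have "x \<in> block_prod K" "y \<in> block_prod L" using x y pq unfolding block_prod_def by auto
    ultimately show "m \<in> block_prod K <#> block_prod L" by (auto intro: set_multI)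
  qed
qed

text \<open>The component \<open>K b\<close> alone already produces the full \<open>i\<close>-th
  coordinate of \<open>Z\<close>. Its projection to the support of \<open>Z\<close> is a subset of
  the strip \<open>Z\<close> with that same coordinate image, hence all of \<open>Z\<close>; and
  elements of \<open>K b\<close> have no coordinates outside \<open>\<beta> b\<close>.\<close>

lemma strip_involved_block:
  assumes fin: "finite M"
    and K: "\<And>b. b \<in> B \<Longrightarrow> subgroup (K b) S" "\<And>b. b \<in> B \<Longrightarrow> K b \<subseteq> P (\<beta> b)"
    and Z: "strip S M T k Z" "involved_in S T k Z (block_prod K)"
    and i: "i \<in> sp Z" "i \<in> \<beta> b" "b \<in> B"
  shows "sp Z \<subseteq> \<beta> b" "\<sigma> (sp Z) ` K b = Z"
proof -
  have Zs: "subgroup Z S" "Z \<subseteq> M" using Z unfolding strip_def by auto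
  have Zeq: "\<sigma> (sp Z) ` block_prod K = Z"
    using involved_iff[OF Zs block_prod_subgroup block_prod_sub_M] K Z by auto
  have KM: "K b \<subseteq> M" using K(2)[OF i(3)] P_sub_M[OF block_sub[OF i(3)]] by auto
  have sub: "\<sigma> (sp Z) ` K b \<subseteq> Z" using part_sub_block_prod[OF K i(3)] Zeq by blast
  have "\<sigma> {i} ` \<sigma> (sp Z) ` K b = \<sigma> {i} ` K b"
    using sigma_image_sigma[OF _ supp_sub KM, of "{i}" Z] i by simp
  also have "\<dots> = \<sigma> {i} ` block_prod K"
    using sigma_block_prod_sub[OF K i(3), of "{i}"] i by simp
  also have "\<dots> = \<sigma> {i} ` Z"
    using sigma_image_sigma[OF _ supp_sub block_prod_sub_M, of "{i}" Z K] i Zeq by simp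
  finally show eq: "\<sigma> (sp Z) ` K b = Z"
    using strip_subset_eq[OF fin Z(1) i(1) sub] by simp
  have "Z \<subseteq> P (\<beta> b)"
  proof
    fix z assume "z \<in> Z"
    then obtain x where x: "x \<in> K b" "z = \<sigma> (sp Z) x" using eq by blast
    have "x \<in> M" "x \<in> P (\<beta> b)" using x KM K(2) i by auto
    then have "\<sigma> (sp Z) x = \<sigma> (sp Z \<inter> \<beta> b) x"
      using sigma_sigma[OF supp_sub block_sub[OF i(3)], of x Z] sigma_id[OF block_sub[OF i(3)]] by simp
    also have "\<dots> \<in> P (sp Z \<inter> \<beta> b)" using supp_sub \<open>x \<in> M\<close> by (intro sigma_P) auto
    finally show "z \<in> P (\<beta> b)" using x P_mono[of "sp Z \<inter> \<beta> b" "\<beta> b"] by auto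
  qed
  then show "sp Z \<subseteq> \<beta> b"
    using supp_subset_iff[OF Zs(2) block_sub[OF i(3)]] subgroup.one_closed[OF Zs(1)] by auto
qed

text \<open>Applied to blocks of size two and non-trivial strips, where the cardinality condition
  holds automatically.\<close>

lemma strip_involved_block_eq:
  assumes fin: "finite M"
    and K: "\<And>b. b \<in> B \<Longrightarrow> subgroup (K b) S" "\<And>b. b \<in> B \<Longrightarrow> K b \<subseteq> P (\<beta> b)"
    and Z: "strip S M T k Z" "involved_in S T k Z (block_prod K)" "card (sp Z) \<ge> card (\<beta> b)"
    and i: "i \<in> sp Z" "i \<in> \<beta> b" "b \<in> B"
  shows "sp Z = \<beta> b" "K b = Z"
proof -
  note * = strip_involved_block[OF fin K Z(1,2) i]
  show "sp Z = \<beta> b"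
    using *(1) Z(3) block_sub[OF i(3)] by (intro card_seteq) (auto intro: finite_subset)
  then show "K b = Z" using *(2) sigma_image_id[OF block_sub[OF i(3)] K(2)[OF i(3)]] by simp
qed

lemma block_involved:
  assumes K: "\<And>b. b \<in> B \<Longrightarrow> subgroup (K b) S" "\<And>b. b \<in> B \<Longrightarrow> K b \<subseteq> P (\<beta> b)"
    and b: "b \<in> B" "sp (K b) = \<beta> b"
  shows "involved_in S T k (K b) (block_prod K)"
proof -
  have "K b \<subseteq> M" using part_sub_block_prod[OF K b(1)] block_prod_sub_M by blast
  then show ?thesis
    using involved_iff[OF K(1)[OF b(1)] _ block_prod_subgroup block_prod_sub_M] K
      sigma_block_prod[OF K b(1)] part_sub_block_prod[OF K b(1)] b(2) by auto
qed

end

section \<open>The construction\<close>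

context group begin

text \<open>Inversion reverses the product and maps each of the three subgroups to itself.\<close>

lemma set_mult_swap:
  assumes "subgroup U G" "subgroup W G" "subgroup Q G" "U <#> W = Q"
  shows "W <#> U = Q"
proof -
  have car: "U \<subseteq> carrier G" "W \<subseteq> carrier G" using assms subgroup.subset by auto
  have "W <#> U = {inv q |q. q \<in> Q}"
  proof safe
    fix z assume "z \<in> W <#> U"
    then obtain w u where wu: "w \<in> W" "u \<in> U" "z = w \<otimes> u" using set_mult_iff by auto
    then have "u \<in> carrier G" "w \<in> carrier G" using car by auto
    then have "z = inv (inv u \<otimes> inv w)" using wu(3) by (simp add: inv_mult_group)
    moreover have "inv u \<otimes> inv w \<in> Q"
      using wu assms subgroup.m_inv_closed set_multI by metis
    ultimately show "\<exists>q. z = inv q \<and> q \<in> Q" by auto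
  next
    fix q assume "q \<in> Q"
    then obtain u w where wu: "w \<in> W" "u \<in> U" "q = u \<otimes> w" using assms(4) set_mult_iff by blast
    then have "inv q = inv w \<otimes> inv u" using car by (simp add: inv_mult_group subset_iff)
    then show "inv q \<in> W <#> U" using wu assms subgroup.m_inv_closed set_multI by metis
  qed
  also have "\<dots> = Q"
  proof safe
    show "inv q \<in> Q" if "q \<in> Q" for q using subgroup.m_inv_closed[OF assms(3) that] .
    show "\<exists>q'. q = inv q' \<and> q' \<in> Q" if "q \<in> Q" for q
      using subgroup.m_inv_closed[OF assms(3) that] subgroup.mem_carrier[OF assms(3) that]
      by (intro exI[of _ "inv q"]) simp
  qed
  finally show ?thesis .
qed

lemma set_mult_absorb:
  assumes "subgroup Q G" "L \<subseteq> Q" "\<one> \<in> L"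
  shows "Q <#> L = Q"
proof
  show "Q <#> L \<subseteq> Q"
    using assms(2) subgroup.m_closed[OF assms(1)] unfolding set_mult_def by blast
  show "Q \<subseteq> Q <#> L"
  proof
    fix q assume q: "q \<in> Q"
    show "q \<in> Q <#> L" using set_multI[OF q assms(3)] subgroup.mem_carrier[OF assms(1) q] by simp
  qed
qed

lemma normalizer_in_iff:
  assumes "subgroup H G" "L \<subseteq> carrier G"
  shows "g \<in> normalizer_in G H L \<longleftrightarrow> g \<in> H \<and> conj_by G g L = L"
  using assms subgroup.subset[OF assms(1)]
  unfolding normalizer_in_def normalizer_def stabilizer_def conj_by_def by auto

end

section \<open>Factorisations in a product of two factors\<close>

context direct_factors begin

lemma pair_mem:
  assumes ab: "a \<in> {1..k}" "b \<in> {1..k}" "a \<noteq> b" and U: "U \<subseteq> T a" and W: "W \<subseteq> T b"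
  shows "x \<in> U <#> W \<longleftrightarrow> x \<in> P {a, b} \<and> \<sigma> {a} x \<in> U \<and> \<sigma> {b} x \<in> W"
proof
  assume "x \<in> U <#> W"
  then obtain u w where uw: "u \<in> U" "w \<in> W" "x = u \<otimes> w" using set_mult_iff by auto
  have P: "u \<in> P {a}" "w \<in> P {b}" using uw U W P_singleton ab by auto
  have "w \<in> P ({1..k} - {a})" "u \<in> P ({1..k} - {b})"
    using P P_mono[of "{b}" "{1..k} - {a}"] P_mono[of "{a}" "{1..k} - {b}"] ab by auto
  then have "\<sigma> {a} x = u" "\<sigma> {b} x = w"
    using sigma_eq[of "{a}" u w] sigma_eq[of "{b}" w u] P_commute[of "{a}" "{b}" u w] P ab uw(3) by auto
  moreover have "u \<in> P {a, b}" "w \<in> P {a, b}" using P P_mono[of _ "{a, b}"] by blast+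
  then have "x \<in> P {a, b}" using uw(3) subgroup.m_closed[OF P_subgroup] ab by auto
  ultimately show "x \<in> P {a, b} \<and> \<sigma> {a} x \<in> U \<and> \<sigma> {b} x \<in> W" using uw by simp
next
  assume *: "x \<in> P {a, b} \<and> \<sigma> {a} x \<in> U \<and> \<sigma> {b} x \<in> W"
  have "{a, b} \<subseteq> {1..k}" using ab by auto
  then have "x \<in> M" using * P_sub_M by blast
  have Un: "{a} \<union> {b} = {a, b}" by auto
  have "\<sigma> ({a} \<union> {b}) x = \<sigma> {a} x \<otimes> \<sigma> {b} x"
    using \<open>x \<in> M\<close> ab by (intro sigma_Un) auto
  moreover have "\<sigma> ({a} \<union> {b}) x = x"
    unfolding Un using sigma_id[OF \<open>{a, b} \<subseteq> {1..k}\<close>] * by blast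
  ultimately have "x = \<sigma> {a} x \<otimes> \<sigma> {b} x" by simp
  then show "x \<in> U <#> W" using * set_multI by metis
qed

lemma T_set_mult:
  assumes ab: "a \<in> {1..k}" "b \<in> {1..k}" "a \<noteq> b"
  shows "T a <#> T b = P {a, b}"
proof -
  have "\<sigma> {i} x \<in> T i" if "x \<in> P {a, b}" "i \<in> {1..k}" for x i
  proof -
    have "x \<in> M" using that(1) P_sub_M[of "{a, b}"] ab by auto
    then show ?thesis using sigma_P[of "{i}" x] P_singleton[of i] that by auto
  qed
  then show ?thesis using pair_mem[OF ab, of "T a" "T b"] ab by auto
qed

text \<open>Given \<open>t\<close>, the assumed factorisation is applied not to \<open>t\<close> but
  to its projection onto \<open>T a\<close>, giving \<open>y x\<close>. As the
  \<open>b\<close>-coordinate of this projection is trivial, that of \<open>x\<close> is the inverse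
  of the one of \<open>y\<close>, hence lies in \<open>B\<close>, so \<open>x\<close> belongs to the
  intersection. Dividing \<open>t\<close> by \<open>x\<close> leaves the \<open>a\<close>-coordinate
  of \<open>y\<close>, which lies in \<open>A\<close>.\<close>

lemma diagonal_factorisation:
  assumes ab: "a \<in> {1..k}" "b \<in> {1..k}" "a \<noteq> b"
    and X: "subgroup X S" "X \<subseteq> P {a, b}"
    and A: "subgroup A S" "A \<subseteq> T a" and B: "subgroup B S" "B \<subseteq> T b"
    and fact: "(A <#> B) <#> X = P {a, b}"
  shows "(A <#> T b) <#> ((T a <#> B) \<inter> X) = P {a, b}"
proof -
  have c: "{a, b} \<subseteq> {1..k}" using ab by auto
  note sP = P_subgroup[OF c]
  have M: "x \<in> M" if "x \<in> P {a, b}" for x using that P_sub_M[OF c] by auto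
  have mem: "x \<in> A <#> T b \<longleftrightarrow> x \<in> P {a, b} \<and> \<sigma> {a} x \<in> A"
    "x \<in> T a <#> B \<longleftrightarrow> x \<in> P {a, b} \<and> \<sigma> {b} x \<in> B" for x
    using pair_mem[OF ab A(2), of "T b" x] pair_mem[OF ab _ B(2), of "T a" x] M
      sigma_P[of "{a}" x] sigma_P[of "{b}" x] P_singleton ab by auto
  show ?thesis
  proof
    show "(A <#> T b) <#> ((T a <#> B) \<inter> X) \<subseteq> P {a, b}"
    proof
      fix z assume "z \<in> (A <#> T b) <#> ((T a <#> B) \<inter> X)"
      then obtain p q where "p \<in> A <#> T b" "q \<in> T a <#> B" "z = p \<otimes> q" using set_mult_iff by auto
      then show "z \<in> P {a, b}" using mem subgroup.m_closed[OF sP] by auto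
    qed
    show "P {a, b} \<subseteq> (A <#> T b) <#> ((T a <#> B) \<inter> X)"
    proof
      fix t assume t: "t \<in> P {a, b}"
      have sa: "\<sigma> {a} t \<in> P {a}" using sigma_P[of "{a}" t] M[OF t] ab by auto
      then have "\<sigma> {a} t \<in> P {a, b}" using P_mono[of "{a}" "{a, b}"] by auto
      then obtain y x where yx: "y \<in> A <#> B" "x \<in> X" "\<sigma> {a} t = y \<otimes> x" using fact set_mult_iff by blast
      have y: "y \<in> P {a, b}" "\<sigma> {a} y \<in> A" "\<sigma> {b} y \<in> B" using pair_mem[OF ab A(2) B(2)] yx(1) by auto
      have x: "x \<in> P {a, b}" using yx X by auto
      have car: "\<sigma> {i} z \<in> carrier S" if "z \<in> P {a, b}" "i \<in> {a, b}" for z i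
        using sigma_carrier[of "{i}" z] M[OF that(1)] that ab by auto
      have "\<sigma> {b} (\<sigma> {a} t) = \<one>" using sigma_disjoint[of "{b}" "{a}", OF _ _ _ sa] ab by auto
      then have "\<sigma> {b} y \<otimes> \<sigma> {b} x = \<one>" using yx(3) sigma_mult[of "{b}" y x] M y x ab by auto
      then have "\<sigma> {b} x = inv (\<sigma> {b} y)" using car y x by (metis insertI1 insertI2 inv_equality inv_inv)
      then have xB: "x \<in> (T a <#> B) \<inter> X" using mem x yx y subgroup.m_inv_closed[OF B(1)] by auto
      have "\<sigma> {a} (\<sigma> {a} t) = \<sigma> {a} t" using sigma_id[of "{a}", OF _ sa] ab by auto
      then have eq: "\<sigma> {a} t = \<sigma> {a} y \<otimes> \<sigma> {a} x" using yx(3) sigma_mult[of "{a}" y x] M y x ab by auto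
      have ix: "inv x \<in> P {a, b}" using x subgroup.m_inv_closed[OF sP] by auto
      have "\<sigma> {a} (t \<otimes> inv x) = \<sigma> {a} t \<otimes> inv (\<sigma> {a} x)"
        using sigma_mult[of "{a}" t "inv x"] sigma_inv[of "{a}" x] M t x ix ab by auto
      also have "\<dots> = \<sigma> {a} y" using eq car y x by (simp add: m_assoc)
      finally have "t \<otimes> inv x \<in> A <#> T b" using mem y subgroup.m_closed[OF sP t ix] by auto
      moreover have "t = (t \<otimes> inv x) \<otimes> x" using t x P_carrier[OF c] by (simp add: m_assoc)
      ultimately show "t \<in> (A <#> T b) <#> ((T a <#> B) \<inter> X)" using xB set_multI by metis
    qed
  qed
qed

end

lemma edge_eq_iff [simp]: "edge v Y = edge w Z \<longleftrightarrow> v = w \<and> Y = Z"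
  unfolding edge_def by (auto simp: doubleton_eq_iff)

lemma edge_action_edge: "edge_action S \<alpha> g (edge v Y) = edge (\<alpha> g v) (conj_by S g Y)"
  unfolding edge_action_def vertex_action_def edge_def by simp

lemma Inr_in_edge [simp]: "Inr Y \<in> edge v Z \<longleftrightarrow> Y = Z"
  unfolding edge_def by auto

text \<open>\<open>H\<close> and \<open>D\<close> stand for the stabilisers of the point in
  \<open>G\<close> and in \<open>M\<close>. Of their origin only this is kept: \<open>H\<close>
  permutes the factors, normalises \<open>D\<close>, and \<open>D\<close> is the product of the
  strips. The base vertices \<open>Y1\<close>, \<open>v1\<close>, \<open>v2\<close> are fixed as
  parameters.\<close>

locale construction = factor_blocks S T k M YS "supp S T k"
  for S (structure) and T :: "nat \<Rightarrow> 'a set" and k and M and YS :: "'a set set" +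
  fixes H D X1 A1 B1 :: "'a set"
    and V :: "'v set" and E1 E2 :: "('v + 'a set) set set"
    and \<alpha> :: "'a \<Rightarrow> 'v \<Rightarrow> 'v"
    and Y1 :: "'a set" and v1 v2 :: 'v
  assumes fin: "finite M" "finite H"
    and H: "subgroup H S" "\<And>g. g \<in> H \<Longrightarrow> \<exists>\<pi>. permutes_factors g \<pi>"
    and D: "D = generate S (\<Union>Y\<in>YS. Y)" "\<And>g. g \<in> H \<Longrightarrow> conj_by S g D = D"
    and YS: "\<And>Y. Y \<in> YS \<Longrightarrow> subgroup Y S" "\<And>Y. Y \<in> YS \<Longrightarrow> Y \<subseteq> M"
      "\<And>Y. Y \<in> YS \<Longrightarrow> card (supp S T k Y) = 2"
    and X1: "full_strip S M T k X1"
    and A1: "subgroup A1 S" "A1 \<subset> T_min S T k X1"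
    and B1: "subgroup B1 S" "B1 \<subset> T_max S T k X1"
    and fact: "X1 <#> (A1 <#> B1) = T_min S T k X1 <#> T_max S T k X1"
    and inter: "X1 \<inter> (A1 <#> B1) = sigma S T k (supp S T k X1) ` D"
    and norm: "normalizer_in S H (T_min S T k X1 <#> T_max S T k X1) = normalizer_in S H X1"
      "normalizer_in S H X1 = normalizer_in S H (A1 <#> B1)"
    and bipartite: "E1 \<union> E2 \<subseteq> {edge v Y |v Y. v \<in> V \<and> Y \<in> YS}" "E1 \<inter> E2 = {}"
    and action: "group_action (S\<lparr>carrier := H\<rparr>) V \<alpha>"
    and orbits: "V \<in> orbits (S\<lparr>carrier := H\<rparr>) V \<alpha>"
      "YS \<in> orbits (S\<lparr>carrier := H\<rparr>) YS (conj_by S)"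
      "E1 \<in> orbits (S\<lparr>carrier := H\<rparr>) (E1 \<union> E2) (edge_action S \<alpha>)"
      "E2 \<in> orbits (S\<lparr>carrier := H\<rparr>) (E1 \<union> E2) (edge_action S \<alpha>)"
    and degrees: "\<forall>Y\<in>YS. card (incident_edges E1 Y) = 1 \<or> card (incident_edges E1 Y) = 2"
      "\<forall>Y\<in>YS. card (incident_edges E2 Y) = 1"
    and two_edges: "(\<forall>Y\<in>YS. card (incident_edges E1 Y) = 2) \<longrightarrow>
      (\<forall>v\<in>V. \<forall>Y\<in>YS. edge v Y \<in> E1 \<longrightarrow>
        stabilizer (S\<lparr>carrier := H\<rparr>) (edge_action S \<alpha>) (edge v Y) =
          normalizer_in S H (T_min S T k Y) \<inter> normalizer_in S H (T_max S T k Y))"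
    and base: "Y1 \<in> YS" "v1 \<in> V" "v2 \<in> V" "supp S T k X1 = supp S T k Y1"
      "edge v1 Y1 \<in> E1" "edge v2 Y1 \<in> E2"
begin

section \<open>The group action on vertices, strips and edges\<close>

abbreviation "cj \<equiv> conj_by S"

lemma H_carrier: "g \<in> H \<Longrightarrow> g \<in> carrier S" using H(1) subgroup.mem_carrier by metis

lemma H_mult: "g \<in> H \<Longrightarrow> h \<in> H \<Longrightarrow> g \<otimes> h \<in> H" using subgroup.m_closed[OF H(1)] .
lemma H_inv: "g \<in> H \<Longrightarrow> inv g \<in> H" using subgroup.m_inv_closed[OF H(1)] .
lemma H_one: "\<one> \<in> H" using subgroup.one_closed[OF H(1)] .

lemma YS_carrier: "Y \<in> YS \<Longrightarrow> Y \<subseteq> carrier S" using YS(1) subgroup.subset by metis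

lemma alpha_V: "g \<in> H \<Longrightarrow> v \<in> V \<Longrightarrow> \<alpha> g v \<in> V"
  using group_action.element_image[OF action, of g v] by simp

lemma alpha_mult: "g \<in> H \<Longrightarrow> h \<in> H \<Longrightarrow> v \<in> V \<Longrightarrow> \<alpha> (g \<otimes> h) v = \<alpha> g (\<alpha> h v)"
  using group_action.composition_rule[OF action, of v g h] by simp

lemma alpha_one: "v \<in> V \<Longrightarrow> \<alpha> \<one> v = v"
  using group_action.id_eq_one[OF action] by (auto dest: fun_cong[of _ _ v])

lemma alpha_inv: "g \<in> H \<Longrightarrow> v \<in> V \<Longrightarrow> \<alpha> (inv g) (\<alpha> g v) = v"
  using alpha_mult[of "inv g" g v] H_inv H_carrier alpha_one by simp

lemma alpha_inv': "g \<in> H \<Longrightarrow> v \<in> V \<Longrightarrow> \<alpha> g (\<alpha> (inv g) v) = v"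
  using alpha_mult[of g "inv g" v] H_inv H_carrier alpha_one by simp

lemma alpha_image: "g \<in> H \<Longrightarrow> \<alpha> g ` V = V"
  using group_action.surj_prop[OF action] by simp

lemma V_trans: "v \<in> V \<Longrightarrow> w \<in> V \<Longrightarrow> \<exists>g\<in>H. \<alpha> g v = w"
proof -
  assume vw: "v \<in> V" "w \<in> V"
  obtain u where u: "u \<in> V" "V = {\<alpha> g u |g. g \<in> H}"
    using orbits(1) unfolding orbits_def orbit_def by auto
  then obtain g h where gh: "g \<in> H" "h \<in> H" "v = \<alpha> g u" "w = \<alpha> h u" using vw by blast
  then have "\<alpha> (h \<otimes> inv g) v = w" using u alpha_mult[of h "inv g" v] alpha_inv H_inv vw by simp
  then show ?thesis using gh H_mult H_inv by metis
qed

lemma finite_V: "finite V"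
proof -
  obtain u where "u \<in> V" "V = (\<lambda>g. \<alpha> g u) ` H"
    using orbits(1) unfolding orbits_def orbit_def by auto
  then show ?thesis using fin(2) by (metis finite_imageI)
qed

lemma YS_orbit: obtains Z where "Z \<in> YS" "YS = {cj g Z |g. g \<in> H}"
  using orbits(2) unfolding orbits_def orbit_def by auto

lemma YS_closed: "Y \<in> YS \<Longrightarrow> g \<in> H \<Longrightarrow> cj g Y \<in> YS"
proof -
  assume Y: "Y \<in> YS" "g \<in> H"
  obtain Z where Z: "Z \<in> YS" "YS = {cj g Z |g. g \<in> H}" by (rule YS_orbit)
  then obtain h where h: "h \<in> H" "Y = cj h Z" using Y by blast
  then have "cj g Y = cj (g \<otimes> h) Z" using conj_by_comp H_carrier Y YS_carrier Z by simp
  moreover have "g \<otimes> h \<in> H" using h Y H_mult by simp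
  ultimately show ?thesis using Z by blast
qed

lemma YS_from_base: "Y \<in> YS \<Longrightarrow> \<exists>g\<in>H. Y = cj g Y1"
proof -
  assume Y: "Y \<in> YS"
  obtain Z where Z: "Z \<in> YS" "YS = {cj g Z |g. g \<in> H}" by (rule YS_orbit)
  then obtain h g where h: "h \<in> H" "Y = cj h Z" "g \<in> H" "Y1 = cj g Z" using Y base(1) by blast
  then have "Z = cj (inv g) Y1" using conj_by_inv H_carrier YS_carrier Z by simp
  then have "Y = cj (h \<otimes> inv g) Y1" using h conj_by_comp H_carrier H_inv YS_carrier base(1) by simp
  then show ?thesis using h H_mult H_inv by blast
qed

lemma YS_image: "g \<in> H \<Longrightarrow> cj g ` YS = YS"
proof
  assume g: "g \<in> H"
  show "cj g ` YS \<subseteq> YS" using YS_closed g by auto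
  show "YS \<subseteq> cj g ` YS"
  proof
    fix Y assume Y: "Y \<in> YS"
    then have "Y = cj g (cj (inv g) Y)" using conj_by_inv' H_carrier YS_carrier g by simp
    then show "Y \<in> cj g ` YS" using YS_closed[OF Y H_inv[OF g]] by (rule image_eqI)
  qed
qed

text \<open>The common property of \<open>E1\<close> and \<open>E2\<close> on which the following
  lemmas rest, so that each is proved once for both edge sets.\<close>

definition edge_orbit :: "('v + 'a set) set set \<Rightarrow> bool" where
  "edge_orbit E \<longleftrightarrow> (\<exists>v\<in>V. \<exists>Y\<in>YS. E = {edge (\<alpha> g v) (cj g Y) |g. g \<in> H})"

lemma edge_orbitI:
  assumes "E \<in> orbits (S\<lparr>carrier := H\<rparr>) (E1 \<union> E2) (edge_action S \<alpha>)"
  shows "edge_orbit E"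
proof -
  obtain e where e: "e \<in> E1 \<union> E2" "E = {edge_action S \<alpha> g e |g. g \<in> H}"
    using assms unfolding orbits_def orbit_def by auto
  then obtain v Y where "v \<in> V" "Y \<in> YS" "e = edge v Y" using bipartite by blast
  then show ?thesis unfolding edge_orbit_def using e(2) by (auto simp: edge_action_edge)
qed

lemma edge_orbit_E1: "edge_orbit E1" and edge_orbit_E2: "edge_orbit E2"
  using orbits edge_orbitI by auto

lemma edge_orbit_closed:
  assumes "edge_orbit E" "edge v Y \<in> E" "g \<in> H"
  shows "edge (\<alpha> g v) (cj g Y) \<in> E"
proof -
  obtain w Z where Z: "w \<in> V" "Z \<in> YS" "E = {edge (\<alpha> g w) (cj g Z) |g. g \<in> H}"
    using assms(1) unfolding edge_orbit_def by auto
  then obtain h where h: "h \<in> H" "v = \<alpha> h w" "Y = cj h Z" using assms(2) by auto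
  have "\<alpha> g v = \<alpha> (g \<otimes> h) w" "cj g Y = cj (g \<otimes> h) Z"
    using h Z assms(3) alpha_mult conj_by_comp H_carrier YS_carrier by auto
  then show ?thesis using Z(3) H_mult[OF assms(3) h(1)] by auto
qed

lemma edge_orbit_in: "edge_orbit E \<Longrightarrow> edge v Y \<in> E \<Longrightarrow> v \<in> V \<and> Y \<in> YS"
  unfolding edge_orbit_def using alpha_V YS_closed by auto

lemma edge_orbit_trans:
  assumes "edge_orbit E" "edge v Y \<in> E" "edge u X \<in> E"
  shows "\<exists>g\<in>H. \<alpha> g v = u \<and> cj g Y = X"
proof -
  obtain w Z where Z: "w \<in> V" "Z \<in> YS" "E = {edge (\<alpha> g w) (cj g Z) |g. g \<in> H}"
    using assms(1) unfolding edge_orbit_def by auto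
  obtain h where h: "h \<in> H" "v = \<alpha> h w" "Y = cj h Z" using assms(2) Z(3) by auto
  obtain g where g: "g \<in> H" "u = \<alpha> g w" "X = cj g Z" using assms(3) Z(3) by auto
  have "\<alpha> (g \<otimes> inv h) v = u"
    using alpha_mult[of g "inv h" v] alpha_inv[OF h(1) Z(1)] h g H_inv alpha_V Z(1) by simp
  moreover have "cj (g \<otimes> inv h) Y = X"
    using conj_by_comp[of g "inv h" Y] conj_by_inv[of h Z] h g H_inv H_carrier YS_carrier Z conj_by_subset by simp
  ultimately show ?thesis using H_mult[OF g(1) H_inv[OF h(1)]] by blast
qed

lemma edge_orbit_back:
  assumes "edge_orbit E" "edge (\<alpha> g v) (cj g Y) \<in> E" "g \<in> H" "v \<in> V" "Y \<in> YS"
  shows "edge v Y \<in> E"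
  using edge_orbit_closed[OF assms(1,2) H_inv[OF assms(3)]] alpha_inv conj_by_inv assms H_carrier YS_carrier
  by simp

lemma edge_orbit_iff:
  assumes "edge_orbit E" "g \<in> H" "v \<in> V" "Y \<in> YS"
  shows "edge (\<alpha> g v) (cj g Y) \<in> E \<longleftrightarrow> edge v Y \<in> E"
  using assms edge_orbit_back edge_orbit_closed by metis

lemma incident_eq:
  assumes "edge_orbit E"
  shows "incident_edges E Y = (\<lambda>v. edge v Y) ` {v. edge v Y \<in> E}"
proof -
  have "\<exists>v. e = edge v Y" if "e \<in> E" "Inr Y \<in> e" for e
    using assms that unfolding edge_orbit_def by auto
  then show ?thesis unfolding incident_edges_def by auto
qed

lemma card_incident:
  assumes "edge_orbit E"
  shows "card (incident_edges E Y) = card {v. edge v Y \<in> E}"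
  unfolding incident_eq[OF assms] by (rule card_image) (auto simp: inj_on_def)

text \<open>The action of \<open>g\<close> matches the neighbours of \<open>Y\<close> with those of
  its conjugate; since \<open>YS\<close> is one orbit, degrees are constant.\<close>

lemma card_incident_conj:
  assumes "edge_orbit E" "g \<in> H" "Y \<in> YS"
  shows "card (incident_edges E (cj g Y)) = card (incident_edges E Y)"
proof -
  have "{v. edge v (cj g Y) \<in> E} = \<alpha> g ` {v. edge v Y \<in> E}"
  proof safe
    fix v assume v: "edge v (cj g Y) \<in> E"
    then have "v \<in> V" using edge_orbit_in[OF assms(1)] by blast
    then have "v = \<alpha> g (\<alpha> (inv g) v)" "\<alpha> (inv g) v \<in> V"
      using alpha_inv' alpha_V H_inv assms by auto
    then show "v \<in> \<alpha> g ` {v. edge v Y \<in> E}"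
      using edge_orbit_back[OF assms(1) _ assms(2) _ assms(3)] v by (metis image_eqI mem_Collect_eq)
  next
    fix v assume "edge v Y \<in> E"
    then show "edge (\<alpha> g v) (cj g Y) \<in> E" using edge_orbit_closed assms by auto
  qed
  moreover have "inj_on (\<alpha> g) {v. edge v Y \<in> E}"
    using group_action.inj_prop[OF action, of g] assms(2) edge_orbit_in[OF assms(1)]
    by (auto intro: inj_on_subset)
  ultimately show ?thesis using card_incident[OF assms(1)] card_image by metis
qed

lemma E2_unique: "edge v Y \<in> E2 \<Longrightarrow> edge w Y \<in> E2 \<Longrightarrow> v = w"
proof -
  assume *: "edge v Y \<in> E2" "edge w Y \<in> E2"
  then have "card {v. edge v Y \<in> E2} = 1"
    using degrees(2) card_incident[OF edge_orbit_E2] edge_orbit_in[OF edge_orbit_E2] by auto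
  then obtain u where "{v. edge v Y \<in> E2} = {u}" by (rule card_1_singletonE)
  then show ?thesis using * by (metis mem_Collect_eq singletonD)
qed

section \<open>The base block and condition (v)\<close>

abbreviation "a \<equiv> Min (sp X1)"
abbreviation "b \<equiv> Max (sp X1)"

text \<open>Tested at \<open>Y1\<close> only; by \<open>all_two\<close> it then holds for every
  strip, which is the premise of \<open>two_edges\<close>.\<close>

definition two :: bool where "two \<longleftrightarrow> card (incident_edges E1 Y1) = 2"

lemma card2_min_max:
  assumes "card (c :: nat set) = 2"
  shows "c = {Min c, Max c}" "Min c \<noteq> Max c"
proof -
  obtain x y where "c = {x, y}" "x \<noteq> y" using assms card_2_iff by metis
  then show "c = {Min c, Max c}" "Min c \<noteq> Max c" by (cases "x < y"; auto simp: min_def max_def)+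
qed

lemma sp_X1: "sp X1 = {a, b}" "a \<noteq> b" "a \<in> {1..k}" "b \<in> {1..k}"
proof -
  have "card (sp X1) = 2" using YS(3) base by simp
  from card2_min_max[OF this] show *: "sp X1 = {a, b}" "a \<noteq> b" by auto
  have "{a, b} \<subseteq> {1..k}" using supp_sub[of X1] * by simp
  then show "a \<in> {1..k}" "b \<in> {1..k}" by auto
qed

lemma T_pair: "Y \<in> YS \<Longrightarrow> T_min S T k Y <#> T_max S T k Y = P (sp Y)"
proof -
  assume Y: "Y \<in> YS"
  note * = card2_min_max[OF YS(3)[OF Y]]
  have "{Min (sp Y), Max (sp Y)} \<subseteq> {1..k}" using supp_sub[of Y] * by simp
  then have "T (Min (sp Y)) <#> T (Max (sp Y)) = P {Min (sp Y), Max (sp Y)}"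
    using *(2) by (intro T_set_mult) auto
  then show ?thesis using *(1) by simp
qed

abbreviation "c \<equiv> sp Y1"

lemma c_eq: "c = {a, b}" using sp_X1 base by simp

lemma T_ab: "T a <#> T b = P c" using T_set_mult sp_X1 c_eq by simp

lemma c_sub: "c \<subseteq> {1..k}" using supp_sub .

lemma Pc_M: "P c \<subseteq> M" using P_sub_M c_sub by blast

lemma X1': "subgroup X1 S" "X1 \<subseteq> M" "X1 \<subseteq> P c" "strip S M T k X1"
proof -
  show *: "subgroup X1 S" "X1 \<subseteq> M" "strip S M T k X1" using X1 unfolding full_strip_def strip_def by auto
  show "X1 \<subseteq> P c" using sigma_supp[OF *(2)] base by auto
qed

lemma AB_mem: "x \<in> A1 <#> B1 \<longleftrightarrow> x \<in> P c \<and> \<sigma> {a} x \<in> A1 \<and> \<sigma> {b} x \<in> B1"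
  using pair_mem[of a b A1 B1 x] sp_X1 A1 B1 c_eq by auto

lemma sigma_T: "x \<in> M \<Longrightarrow> i \<in> {1..k} \<Longrightarrow> \<sigma> {i} x \<in> T i"
  using sigma_P[of "{i}" x] P_singleton by auto

lemma ATb_mem: "x \<in> A1 <#> T b \<longleftrightarrow> x \<in> P c \<and> \<sigma> {a} x \<in> A1"
  using pair_mem[of a b A1 "T b" x] sp_X1 A1 c_eq sigma_T[of x b] Pc_M by auto

lemma TaB_mem: "x \<in> T a <#> B1 \<longleftrightarrow> x \<in> P c \<and> \<sigma> {b} x \<in> B1"
  using pair_mem[of a b "T a" B1 x] sp_X1 B1 c_eq sigma_T[of x a] Pc_M by auto

lemma factor_commute: "U \<subseteq> T a \<Longrightarrow> W \<subseteq> T b \<Longrightarrow> x \<in> U \<Longrightarrow> y \<in> W \<Longrightarrow> x \<otimes> y = y \<otimes> x"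
  using P_commute[of "{a}" "{b}" x y] sp_X1 P_singleton by auto

lemma pair_subgroup:
  "subgroup U S \<Longrightarrow> U \<subseteq> T a \<Longrightarrow> subgroup W S \<Longrightarrow> W \<subseteq> T b \<Longrightarrow> subgroup (U <#> W) S"
  using factor_commute by (intro commuting_set_mult_subgroup) auto

lemma AB_subgroup: "subgroup (A1 <#> B1) S" "subgroup (A1 <#> T b) S" "subgroup (T a <#> B1) S"
  using A1 B1 T_subgroup sp_X1 by (auto intro!: pair_subgroup)

text \<open>Condition (v) enters here: the block, \<open>X1\<close> and \<open>A1 <#> B1\<close>
  have the same normaliser in \<open>H\<close>.\<close>

lemma norm_Pc:
  assumes "g \<in> H" "cj g (P c) = P c"
  shows "cj g X1 = X1" "cj g (A1 <#> B1) = A1 <#> B1"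
proof -
  have "P c \<subseteq> carrier S" using P_carrier c_sub by auto
  then have "g \<in> normalizer_in S H (T a <#> T b)" using assms normalizer_in_iff[OF H(1)] T_ab by simp
  then show "cj g X1 = X1" "cj g (A1 <#> B1) = A1 <#> B1"
    using norm normalizer_in_iff[OF H(1)] X1'(1) AB_subgroup(1) subgroup.subset by metis+
qed

lemma conj_supp_YS:
  assumes "g \<in> H" "permutes_factors g \<pi>" "Y \<in> YS"
  shows "sp (cj g Y) = \<pi> ` sp Y"
  using conj_supp[OF assms(2)] YS(1,2) assms(3) by simp

lemma conj_P_YS:
  assumes "g \<in> H" "Y \<in> YS"
  shows "cj g (P (sp Y)) = P (sp (cj g Y))"
proof -
  obtain \<pi> where "permutes_factors g \<pi>" using H(2)[OF assms(1)] by auto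
  then show ?thesis using conj_P[OF _ supp_sub] conj_supp_YS assms by simp
qed

lemma norm_Y1:
  assumes "g \<in> H" "cj g Y1 = Y1"
  shows "cj g X1 = X1" "cj g (A1 <#> B1) = A1 <#> B1" "cj g (P c) = P c"
proof -
  show "cj g (P c) = P c" using conj_P_YS[OF assms(1) base(1)] assms(2) by simp
  then show "cj g X1 = X1" "cj g (A1 <#> B1) = A1 <#> B1" using norm_Pc assms by auto
qed

lemma conj_by_Int:
  "g \<in> carrier S \<Longrightarrow> U \<subseteq> carrier S \<Longrightarrow> W \<subseteq> carrier S \<Longrightarrow> cj g (U \<inter> W) = cj g U \<inter> cj g W"
  unfolding conj_by_image using inj_on_image_Int[OF conj_inj] by blast

text \<open>Recovers \<open>A1\<close> and \<open>B1\<close> from their product, so that the effect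
  of a group element on them can be read off from its effect on the product and on the two
  factors.\<close>

lemma A_eq: "A1 = (A1 <#> B1) \<inter> T a" and B_eq: "B1 = (A1 <#> B1) \<inter> T b"
proof -
  have *: "x \<in> P c" "\<sigma> {i} x = x" "\<sigma> {j} x = \<one>" if "x \<in> T i" "i = a \<and> j = b \<or> i = b \<and> j = a" for x i j
  proof -
    have ij: "i \<in> {1..k}" "j \<in> {1..k}" "i \<noteq> j" "i \<in> c" using that(2) sp_X1(2-4) c_eq by auto
    then have Pi: "x \<in> P {i}" using P_singleton that by simp
    show "x \<in> P c" using Pi P_mono[of "{i}" c] ij by auto
    show "\<sigma> {i} x = x" using sigma_id[of "{i}" x] Pi ij by auto
    show "\<sigma> {j} x = \<one>" using sigma_disjoint[of "{j}" "{i}" x] Pi ij by auto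
  qed
  show "A1 = (A1 <#> B1) \<inter> T a"
    using *[of _ a b] AB_mem A1 subgroup.one_closed[OF B1(1)] by (auto simp: subset_iff psubset_eq)
  show "B1 = (A1 <#> B1) \<inter> T b"
    using *[of _ b a] AB_mem B1 subgroup.one_closed[OF A1(1)] by (auto simp: subset_iff psubset_eq)
qed

lemma Ts_carrier: "T a \<subseteq> carrier S" "T b \<subseteq> carrier S" "A1 \<subseteq> carrier S" "B1 \<subseteq> carrier S"
  using T_subgroup sp_X1 A1 B1 subgroup.subset by metis+

lemma all_two: "two \<Longrightarrow> Y \<in> YS \<Longrightarrow> card (incident_edges E1 Y) = 2"
  using YS_from_base card_incident_conj[OF edge_orbit_E1 _ base(1)] unfolding two_def by metis

lemma two_stab:
  assumes two "g \<in> H"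
  shows "\<alpha> g v1 = v1 \<and> cj g Y1 = Y1 \<longleftrightarrow> cj g (T a) = T a \<and> cj g (T b) = T b"
proof -
  have "stabilizer (S\<lparr>carrier := H\<rparr>) (edge_action S \<alpha>) (edge v1 Y1) =
      normalizer_in S H (T a) \<inter> normalizer_in S H (T b)"
    using two_edges all_two[OF assms(1)] base by auto
  then have "g \<in> stabilizer (S\<lparr>carrier := H\<rparr>) (edge_action S \<alpha>) (edge v1 Y1) \<longleftrightarrow>
      g \<in> normalizer_in S H (T a) \<and> g \<in> normalizer_in S H (T b)" by simp
  then show ?thesis
    using assms(2) normalizer_in_iff[OF H(1)] Ts_carrier
    unfolding stabilizer_def by (simp add: edge_action_edge)
qed

definition L1 where "L1 = (if two then A1 <#> T b else A1 <#> B1)"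

lemma L1_subgroup: "subgroup L1 S" "L1 \<subseteq> P c"
  using AB_subgroup AB_mem ATb_mem unfolding L1_def by auto

text \<open>With one edge this is condition (v). With two edges, the edge stabiliser fixes both
  factors and, through \<open>A_eq\<close>, also \<open>A1\<close>.\<close>

lemma L1_stab:
  assumes "g \<in> H" "\<alpha> g v1 = v1" "cj g Y1 = Y1"
  shows "cj g L1 = L1"
proof (cases two)
  case False
  then show ?thesis using norm_Y1 assms unfolding L1_def by simp
next
  case True
  then have T: "cj g (T a) = T a" "cj g (T b) = T b" using two_stab assms by auto
  have "cj g A1 = A1"
    using A_eq conj_by_Int[OF H_carrier[OF assms(1)], of "A1 <#> B1" "T a"] T norm_Y1(2)[OF assms(1,3)]
      Ts_carrier subgroup.subset[OF AB_subgroup(1)] by simp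
  then show ?thesis
    using True T conj_by_set_mult[OF H_carrier[OF assms(1)]] Ts_carrier unfolding L1_def by simp
qed

definition "KvY = K_part S T k H \<alpha> E1 E2 (edge v1 Y1) L1 (edge v2 Y1) X1"

text \<open>Two admissible elements \<open>g\<close> and \<open>h\<close> differ by
  \<open>inv g \<otimes> h\<close>, which stabilises the base edge and therefore \<open>L\<close>.
  The formulation covers the base edges of both \<open>E1\<close> and \<open>E2\<close>.\<close>

lemma KvY_welldef:
  assumes E: "edge_orbit E" "edge w Y1 \<in> E" "edge v Y \<in> E"
    and L: "L \<subseteq> carrier S" "\<And>g. g \<in> H \<Longrightarrow> \<alpha> g w = w \<Longrightarrow> cj g Y1 = Y1 \<Longrightarrow> cj g L = L"
    and g: "g \<in> H" "\<alpha> g w = v" "cj g Y1 = Y"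
  shows "cj (SOME g. g \<in> H \<and> edge_action S \<alpha> g (edge w Y1) = edge v Y) L = cj g L"
proof -
  define h where "h = (SOME g. g \<in> H \<and> edge_action S \<alpha> g (edge w Y1) = edge v Y)"
  have "h \<in> H \<and> edge_action S \<alpha> h (edge w Y1) = edge v Y"
    unfolding h_def by (rule someI[of _ g]) (use g in \<open>simp add: edge_action_edge\<close>)
  then have h: "h \<in> H" "\<alpha> h w = v" "cj h Y1 = Y" by (auto simp: edge_action_edge)
  have w: "w \<in> V" using edge_orbit_in E by blast
  let ?f = "inv g \<otimes> h"
  have car: "g \<in> carrier S" "h \<in> carrier S" using H_carrier g h by auto
  have "\<alpha> ?f w = w" using alpha_mult[of "inv g" h w] alpha_inv g h H_inv w by auto
  moreover have "cj ?f Y1 = Y1"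
    using conj_by_comp[of "inv g" h Y1] conj_by_inv[of g Y1] g h car YS_carrier base(1) by auto
  ultimately have "cj ?f L = L" using L(2) H_mult H_inv g h by blast
  then have "cj g L = cj g (cj ?f L)" by simp
  also have "\<dots> = cj (g \<otimes> ?f) L" using conj_by_comp[of g ?f L] car L by simp
  also have "g \<otimes> ?f = h" using car by (simp add: m_assoc[symmetric])
  finally show ?thesis unfolding h_def by simp
qed

lemma KvY_E1:
  assumes "edge v Y \<in> E1" "g \<in> H" "\<alpha> g v1 = v" "cj g Y1 = Y"
  shows "KvY v Y = cj g L1"
proof -
  have "cj (SOME g. g \<in> H \<and> edge_action S \<alpha> g (edge v1 Y1) = edge v Y) L1 = cj g L1"
    by (rule KvY_welldef[OF edge_orbit_E1 base(5) assms(1)])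
      (use assms L1_stab subgroup.subset[OF L1_subgroup(1)] in blast)+
  then show ?thesis unfolding KvY_def K_part_def using assms(1) by (simp only: if_True)
qed

lemma KvY_E2:
  assumes "edge v Y \<in> E2" "g \<in> H" "\<alpha> g v2 = v" "cj g Y1 = Y"
  shows "KvY v Y = cj g X1"
proof -
  have "edge v Y \<notin> E1" using assms bipartite by auto
  moreover have "cj (SOME g. g \<in> H \<and> edge_action S \<alpha> g (edge v2 Y1) = edge v Y) X1 = cj g X1"
    by (rule KvY_welldef[OF edge_orbit_E2 base(6) assms(1)])
      (use assms norm_Y1(1) subgroup.subset[OF X1'(1)] in blast)+
  ultimately show ?thesis unfolding KvY_def K_part_def using assms(1) by (simp only: if_True if_False)
qed

lemma KvY_other:
  assumes "edge v Y \<notin> E1" "edge v Y \<notin> E2" "Y \<in> YS"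
  shows "KvY v Y = P (sp Y)"
  using assms T_pair unfolding KvY_def K_part_def by simp

lemma edge_cases [consumes 2, case_names E1 E2 other]:
  assumes "v \<in> V" "Y \<in> YS"
  obtains (E1) g where "edge v Y \<in> E1" "g \<in> H" "\<alpha> g v1 = v" "cj g Y1 = Y" "KvY v Y = cj g L1"
  | (E2) g where "edge v Y \<in> E2" "g \<in> H" "\<alpha> g v2 = v" "cj g Y1 = Y" "KvY v Y = cj g X1"
  | (other) "edge v Y \<notin> E1" "edge v Y \<notin> E2" "KvY v Y = P (sp Y)"
proof -
  consider "edge v Y \<in> E1" | "edge v Y \<in> E2" | "edge v Y \<notin> E1" "edge v Y \<notin> E2" by blast
  then show thesis
  proof cases
    case 1
    then obtain g where "g \<in> H" "\<alpha> g v1 = v" "cj g Y1 = Y"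
      using edge_orbit_trans[OF edge_orbit_E1 base(5)] by blast
    then show thesis using E1 1 KvY_E1 by blast
  next
    case 2
    then obtain g where "g \<in> H" "\<alpha> g v2 = v" "cj g Y1 = Y"
      using edge_orbit_trans[OF edge_orbit_E2 base(6)] by blast
    then show thesis using E2 2 KvY_E2 by blast
  next
    case 3
    then show thesis using other KvY_other assms(2) by blast
  qed
qed

text \<open>This equivariance is what permits every later claim about components to be checked over
  \<open>Y1\<close> alone.\<close>

lemma KvY_conj:
  assumes "v \<in> V" "Y \<in> YS" "h \<in> H"
  shows "KvY (\<alpha> h v) (cj h Y) = cj h (KvY v Y)"
  using assms(1,2)
proof (cases rule: edge_cases)
  case (E1 g)
  have "edge (\<alpha> h v) (cj h Y) \<in> E1" using edge_orbit_closed[OF edge_orbit_E1] E1 assms by simp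
  moreover have "\<alpha> (h \<otimes> g) v1 = \<alpha> h v" "cj (h \<otimes> g) Y1 = cj h Y" "cj (h \<otimes> g) L1 = cj h (cj g L1)"
    using E1 assms alpha_mult base conj_by_comp H_carrier YS_carrier subgroup.subset[OF L1_subgroup(1)] by auto
  ultimately show ?thesis using KvY_E1[of _ _ "h \<otimes> g"] H_mult E1 assms by simp
next
  case (E2 g)
  have "edge (\<alpha> h v) (cj h Y) \<in> E2" using edge_orbit_closed[OF edge_orbit_E2] E2 assms by simp
  moreover have "\<alpha> (h \<otimes> g) v2 = \<alpha> h v" "cj (h \<otimes> g) Y1 = cj h Y" "cj (h \<otimes> g) X1 = cj h (cj g X1)"
    using E2 assms alpha_mult base conj_by_comp H_carrier YS_carrier subgroup.subset[OF X1'(1)] by auto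
  ultimately show ?thesis using KvY_E2[of _ _ "h \<otimes> g"] H_mult E2 assms by simp
next
  case other
  then have "edge (\<alpha> h v) (cj h Y) \<notin> E1" "edge (\<alpha> h v) (cj h Y) \<notin> E2"
    using edge_orbit_iff[OF edge_orbit_E1] edge_orbit_iff[OF edge_orbit_E2] assms by auto
  then show ?thesis using KvY_other YS_closed assms conj_P_YS other by simp
qed

lemma KvY_subgroup:
  assumes "v \<in> V" "Y \<in> YS"
  shows "subgroup (KvY v Y) S" "KvY v Y \<subseteq> P (sp Y)"
proof -
  have "subgroup (KvY v Y) S \<and> KvY v Y \<subseteq> P (sp Y)"
    using assms
  proof (cases rule: edge_cases)
    case (E1 g)
    then have "cj g L1 \<subseteq> cj g (P c)" using L1_subgroup(2) unfolding conj_by_image by auto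
    then show ?thesis
      using E1 conj_by_subgroup[OF H_carrier[OF E1(2)] L1_subgroup(1)] conj_P_YS[OF E1(2) base(1)] by simp
  next
    case (E2 g)
    then have "cj g X1 \<subseteq> cj g (P c)" using X1'(3) unfolding conj_by_image by auto
    then show ?thesis
      using E2 conj_by_subgroup[OF H_carrier[OF E2(2)] X1'(1)] conj_P_YS[OF E2(2) base(1)] by simp
  next
    case other
    then show ?thesis using P_subgroup supp_sub by simp
  qed
  then show "subgroup (KvY v Y) S" "KvY v Y \<subseteq> P (sp Y)" by auto
qed

end

section \<open>The components over one block\<close>

context group begin

lemma set_mult_commute:
  assumes "\<And>x y. x \<in> U \<Longrightarrow> y \<in> W \<Longrightarrow> x \<otimes> y = y \<otimes> x"
  shows "U <#> W = W <#> U"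
proof -
  have "U <#> W = (\<Union>x\<in>U. \<Union>y\<in>W. {y \<otimes> x})"
    unfolding set_mult_def using assms by (intro SUP_cong refl) simp
  also have "\<dots> = W <#> U" unfolding set_mult_def by (rule SUP_commute)
  finally show ?thesis .
qed

end

context construction begin

lemma c_carrier: "P c \<subseteq> carrier S" using P_carrier c_sub by auto

lemma Pc_subgroup: "subgroup (P c) S" using P_subgroup c_sub .

lemma KvY_v1: "KvY v1 Y1 = L1"
  using KvY_E1[OF base(5) H_one] alpha_one base conj_by_one YS_carrier subgroup.subset[OF L1_subgroup(1)] by simp

lemma KvY_v2: "KvY v2 Y1 = X1"
  using KvY_E2[OF base(6) H_one] alpha_one base conj_by_one YS_carrier subgroup.subset[OF X1'(1)] by simp

lemma E1_not_E2: "edge v Y \<in> E1 \<Longrightarrow> edge v Y \<notin> E2" using bipartite(2) by blast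

lemma v1_ne_v2: "v1 \<noteq> v2" using base E1_not_E2 by blast

lemma one_edge_values:
  assumes "\<not> two" "v \<in> V"
  shows "KvY v Y1 = (if v = v1 then A1 <#> B1 else if v = v2 then X1 else P c)"
    "edge v Y1 \<in> E1 \<longleftrightarrow> v = v1"
proof -
  have "card {v. edge v Y1 \<in> E1} = 1"
    using assms(1) degrees(1) base(1) card_incident[OF edge_orbit_E1] unfolding two_def by auto
  then obtain u where "{v. edge v Y1 \<in> E1} = {u}" by (rule card_1_singletonE)
  then have E1: "edge w Y1 \<in> E1 \<longleftrightarrow> w = v1" for w using base(5) by (metis mem_Collect_eq singletonD)
  then show "edge v Y1 \<in> E1 \<longleftrightarrow> v = v1" .
  have "KvY v Y1 = P c" if "v \<noteq> v1" "v \<noteq> v2"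
    using KvY_other[of v Y1] E1 E2_unique[OF base(6)] that base(1) by metis
  then show "KvY v Y1 = (if v = v1 then A1 <#> B1 else if v = v2 then X1 else P c)"
    using KvY_v1 KvY_v2 assms(1) unfolding L1_def by simp
qed

text \<open>The vertex \<open>u\<close> is the second neighbour of \<open>Y1\<close> in
  \<open>E1\<close>. Some \<open>g\<close> carries the first edge to the second; it fixes
  \<open>Y1\<close>, so it permutes \<open>{a, b}\<close>, and it must swap the two indices. As it
  fixes \<open>A1 <#> B1\<close>, it takes \<open>A1\<close> to \<open>B1\<close>, whence the
  component at \<open>u\<close>.\<close>

lemma two_edge_values:
  assumes two
  obtains u where "u \<in> V" "u \<noteq> v1" "u \<noteq> v2"
    "\<And>v. v \<in> V \<Longrightarrow> KvY v Y1 = (if v = v1 then A1 <#> T b else if v = u then T a <#> B1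
      else if v = v2 then X1 else P c)"
    "\<And>v. v \<in> V \<Longrightarrow> edge v Y1 \<in> E1 \<longleftrightarrow> v = v1 \<or> v = u"
proof -
  have "card {v. edge v Y1 \<in> E1} = 2"
    using assms card_incident[OF edge_orbit_E1] unfolding two_def by auto
  then obtain x y where xy: "{v. edge v Y1 \<in> E1} = {x, y}" "x \<noteq> y" unfolding card_2_iff by blast
  then have "v1 = x \<or> v1 = y" using base(5) by blast
  then obtain u where u: "{v. edge v Y1 \<in> E1} = {v1, u}" "u \<noteq> v1" using xy by (metis insert_commute)
  have E1: "edge w Y1 \<in> E1 \<longleftrightarrow> w = v1 \<or> w = u" for w using u(1) by blast
  have uV: "u \<in> V" using E1 edge_orbit_in[OF edge_orbit_E1] by blast
  have uv2: "u \<noteq> v2" using E1 E1_not_E2 base(6) by blast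
  obtain g where g: "g \<in> H" "\<alpha> g v1 = u" "cj g Y1 = Y1"
    using edge_orbit_trans[OF edge_orbit_E1 base(5), of u Y1] E1 by blast
  obtain \<pi> where pi: "permutes_factors g \<pi>" using H(2)[OF g(1)] by auto
  have pc: "\<pi> ` {a, b} = {a, b}" using conj_supp_YS[OF g(1) pi base(1)] unfolding g(3) c_eq by (rule sym)
  have cT: "cj g (T a) = T (\<pi> a)" "cj g (T b) = T (\<pi> b)" using perm_T[OF pi] sp_X1 by auto
  \<comment> \<open>Normalising both factors would put \<open>g\<close> into the stabiliser of the
    first edge, contrary to \<open>u \<noteq> v1\<close>.\<close>
  have "\<not> (\<pi> a = a \<and> \<pi> b = b)"
  proof
    assume "\<pi> a = a \<and> \<pi> b = b"
    then have "\<alpha> g v1 = v1" using two_stab[OF assms g(1)] cT by simp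
    then show False using g u by simp
  qed
  moreover have "{\<pi> a, \<pi> b} = {a, b}" using pc by (simp only: image_insert image_empty)
  ultimately have swap: "\<pi> a = b" "\<pi> b = a" unfolding doubleton_eq_iff by blast+
  have "cj g A1 = cj g (A1 <#> B1) \<inter> cj g (T a)"
    using A_eq conj_by_Int[OF H_carrier[OF g(1)]] subgroup.subset[OF AB_subgroup(1)] Ts_carrier by metis
  also have "\<dots> = B1" using norm_Y1(2)[OF g(1,3)] cT swap B_eq by simp
  finally have "cj g (A1 <#> T b) = B1 <#> T a"
    using conj_by_set_mult[OF H_carrier[OF g(1)]] Ts_carrier cT swap by simp
  also have "\<dots> = T a <#> B1"
  proof -
    have "x \<otimes> y = y \<otimes> x" if "x \<in> T a" "y \<in> B1" for x y
      using factor_commute[of "T a" "T b"] that B1(2) by auto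
    then show ?thesis by (rule set_mult_commute[symmetric])
  qed
  finally have Ku: "KvY u Y1 = T a <#> B1"
    using KvY_E1[of u Y1 g] g E1 assms unfolding L1_def by simp
  have "KvY v Y1 = P c" if "v \<noteq> v1" "v \<noteq> u" "v \<noteq> v2" for v
    using KvY_other[of v Y1] E1 E2_unique[OF base(6)] that base(1) by metis
  then have "KvY v Y1 = (if v = v1 then A1 <#> T b else if v = u then T a <#> B1
      else if v = v2 then X1 else P c)" for v
    using KvY_v1 KvY_v2 Ku assms unfolding L1_def by simp
  then show ?thesis using that uV u(2) uv2 E1 by blast
qed

lemma sigma_pair:
  assumes "subgroup U S" "U \<subseteq> T a" "subgroup W S" "W \<subseteq> T b"
  shows "\<sigma> {a} ` (U <#> W) = U" "\<sigma> {b} ` (U <#> W) = W"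
proof -
  have PP: "U \<subseteq> P {a}" "W \<subseteq> P {b}" using assms P_singleton sp_X1 by auto
  have mem: "x \<in> U <#> W \<longleftrightarrow> x \<in> P {a, b} \<and> \<sigma> {a} x \<in> U \<and> \<sigma> {b} x \<in> W" for x
    using pair_mem[of a b U W x] sp_X1 assms by simp
  have one: "\<one> \<in> U" "\<one> \<in> W" using assms subgroup.one_closed by auto
  have UW: "U \<subseteq> U <#> W" "W \<subseteq> U <#> W"
  proof -
    show "U \<subseteq> U <#> W" using set_multI[OF _ one(2)] subgroup.mem_carrier[OF assms(1)] by force
    show "W \<subseteq> U <#> W" using set_multI[OF one(1)] subgroup.mem_carrier[OF assms(3)] by force
  qed
  have "\<sigma> {a} ` U = U" "\<sigma> {b} ` W = W" using PP sigma_image_id sp_X1 by auto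
  then show "\<sigma> {a} ` (U <#> W) = U" "\<sigma> {b} ` (U <#> W) = W" using UW mem by blast+
qed

lemma sigma_P_block: "i \<in> I \<Longrightarrow> I \<subseteq> {1..k} \<Longrightarrow> \<sigma> {i} ` P I = T i"
proof -
  assume i: "i \<in> I" "I \<subseteq> {1..k}"
  then have i': "i \<in> {1..k}" by blast
  then have "\<sigma> {i} ` T i = T i" using sigma_image_id[of "{i}" "T i"] P_singleton[of i] by simp
  moreover have "\<sigma> {i} ` P I \<subseteq> T i" using sigma_T[OF _ i'] P_sub_M[OF i(2)] by blast
  ultimately show ?thesis using T_sub_P[OF i(1)] by blast
qed

lemma sigma_X1: "i \<in> c \<Longrightarrow> \<sigma> {i} ` X1 = T i"
  using X1 base unfolding full_strip_def by auto

lemma sigma_values: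
  assumes "i \<in> c"
  shows "\<sigma> {i} ` (A1 <#> B1) = (if i = a then A1 else B1)"
    "\<sigma> {i} ` (A1 <#> T b) = (if i = a then A1 else T i)"
    "\<sigma> {i} ` (T a <#> B1) = (if i = a then T i else B1)"
    "\<sigma> {i} ` P c = T i" "A1 \<noteq> T a" "B1 \<noteq> T b" "i = a \<or> i = b"
proof -
  have T: "subgroup (T a) S" "subgroup (T b) S" using T_subgroup sp_X1 by auto
  show i: "i = a \<or> i = b" using assms c_eq by auto
  have A: "A1 \<subseteq> T a" and B: "B1 \<subseteq> T b" using A1 B1 by auto
  show "A1 \<noteq> T a" "B1 \<noteq> T b" using A1 B1 by auto
  note s = sigma_pair[OF A1(1) A B1(1) B] sigma_pair[OF A1(1) A T(2) subset_refl]
    sigma_pair[OF T(1) subset_refl B1(1) B]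
  show "\<sigma> {i} ` (A1 <#> B1) = (if i = a then A1 else B1)"
    "\<sigma> {i} ` (A1 <#> T b) = (if i = a then A1 else T i)"
    "\<sigma> {i} ` (T a <#> B1) = (if i = a then T i else B1)"
    using s i sp_X1(2) by auto
  show "\<sigma> {i} ` P c = T i" using sigma_P_block[OF assms c_sub] .
qed

definition proper_projections :: "nat \<Rightarrow> 'a set \<Rightarrow> 'a set set" where
  "proper_projections i Y = {\<sigma> {i} ` KvY v Y |v. v \<in> V \<and> \<sigma> {i} ` KvY v Y \<noteq> T i}"

lemma singleton_values:
  assumes "\<And>v. v \<in> V \<Longrightarrow> f v = Z \<or> f v = t" "\<exists>v\<in>V. f v = Z" "Z \<noteq> t"
  shows "{f v |v. v \<in> V \<and> f v \<noteq> t} = {Z}"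
proof
  show "{f v |v. v \<in> V \<and> f v \<noteq> t} \<subseteq> {Z}" using assms(1) by auto
  show "{Z} \<subseteq> {f v |v. v \<in> V \<and> f v \<noteq> t}" using assms(2,3) by auto
qed

text \<open>\<open>X1\<close> and the whole block project onto every factor, so proper projections
  arise only from the neighbours in \<open>E1\<close>. With two such neighbours each of them is
  proper on exactly one of the two coordinates, so the proper projection is still unique.\<close>

lemma base_projections:
  assumes i: "i \<in> c"
  shows "proper_projections i Y1 = {if i = a then A1 else B1}"
    "v \<in> V \<Longrightarrow> edge v Y1 \<in> E1 \<longleftrightarrow> (\<exists>i\<in>c. \<sigma> {i} ` KvY v Y1 \<noteq> T i)"
proof -
  note s = sigma_values sigma_X1
  have abc: "a \<in> c" "b \<in> c" using c_eq by auto
  show "proper_projections i Y1 = {if i = a then A1 else B1}"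
  proof (cases two)
    case False
    note val = one_edge_values(1)[OF False]
    have "\<sigma> {i} ` KvY v Y1 = (if v = v1 then if i = a then A1 else B1 else T i)" if "v \<in> V" for v
      using val[OF that] s[OF i] by simp
    then show ?thesis unfolding proper_projections_def
      using s(5,6,7)[OF i] base(2) by (intro singleton_values) auto
  next
    case True
    obtain u where u: "u \<in> V" "u \<noteq> v1" "u \<noteq> v2"
      "\<And>v. v \<in> V \<Longrightarrow> KvY v Y1 = (if v = v1 then A1 <#> T b else if v = u then T a <#> B1
        else if v = v2 then X1 else P c)"
      "\<And>v. v \<in> V \<Longrightarrow> edge v Y1 \<in> E1 \<longleftrightarrow> v = v1 \<or> v = u"
      by (rule two_edge_values[OF True]) blast
    have "\<sigma> {i} ` KvY v Y1 = (if v = v1 \<and> i = a then A1 else if v = u \<and> i = b then B1 else T i)"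
      if "v \<in> V" for v
    proof -
      have "i = b \<longleftrightarrow> i \<noteq> a" using s(7)[OF i] sp_X1(2) by metis
      then show ?thesis
        using u(4)[OF that] u(2) s(1-4)[OF i] s(8)[OF i] by (cases "i = a"; cases "v = v1"; cases "v = u"; simp)
    qed
    then show ?thesis unfolding proper_projections_def
      using s(5,6,7)[OF i] base(2) u(1,2) sp_X1(2) by (intro singleton_values) auto
  qed
  show "edge v Y1 \<in> E1 \<longleftrightarrow> (\<exists>i\<in>c. \<sigma> {i} ` KvY v Y1 \<noteq> T i)" if v: "v \<in> V"
  proof (cases two)
    case False
    note val = one_edge_values[OF False v]
    have "\<sigma> {a} ` KvY v Y1 \<noteq> T a" if "v = v1" using val(1) that s(1)[OF abc(1)] s(5)[OF abc(1)] by simp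
    moreover have "\<sigma> {i} ` KvY v Y1 = T i" if "v \<noteq> v1" "i \<in> c" for i
      using val(1) that s(4)[OF that(2)] s(8)[OF that(2)] by simp
    ultimately show ?thesis using val(2) abc(1) by metis
  next
    case True
    obtain u where u: "u \<in> V" "u \<noteq> v1" "u \<noteq> v2"
      "\<And>v. v \<in> V \<Longrightarrow> KvY v Y1 = (if v = v1 then A1 <#> T b else if v = u then T a <#> B1
        else if v = v2 then X1 else P c)"
      "\<And>v. v \<in> V \<Longrightarrow> edge v Y1 \<in> E1 \<longleftrightarrow> v = v1 \<or> v = u"
      by (rule two_edge_values[OF True]) blast
    have "\<sigma> {a} ` KvY v Y1 \<noteq> T a" if "v = v1"
      using u(4)[OF v] that s(2)[OF abc(1)] s(5)[OF abc(1)] by simp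
    moreover have "\<sigma> {b} ` KvY v Y1 \<noteq> T b" if "v = u"
      using u(2) u(4)[OF v] that s(3)[OF abc(2)] s(6)[OF abc(2)] sp_X1(2) by simp
    moreover have "\<sigma> {i} ` KvY v Y1 = T i" if "v \<noteq> v1" "v \<noteq> u" "i \<in> c" for i
      using u(4)[OF v] that s(4)[OF that(3)] s(8)[OF that(3)] by simp
    ultimately show ?thesis using u(5)[OF v] abc by metis
  qed
qed

text \<open>The two components of the two-edge case intersect in \<open>A1 <#> B1\<close>, so in
  both cases the intersection is that of \<open>X1\<close> with \<open>A1 <#> B1\<close>. By (iv)
  this is the projection of \<open>D\<close> to the block, and since \<open>D\<close> is the product
  of the strips, that projection is \<open>Y1\<close>.\<close>

lemma base_inter: "x \<in> M \<Longrightarrow> (\<forall>v\<in>V. x \<in> KvY v Y1) \<longleftrightarrow> x \<in> Y1"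
proof -
  have YP: "\<And>Y. Y \<in> YS \<Longrightarrow> Y \<subseteq> P (sp Y)" using sigma_supp YS(2) by blast
  have "D = block_prod (\<lambda>Y. Y)" using generate_eq_block_prod[of "\<lambda>Y. Y"] YS(1) YP D(1) by simp
  then have Y1: "X1 \<inter> (A1 <#> B1) = Y1"
    using inter sigma_block_prod[of "\<lambda>Y. Y" Y1] YS(1) YP base by simp
  have sub: "x \<in> P c" if "x \<in> X1" for x using that X1' by auto
  show ?thesis
  proof (cases two)
    case False
    note val = one_edge_values(1)[OF False]
    have "(\<forall>v\<in>V. x \<in> KvY v Y1) \<longleftrightarrow> x \<in> A1 <#> B1 \<and> x \<in> X1"
      using val val[OF base(2)] val[OF base(3)] v1_ne_v2 sub base(2,3) by (auto split: if_splits)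
    then show ?thesis using Y1 by blast
  next
    case True
    obtain u where u: "u \<in> V" "u \<noteq> v1" "u \<noteq> v2"
      "\<And>v. v \<in> V \<Longrightarrow> KvY v Y1 = (if v = v1 then A1 <#> T b else if v = u then T a <#> B1
        else if v = v2 then X1 else P c)"
      "\<And>v. v \<in> V \<Longrightarrow> edge v Y1 \<in> E1 \<longleftrightarrow> v = v1 \<or> v = u"
      by (rule two_edge_values[OF True]) blast
    have "(\<forall>v\<in>V. x \<in> KvY v Y1) \<longleftrightarrow> x \<in> A1 <#> T b \<and> x \<in> T a <#> B1 \<and> x \<in> X1"
      using u(1-3) u(4) u(4)[OF base(2)] u(4)[OF base(3)] u(4)[OF u(1)] v1_ne_v2 sub base(2,3)
      by (auto split: if_splits)
    also have "\<dots> \<longleftrightarrow> x \<in> A1 <#> B1 \<and> x \<in> X1" using ATb_mem AB_mem TaB_mem by auto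
    finally show ?thesis using Y1 by blast
  qed
qed

text \<open>The one-block counterpart of the intersection of the remaining members in
  \<open>cartesian_system\<close>, with \<open>P (sp Y)\<close> in place of
  \<open>M\<close>.\<close>

definition others :: "'v \<Rightarrow> 'a set \<Rightarrow> 'a set" where
  "others v Y = {x \<in> P (sp Y). \<forall>w\<in>V - {v}. x \<in> KvY w Y}"

lemma others_one: "v \<in> V \<Longrightarrow> Y \<in> YS \<Longrightarrow> \<one> \<in> others v Y"
  unfolding others_def using KvY_subgroup(1) subgroup.one_closed P_subgroup[OF supp_sub] by fastforce

text \<open>With one edge, \<open>X1\<close> and \<open>A1 <#> B1\<close> are each other's
  complements and (iv) suffices. With two edges the same holds at \<open>v2\<close>, while at
  \<open>v1\<close> and \<open>u\<close> part of \<open>X1\<close> is lost to the intersection and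
  \<open>diagonal_factorisation\<close> is needed. At all other vertices the component is the whole
  block.\<close>

lemma base_factorisation:
  assumes v: "v \<in> V"
  shows "KvY v Y1 <#> others v Y1 = P c"
proof -
  have XAB: "X1 <#> (A1 <#> B1) = P c" using fact T_ab by simp
  then have ABX: "(A1 <#> B1) <#> X1 = P c"
    using set_mult_swap[OF X1'(1) AB_subgroup(1) Pc_subgroup] by simp
  have absorb: "P c <#> others v Y1 = P c"
    using set_mult_absorb[OF Pc_subgroup _ others_one[OF v base(1)]] unfolding others_def by auto
  have sub: "x \<in> P c" if "x \<in> X1 \<or> x \<in> A1 <#> B1" for x using that X1' AB_mem by auto
  show ?thesis
  proof (cases two)
    case False
    note val = one_edge_values(1)[OF False]
    have vals: "KvY v1 Y1 = A1 <#> B1" "KvY v2 Y1 = X1" using val base(2,3) v1_ne_v2 by auto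
    have "others v1 Y1 = X1" unfolding others_def
      using val vals v1_ne_v2 sub base(2,3) by (auto split: if_splits)
    moreover have "others v2 Y1 = A1 <#> B1" unfolding others_def
      using val vals v1_ne_v2 sub base(2,3) by (auto split: if_splits)
    ultimately show ?thesis using vals XAB ABX absorb val[OF v] by (cases "v = v1"; cases "v = v2") auto
  next
    case True
    obtain u where u: "u \<in> V" "u \<noteq> v1" "u \<noteq> v2"
      "\<And>v. v \<in> V \<Longrightarrow> KvY v Y1 = (if v = v1 then A1 <#> T b else if v = u then T a <#> B1
        else if v = v2 then X1 else P c)"
      "\<And>v. v \<in> V \<Longrightarrow> edge v Y1 \<in> E1 \<longleftrightarrow> v = v1 \<or> v = u"
      by (rule two_edge_values[OF True]) blast
    have vals: "KvY v1 Y1 = A1 <#> T b" "KvY v2 Y1 = X1" "KvY u Y1 = T a <#> B1"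
      using u base(2,3) v1_ne_v2 by auto
    have o1: "others v1 Y1 = (T a <#> B1) \<inter> X1" unfolding others_def
      using u(4) vals v1_ne_v2 u(1-3) sub base(2,3) by (auto split: if_splits)
    have ou: "others u Y1 = (A1 <#> T b) \<inter> X1" unfolding others_def
      using u(4) vals v1_ne_v2 u(1-3) sub base(2,3) by (auto split: if_splits)
    have "others v2 Y1 = (A1 <#> T b) \<inter> (T a <#> B1)" unfolding others_def
      using u(4) vals v1_ne_v2 u(1-3) ATb_mem base(2,3) by (auto split: if_splits)
    then have o2: "others v2 Y1 = A1 <#> B1" using ATb_mem AB_mem TaB_mem by auto
    have abs: "A1 \<subseteq> T a" "B1 \<subseteq> T b" using A1 B1 by auto
    have f1: "(A1 <#> T b) <#> ((T a <#> B1) \<inter> X1) = P c"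
      using diagonal_factorisation[OF sp_X1(3,4,2) X1'(1) _ A1(1) abs(1) B1(1) abs(2)] X1'(3) ABX c_eq by simp
    have sw: "U <#> W = W <#> U" if "U \<subseteq> T a" "W \<subseteq> T b" for U W
      using factor_commute[OF that] by (rule set_mult_commute)
    \<comment> \<open>The same lemma with the roles of the two coordinates exchanged.\<close>
    have "(B1 <#> T a) <#> ((T b <#> A1) \<inter> X1) = P c"
      using diagonal_factorisation[OF sp_X1(4,3) _ X1'(1) _ B1(1) abs(2) A1(1) abs(1)] X1'(3) ABX c_eq sp_X1(2)
        sw[OF abs] by (simp add: insert_commute)
    then have f2: "(T a <#> B1) <#> ((A1 <#> T b) \<inter> X1) = P c"
      using sw[OF abs(1) subset_refl] sw[OF subset_refl abs(2)] by simp
    show ?thesis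
      using vals u(4)[OF v] o1 ou o2 f1 f2 XAB absorb by (cases "v = v1"; cases "v = u"; cases "v = v2") auto
  qed
qed

text \<open>A component on an edge of \<open>E1\<close> has a proper projection and is not full. The
  whole block is not a strip, because its \<open>b\<close>-coordinate vanishes on
  \<open>T a\<close>, which is non-trivial as it has a proper subgroup.\<close>

lemma base_strip_E2:
  assumes v: "v \<in> V" "full_strip S M T k (KvY v Y1)" "sp (KvY v Y1) = c"
  shows "edge v Y1 \<in> E2"
proof (rule ccontr)
  assume nE2: "edge v Y1 \<notin> E2"
  have abc: "a \<in> c" "b \<in> c" using c_eq by auto
  have "edge v Y1 \<notin> E1"
    using base_projections(2)[OF abc(1) v(1)] v(2,3) unfolding full_strip_def by auto
  then have KP: "KvY v Y1 = P c" using KvY_other nE2 base(1) by simp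
  then have inj: "inj_on (\<sigma> {b}) (P c)" using v strip_iff_inj[OF fin(1)] abc unfolding full_strip_def by auto
  have "x = \<one>" if x: "x \<in> T a" for x
  proof -
    have Px: "x \<in> P {a}" "x \<in> P c" "\<one> \<in> P c"
      using x P_singleton sp_X1 T_sub_P[OF abc(1)] subgroup.one_closed[OF Pc_subgroup] by auto
    have "\<sigma> {b} x = \<one>" using sigma_disjoint[of "{b}" "{a}"] Px sp_X1 by auto
    then show "x = \<one>" using inj_onD[OF inj] Px sigma_one[of "{b}"] sp_X1 by auto
  qed
  then show False using A1(2) subgroup.one_closed[OF A1(1)] by blast
qed

section \<open>Transport from the base block to the other blocks\<close>

lemma transport:
  assumes "v \<in> V" "Y \<in> YS"
  obtains h w \<pi> where "h \<in> H" "w \<in> V" "v = \<alpha> h w" "Y = cj h Y1" "KvY v Y = cj h (KvY w Y1)"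
    "permutes_factors h \<pi>" "sp Y = \<pi> ` c"
proof -
  obtain h where h: "h \<in> H" "Y = cj h Y1" using YS_from_base assms by blast
  obtain \<pi> where "permutes_factors h \<pi>" using H(2)[OF h(1)] by auto
  moreover have w: "\<alpha> (inv h) v \<in> V" "v = \<alpha> h (\<alpha> (inv h) v)"
    using alpha_V H_inv alpha_inv' h(1) assms(1) by auto
  moreover have "KvY v Y = cj h (KvY (\<alpha> (inv h) v) Y1)"
    using KvY_conj[OF w(1) base(1) h(1)] w(2) h(2) by simp
  ultimately show ?thesis using that[OF h(1) w h(2)] conj_supp_YS[OF h(1) _ base(1)] h(2) by simp
qed

lemma conj_by_eq_iff:
  "g \<in> H \<Longrightarrow> U \<subseteq> carrier S \<Longrightarrow> W \<subseteq> carrier S \<Longrightarrow> cj g U = cj g W \<longleftrightarrow> U = W"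
  using conj_by_inv H_carrier by metis

lemma KvY_M: "v \<in> V \<Longrightarrow> Y \<in> YS \<Longrightarrow> KvY v Y \<subseteq> M"
  using KvY_subgroup(2) P_sub_M[OF supp_sub] by blast

lemma transport_projection:
  assumes "h \<in> H" "permutes_factors h \<pi>" "w \<in> V" "i \<in> c"
  shows "\<sigma> {\<pi> i} ` cj h (KvY w Y1) = cj h (\<sigma> {i} ` KvY w Y1)"
    "\<sigma> {\<pi> i} ` cj h (KvY w Y1) = T (\<pi> i) \<longleftrightarrow> \<sigma> {i} ` KvY w Y1 = T i"
proof -
  have i: "i \<in> {1..k}" using assms(4) c_sub by blast
  show *: "\<sigma> {\<pi> i} ` cj h (KvY w Y1) = cj h (\<sigma> {i} ` KvY w Y1)"
    using conj_sigma_image[OF assms(2), of "{i}" "KvY w Y1"] KvY_M[OF assms(3) base(1)] i by simp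
  have "\<sigma> {i} ` KvY w Y1 \<subseteq> carrier S" "T i \<subseteq> carrier S"
    using sigma_carrier[of "{i}"] KvY_M[OF assms(3) base(1)] i subgroup.subset[OF T_subgroup[OF i]] by auto
  then show "\<sigma> {\<pi> i} ` cj h (KvY w Y1) = T (\<pi> i) \<longleftrightarrow> \<sigma> {i} ` KvY w Y1 = T i"
    unfolding * perm_T[OF assms(2) i, symmetric] using conj_by_eq_iff[OF assms(1)] by simp
qed

lemma E1_iff_projection:
  assumes v: "v \<in> V" "Y \<in> YS"
  shows "edge v Y \<in> E1 \<longleftrightarrow> (\<exists>i\<in>sp Y. \<sigma> {i} ` KvY v Y \<noteq> T i)"
proof -
  obtain h w \<pi> where h: "h \<in> H" "w \<in> V" "v = \<alpha> h w" "Y = cj h Y1" "KvY v Y = cj h (KvY w Y1)"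
    "permutes_factors h \<pi>" "sp Y = \<pi> ` c" using transport[OF v] by metis
  have "edge v Y \<in> E1 \<longleftrightarrow> edge w Y1 \<in> E1" using edge_orbit_iff[OF edge_orbit_E1 h(1,2) base(1)] h by simp
  also have "\<dots> \<longleftrightarrow> (\<exists>i\<in>c. \<sigma> {i} ` KvY w Y1 \<noteq> T i)" using base_projections(2)[of a w] h c_eq by simp
  also have "\<dots> \<longleftrightarrow> (\<exists>i\<in>c. \<sigma> {\<pi> i} ` KvY v Y \<noteq> T (\<pi> i))"
    using transport_projection(2)[OF h(1,6,2)] h(5) by simp
  finally show ?thesis using h(7) by auto
qed

lemma card_proper_projections:
  assumes Y: "Y \<in> YS" "j \<in> sp Y"
  shows "card (proper_projections j Y) = 1"
proof -
  obtain h w0 \<pi> where h: "h \<in> H" "Y = cj h Y1" "permutes_factors h \<pi>" "sp Y = \<pi> ` c"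
    using transport[OF base(2) Y(1)] by metis
  obtain i where i: "i \<in> c" "j = \<pi> i" using h Y(2) by blast
  have K: "KvY (\<alpha> h w) Y = cj h (KvY w Y1)" if "w \<in> V" for w using KvY_conj that base h by simp
  note tp = transport_projection[OF h(1,3) _ i(1)]
  have "proper_projections j Y = cj h ` proper_projections i Y1"
  proof
    show "proper_projections j Y \<subseteq> cj h ` proper_projections i Y1"
    proof
      fix Z assume "Z \<in> proper_projections j Y"
      then obtain v where v: "v \<in> V" "\<sigma> {j} ` KvY v Y \<noteq> T j" "Z = \<sigma> {j} ` KvY v Y"
        unfolding proper_projections_def by blast
      then obtain w where w: "w \<in> V" "v = \<alpha> h w" using alpha_image[OF h(1)] by blast
      then have "\<sigma> {i} ` KvY w Y1 \<noteq> T i" "Z = cj h (\<sigma> {i} ` KvY w Y1)"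
        using v K[OF w(1)] tp[OF w(1)] i(2) by auto
      then show "Z \<in> cj h ` proper_projections i Y1" unfolding proper_projections_def using w(1) by blast
    qed
    show "cj h ` proper_projections i Y1 \<subseteq> proper_projections j Y"
    proof
      fix Z assume "Z \<in> cj h ` proper_projections i Y1"
      then obtain w where w: "w \<in> V" "\<sigma> {i} ` KvY w Y1 \<noteq> T i" "Z = cj h (\<sigma> {i} ` KvY w Y1)"
        unfolding proper_projections_def by blast
      then have "\<sigma> {j} ` KvY (\<alpha> h w) Y \<noteq> T j" "Z = \<sigma> {j} ` KvY (\<alpha> h w) Y"
        using K[OF w(1)] tp[OF w(1)] i(2) by auto
      then show "Z \<in> proper_projections j Y"
        unfolding proper_projections_def using alpha_V[OF h(1) w(1)] by blast
    qed
  qed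
  then show ?thesis using base_projections(1)[OF i(1)] by simp
qed

lemma inter_KvY:
  assumes Y: "Y \<in> YS" "x \<in> M"
  shows "(\<forall>v\<in>V. x \<in> KvY v Y) \<longleftrightarrow> x \<in> Y"
proof -
  obtain h where h: "h \<in> H" "Y = cj h Y1" using YS_from_base Y by blast
  obtain \<pi> where pi: "permutes_factors h \<pi>" using H(2)[OF h(1)] by auto
  have hc: "h \<in> carrier S" using H_carrier h by simp
  have "x \<in> cj h M" using Y conj_M[OF pi] by simp
  then obtain y where y: "y \<in> M" "x = h \<otimes> y \<otimes> inv h" unfolding conj_by_image by auto
  have mem: "x \<in> cj h L \<longleftrightarrow> y \<in> L" if L: "L \<subseteq> M" for L
  proof
    assume "x \<in> cj h L"
    then obtain z where "z \<in> L" "x = h \<otimes> z \<otimes> inv h" unfolding conj_by_image by auto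
    then show "y \<in> L" using inj_onD[OF conj_inj[OF hc], of y z] y M_carrier L by auto
  qed (use y in \<open>auto simp: conj_by_image\<close>)
  have "(\<forall>v\<in>V. x \<in> KvY v Y) \<longleftrightarrow> (\<forall>v\<in>\<alpha> h ` V. x \<in> KvY v Y)" using alpha_image[OF h(1)] by simp
  also have "\<dots> \<longleftrightarrow> (\<forall>w\<in>V. y \<in> KvY w Y1)" using mem KvY_M KvY_conj h base(1) by auto
  also have "\<dots> \<longleftrightarrow> x \<in> Y" using base_inter[OF y(1)] mem[OF YS(2)[OF base(1)]] h by simp
  finally show ?thesis .
qed

lemma KvY_factorisation:
  assumes v: "v \<in> V" "Y \<in> YS"
  shows "KvY v Y <#> others v Y = P (sp Y)"
proof -
  obtain h w \<pi> where h: "h \<in> H" "w \<in> V" "v = \<alpha> h w" "Y = cj h Y1" "KvY v Y = cj h (KvY w Y1)"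
    using transport[OF v] by metis
  have hc: "h \<in> carrier S" using H_carrier h by simp
  have img: "\<alpha> h ` (V - {w}) = V - {v}"
    using inj_on_image_set_diff[OF group_action.inj_prop[OF action], of h V "{w}"] h alpha_image by simp
  have "cj h (others w Y1) \<subseteq> others v Y"
  proof
    fix x assume "x \<in> cj h (others w Y1)"
    then obtain y where y: "y \<in> P c" "\<forall>u\<in>V - {w}. y \<in> KvY u Y1" "x = h \<otimes> y \<otimes> inv h"
      unfolding others_def conj_by_image by auto
    have "x \<in> cj h (P c)" using y unfolding conj_by_image by auto
    then have "x \<in> P (sp Y)" using conj_P_YS[OF h(1) base(1)] h by simp
    moreover have "x \<in> KvY (\<alpha> h u) Y" if "u \<in> V - {w}" for u
      using y that KvY_conj[of u Y1 h] base(1) h unfolding conj_by_image by auto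
    then have "\<forall>u\<in>\<alpha> h ` (V - {w}). x \<in> KvY u Y" by blast
    ultimately show "x \<in> others v Y" unfolding others_def img by blast
  qed
  moreover have "others w Y1 \<subseteq> carrier S" using c_carrier unfolding others_def by auto
  then have "cj h (KvY w Y1) <#> cj h (others w Y1) = P (sp Y)"
    using base_factorisation[OF h(2)] conj_by_set_mult[OF hc, of "KvY w Y1" "others w Y1"]
      subgroup.subset[OF KvY_subgroup(1)[OF h(2) base(1)]] conj_P_YS[OF h(1) base(1)] h(4) by simp
  ultimately have "P (sp Y) \<subseteq> KvY v Y <#> others v Y" using h(5) mono_set_mult[OF subset_refl] by metis
  moreover have "KvY v Y <#> others v Y \<subseteq> P (sp Y)"
  proof
    fix z assume "z \<in> KvY v Y <#> others v Y"
    then obtain x y where "x \<in> KvY v Y" "y \<in> others v Y" "z = x \<otimes> y" using set_mult_iff by auto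
    then show "z \<in> P (sp Y)"
      using KvY_subgroup(2)[OF v] subgroup.m_closed[OF P_subgroup[OF supp_sub]] by (auto simp: others_def)
  qed
  ultimately show ?thesis by blast
qed

text \<open>Recognises the edges of \<open>E2\<close> from the components alone. Conjugates of
  \<open>X1\<close> are full strips on their blocks; conversely, pulling back to \<open>Y1\<close>
  reduces to \<open>base_strip_E2\<close>.\<close>

lemma strip_E2_iff:
  assumes v: "v \<in> V" "Y \<in> YS"
  shows "full_strip S M T k (KvY v Y) \<and> sp (KvY v Y) = sp Y \<longleftrightarrow> edge v Y \<in> E2"
proof
  assume "edge v Y \<in> E2"
  then obtain g where g: "g \<in> H" "cj g Y1 = Y" "KvY v Y = cj g X1"
    using edge_orbit_trans[OF edge_orbit_E2 base(6)] KvY_E2 by metis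
  obtain \<pi> where pi: "permutes_factors g \<pi>" using H(2)[OF g(1)] by auto
  show "full_strip S M T k (KvY v Y) \<and> sp (KvY v Y) = sp Y"
    using conj_full_strip[OF pi fin(1) X1] conj_supp[OF pi X1'(1,2)] conj_supp_YS[OF g(1) pi base(1)] g base
    by simp
next
  assume *: "full_strip S M T k (KvY v Y) \<and> sp (KvY v Y) = sp Y"
  obtain h w \<pi> where h: "h \<in> H" "w \<in> V" "v = \<alpha> h w" "Y = cj h Y1" "KvY v Y = cj h (KvY w Y1)"
    using transport[OF v] by metis
  have hc: "h \<in> carrier S" using H_carrier h by simp
  have pull: "KvY w Y1 = cj (inv h) (KvY v Y)" "Y1 = cj (inv h) Y"
    using h conj_by_inv[OF hc] subgroup.subset[OF KvY_subgroup(1)[OF h(2) base(1)]] YS_carrier[OF base(1)] by auto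
  obtain \<rho> where rho: "permutes_factors (inv h) \<rho>" using H(2)[OF H_inv[OF h(1)]] by auto
  have "full_strip S M T k (KvY w Y1)" using conj_full_strip[OF rho fin(1)] * pull by simp
  moreover have "sp (KvY w Y1) = c"
    using conj_supp[OF rho KvY_subgroup(1)[OF v] KvY_M[OF v]] conj_supp_YS[OF H_inv[OF h(1)] rho v(2)] * pull by simp
  ultimately have "edge w Y1 \<in> E2" using base_strip_E2[OF h(2)] by simp
  then show "edge v Y \<in> E2" using edge_orbit_closed[OF edge_orbit_E2 _ h(1)] h by simp
qed

end

section \<open>The Cartesian system and its graph\<close>

context construction begin

definition K :: "'v \<Rightarrow> 'a set" where "K v = generate S (\<Union>Y\<in>YS. KvY v Y)"

abbreviation "\<K> \<equiv> K ` V"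

lemma K_eq: "v \<in> V \<Longrightarrow> K v = block_prod (KvY v)"
  unfolding K_def by (intro generate_eq_block_prod KvY_subgroup)

lemma K_subgroup: "v \<in> V \<Longrightarrow> subgroup (K v) S"
  using K_eq block_prod_subgroup KvY_subgroup(1) by simp

lemma K_sub_M: "v \<in> V \<Longrightarrow> K v \<subseteq> M"
  using K_eq block_prod_sub_M by simp

lemma K_conj:
  assumes "g \<in> H" "v \<in> V"
  shows "K (\<alpha> g v) = cj g (K v)"
proof -
  have "(\<Union>Y\<in>YS. KvY v Y) \<subseteq> carrier S"
    using subgroup.subset[OF KvY_subgroup(1)[OF assms(2)]] by (rule UN_least)
  then have "cj g (K v) = generate S (cj g (\<Union>Y\<in>YS. KvY v Y))"
    unfolding K_def by (rule conj_by_generate[OF H_carrier[OF assms(1)]])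
  also have "cj g (\<Union>Y\<in>YS. KvY v Y) = (\<Union>Y\<in>YS. cj g (KvY v Y))"
    unfolding conj_by_image by (rule image_UN)
  also have "\<dots> = (\<Union>Y\<in>YS. KvY (\<alpha> g v) (cj g Y))"
    using KvY_conj assms by (intro SUP_cong refl) simp
  also have "\<dots> = (\<Union>Y\<in>cj g ` YS. KvY (\<alpha> g v) Y)" by simp
  finally show ?thesis unfolding K_def YS_image[OF assms(1)] by simp
qed

lemma K_invariant: "g \<in> H \<Longrightarrow> cj g ` \<K> = \<K>"
proof -
  assume g: "g \<in> H"
  have "cj g ` \<K> = K ` \<alpha> g ` V" unfolding image_image using K_conj[OF g] by simp
  then show ?thesis using alpha_image[OF g] by simp
qed

lemma K_transitive: "L \<in> \<K> \<Longrightarrow> N \<in> \<K> \<Longrightarrow> \<exists>g\<in>H. cj g L = N"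
  using V_trans K_conj by fastforce

text \<open>Membership in a block product is tested block by block, so the quantifiers over vertices
  and over strips can be interchanged and \<open>inter_KvY\<close> applied to each block.\<close>

lemma K_Inter: "\<Inter>\<K> = D"
proof -
  have YP: "\<And>Y. Y \<in> YS \<Longrightarrow> Y \<subseteq> P (sp Y)" using sigma_supp YS(2) by blast
  have D: "D = block_prod (\<lambda>Y. Y)" using generate_eq_block_prod[of "\<lambda>Y. Y"] YS(1) YP D(1) by simp
  have "x \<in> \<Inter>\<K> \<longleftrightarrow> x \<in> D" for x
  proof -
    have "x \<in> \<Inter>\<K> \<longleftrightarrow> (\<forall>v\<in>V. x \<in> block_prod (KvY v))" using K_eq by simp
    also have "\<dots> \<longleftrightarrow> x \<in> M \<and> (\<forall>Y\<in>YS. \<forall>v\<in>V. \<sigma> (sp Y) x \<in> KvY v Y)"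
      using base(2) unfolding block_prod_def by auto
    also have "\<dots> \<longleftrightarrow> x \<in> M \<and> (\<forall>Y\<in>YS. \<sigma> (sp Y) x \<in> Y)"
      using inter_KvY[OF _ sigma_M[OF supp_sub]] by (intro conj_cong ball_cong refl)
    finally show ?thesis unfolding D block_prod_def by simp
  qed
  then show ?thesis by blast
qed

text \<open>The intersection of the remaining members is itself a block product, with components
  \<open>others v\<close>; the factorisations over the blocks are then glued.\<close>

lemma K_factorisation:
  assumes v: "v \<in> V"
  shows "K v <#> (M \<inter> (\<Inter>w\<in>V - {v}. K w)) = M"
proof -
  have "M \<inter> (\<Inter>w\<in>V - {v}. K w) = block_prod (others v)"
  proof -
    have "x \<in> M \<inter> (\<Inter>w\<in>V - {v}. K w) \<longleftrightarrow> x \<in> block_prod (others v)" for x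
    proof -
      have "x \<in> M \<inter> (\<Inter>w\<in>V - {v}. K w) \<longleftrightarrow> x \<in> M \<and> (\<forall>w\<in>V - {v}. x \<in> block_prod (KvY w))"
        using K_eq by simp
      also have "\<dots> \<longleftrightarrow> x \<in> block_prod (others v)"
        unfolding block_prod_def others_def using sigma_P[OF supp_sub] by auto
      finally show ?thesis .
    qed
    then show ?thesis by blast
  qed
  moreover have "block_prod (KvY v) <#> block_prod (others v) = M"
    using KvY_subgroup(2)[OF v] KvY_factorisation[OF v]
    by (intro block_prod_mult_eq_M) (auto simp: others_def)
  ultimately show ?thesis using K_eq[OF v] by simp
qed

lemma sigma_K:
  assumes "v \<in> V" "Y \<in> YS" "i \<in> sp Y"
  shows "\<sigma> {i} ` K v = \<sigma> {i} ` KvY v Y"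
  using sigma_block_prod_sub[of "KvY v" Y "{i}"] KvY_subgroup[OF assms(1)] assms K_eq by simp

lemma block_of: "i \<in> {1..k} \<Longrightarrow> \<exists>Y\<in>YS. i \<in> sp Y"
  using cover by blast

lemma sigma_M_image: "i \<in> {1..k} \<Longrightarrow> \<sigma> {i} ` M = T i"
  using sigma_P_block[of i "{1..k}"] P_top by simp

lemma vertex_E1: "v \<in> V \<Longrightarrow> \<exists>Y\<in>YS. edge v Y \<in> E1"
proof -
  assume "v \<in> V"
  then obtain g where "g \<in> H" "\<alpha> g v1 = v" using V_trans[OF base(2)] by blast
  then show ?thesis using edge_orbit_closed[OF edge_orbit_E1 base(5)] YS_closed[OF base(1)] by blast
qed

text \<open>By transitivity on \<open>V\<close> each vertex lies on an edge of \<open>E1\<close>,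
  and over the corresponding block \<open>K v\<close> has a proper projection.\<close>

lemma K_proper: "v \<in> V \<Longrightarrow> K v \<subset> M"
proof -
  assume v: "v \<in> V"
  obtain Y where Y: "Y \<in> YS" "edge v Y \<in> E1" using vertex_E1[OF v] by blast
  then obtain i where i: "i \<in> sp Y" "\<sigma> {i} ` KvY v Y \<noteq> T i" using E1_iff_projection v by blast
  have "K v \<noteq> M"
  proof
    assume "K v = M"
    then have "\<sigma> {i} ` M = \<sigma> {i} ` KvY v Y" using sigma_K[OF v Y(1) i(1)] by simp
    moreover have "i \<in> {1..k}" using i supp_sub by blast
    ultimately show False using i sigma_M_image by simp
  qed
  then show ?thesis using K_sub_M[OF v] by blast
qed

text \<open>If \<open>K v = K w\<close> with \<open>w\<close> different from \<open>v\<close>, the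
  intersection over the vertices other than \<open>v\<close> lies in \<open>K w\<close>, that is, in
  \<open>K v\<close>; the factorisation then collapses to \<open>K v = M\<close>.\<close>

lemma K_inj: "inj_on K V"
proof (rule inj_onI, rule ccontr)
  fix v w assume vw: "v \<in> V" "w \<in> V" "K v = K w" "v \<noteq> w"
  have "K v <#> (M \<inter> (\<Inter>u\<in>V - {v}. K u)) \<subseteq> K v"
  proof
    fix z assume "z \<in> K v <#> (M \<inter> (\<Inter>u\<in>V - {v}. K u))"
    then obtain x y where "x \<in> K v" "y \<in> M \<inter> (\<Inter>u\<in>V - {v}. K u)" "z = x \<otimes> y"
      using set_mult_iff by auto
    moreover from this have "y \<in> K v" using vw by auto
    ultimately show "z \<in> K v" using subgroup.m_closed[OF K_subgroup[OF vw(1)]] by simp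
  qed
  then show False using K_factorisation[OF vw(1)] K_proper[OF vw(1)] by blast
qed

lemma K_system:
  shows "finite \<K>" "\<K> \<noteq> {}" "\<And>L. L \<in> \<K> \<Longrightarrow> subgroup L S \<and> L \<subset> M"
    "\<And>L. L \<in> \<K> \<Longrightarrow> L <#> (M \<inter> \<Inter>(\<K> - {L})) = M"
proof -
  show "finite \<K>" "\<K> \<noteq> {}" using finite_V base by auto
  show "subgroup L S \<and> L \<subset> M" if "L \<in> \<K>" for L using that K_subgroup K_proper by blast
  show "L <#> (M \<inter> \<Inter>(\<K> - {L})) = M" if L: "L \<in> \<K>" for L
  proof -
    obtain v where v: "v \<in> V" "L = K v" using L by blast
    have "\<K> - {L} = K ` (V - {v})" using inj_on_image_set_diff[OF K_inj, of V "{v}"] v by simp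
    then show ?thesis using K_factorisation[OF v(1)] v(2) by simp
  qed
qed

lemma card_F:
  assumes "i \<in> {1..k}"
  shows "card {\<sigma> {i} ` L |L. L \<in> \<K> \<and> \<sigma> {i} ` L \<noteq> T i} = 1"
proof -
  obtain Y where Y: "Y \<in> YS" "i \<in> sp Y" using block_of[OF assms] by blast
  have "{\<sigma> {i} ` L |L. L \<in> \<K> \<and> \<sigma> {i} ` L \<noteq> T i} = {\<sigma> {i} ` K v |v. v \<in> V \<and> \<sigma> {i} ` K v \<noteq> T i}"
    by blast
  also have "\<dots> = proper_projections i Y"
    unfolding proper_projections_def using sigma_K[OF _ Y] by (intro Collect_cong) metis
  finally show ?thesis using card_proper_projections[OF Y] by simp
qed

section \<open>Full strips of the system and the graph\<close>

abbreviation "XS \<equiv> nontrivial_full_strips_in S M T k \<K>"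

lemma E2_strip:
  assumes "edge v Y \<in> E2"
  shows "KvY v Y \<in> XS" "sp (KvY v Y) = sp Y"
proof -
  have vY: "v \<in> V" "Y \<in> YS" using assms edge_orbit_in[OF edge_orbit_E2] by auto
  then have *: "full_strip S M T k (KvY v Y)" "sp (KvY v Y) = sp Y" using strip_E2_iff assms by auto
  show "sp (KvY v Y) = sp Y" by (rule *(2))
  have "involved_in S T k (KvY v Y) (block_prod (KvY v))"
    using *(2) KvY_subgroup[OF vY(1)] vY(2) by (intro block_involved) auto
  then have "involved_in S T k (KvY v Y) (K v)" using K_eq[OF vY(1)] by simp
  then show "KvY v Y \<in> XS"
    unfolding nontrivial_full_strips_in_def using * YS(3)[OF vY(2)] vY(1) by auto
qed

text \<open>The strip has length at least two and blocks have size two, so it fills a block and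
  equals the component there; \<open>strip_E2_iff\<close> then supplies the edge.\<close>

lemma involved_strip:
  assumes Z: "full_strip S M T k Z" "card (sp Z) \<ge> 2" "v \<in> V" "involved_in S T k Z (K v)"
  obtains Y where "Y \<in> YS" "edge v Y \<in> E2" "Z = KvY v Y"
proof -
  have "sp Z \<noteq> {}" using Z(2) by auto
  then obtain i where i: "i \<in> sp Z" by blast
  then obtain Y where Y: "Y \<in> YS" "i \<in> sp Y" using block_of supp_sub by blast
  have st: "strip S M T k Z" using Z(1) unfolding full_strip_def by simp
  note * = strip_involved_block_eq[of "KvY v" Z Y i, OF fin(1) KvY_subgroup[OF Z(3)] st _ _ i Y(2,1)]
  have "sp Z = sp Y" "KvY v Y = Z"
    using * Z(2,4) K_eq[OF Z(3)] YS(3)[OF Y(1)] by auto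
  then show ?thesis using that[OF Y(1)] strip_E2_iff[OF Z(3) Y(1)] Z(1) by simp
qed

lemma XS_eq: "XS = {KvY v Y |v Y. edge v Y \<in> E2}"
proof
  show "XS \<subseteq> {KvY v Y |v Y. edge v Y \<in> E2}"
  proof
    fix Z assume "Z \<in> XS"
    then obtain v where "full_strip S M T k Z" "card (sp Z) \<ge> 2" "v \<in> V" "involved_in S T k Z (K v)"
      unfolding nontrivial_full_strips_in_def by auto
    then obtain Y where "edge v Y \<in> E2" "Z = KvY v Y" by (rule involved_strip)
    then show "Z \<in> {KvY v Y |v Y. edge v Y \<in> E2}" by blast
  qed
  show "{KvY v Y |v Y. edge v Y \<in> E2} \<subseteq> XS" using E2_strip(1) by blast
qed

lemma supp_inj: "Y \<in> YS \<Longrightarrow> Z \<in> YS \<Longrightarrow> sp Y = sp Z \<Longrightarrow> Y = Z"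
proof (rule ccontr)
  assume *: "Y \<in> YS" "Z \<in> YS" "sp Y = sp Z" "Y \<noteq> Z"
  then have "sp Y = {}" using block_disj[of Y Z] by simp
  then show False using YS(3)[OF *(1)] by simp
qed

lemma E2_vertex: "Y \<in> YS \<Longrightarrow> \<exists>w\<in>V. edge w Y \<in> E2"
proof -
  assume "Y \<in> YS"
  then obtain g where g: "g \<in> H" "Y = cj g Y1" using YS_from_base by blast
  then show ?thesis using edge_orbit_closed[OF edge_orbit_E2 base(6) g(1)] alpha_V base(3) by blast
qed

text \<open>The identification of strips of \<open>D\<close> with full strips of the system;
  \<open>XS_ex1\<close> justifies the description, and \<open>xs_eq\<close> evaluates it as the
  component at the \<open>E2\<close>-neighbour of \<open>Y\<close>.\<close>

definition xs :: "'a set \<Rightarrow> 'a set" where "xs Y = (THE Z. Z \<in> XS \<and> sp Z = sp Y)"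

lemma XS_unique:
  assumes "edge w Y \<in> E2" "Z \<in> XS" "sp Z = sp Y"
  shows "Z = KvY w Y"
proof -
  obtain v X where v: "edge v X \<in> E2" "Z = KvY v X" using assms(2) XS_eq by blast
  have "X = Y" using E2_strip(2)[OF v(1)] v assms edge_orbit_in[OF edge_orbit_E2] supp_inj by metis
  then show ?thesis using v assms E2_unique by blast
qed

lemma XS_ex1: "Y \<in> YS \<Longrightarrow> \<exists>!Z. Z \<in> XS \<and> sp Z = sp Y"
proof -
  assume "Y \<in> YS"
  then obtain w where w: "edge w Y \<in> E2" using E2_vertex by blast
  show ?thesis
  proof (rule ex1I)
    show "KvY w Y \<in> XS \<and> sp (KvY w Y) = sp Y" using E2_strip[OF w] by simp
    show "Z = KvY w Y" if "Z \<in> XS \<and> sp Z = sp Y" for Z using XS_unique[OF w] that by simp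
  qed
qed

lemma xs_eq: "edge w Y \<in> E2 \<Longrightarrow> xs Y = KvY w Y"
  unfolding xs_def using E2_strip XS_unique by (intro the_equality conjI) simp_all

lemma xs_in: "Y \<in> YS \<Longrightarrow> xs Y \<in> XS" and xs_supp: "Y \<in> YS \<Longrightarrow> sp (xs Y) = sp Y"
  unfolding xs_def using theI'[OF XS_ex1] by simp_all

lemma XS_image: "XS = xs ` YS"
proof
  show "XS \<subseteq> xs ` YS"
  proof
    fix Z assume "Z \<in> XS"
    then obtain v Y where "edge v Y \<in> E2" "Z = KvY v Y" unfolding XS_eq by blast
    moreover from this have "Y \<in> YS" "Z = xs Y" using edge_orbit_in[OF edge_orbit_E2] xs_eq by metis+
    ultimately show "Z \<in> xs ` YS" by blast
  qed
qed (use xs_in in auto)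

lemma YS_sub_K: "v \<in> V \<Longrightarrow> Y \<in> YS \<Longrightarrow> Y \<subseteq> K v"
  using K_Inter D(1) generate.incl[of _ "\<Union>Y\<in>YS. Y" S] by blast

text \<open>Keeps the two sides of the bipartition apart in the target graph. Over a block joined to
  \<open>v\<close> in \<open>E1\<close>, some projection of \<open>K v\<close> is proper, but it is
  not trivial either, because \<open>K v\<close> contains the strip \<open>Y\<close>.\<close>

lemma K_not_strip: "v \<in> V \<Longrightarrow> \<not> full_strip S M T k (K v)"
proof
  assume v: "v \<in> V" "full_strip S M T k (K v)"
  obtain Y where Y: "Y \<in> YS" "edge v Y \<in> E1" using vertex_E1[OF v(1)] by blast
  then obtain i where i: "i \<in> sp Y" "\<sigma> {i} ` KvY v Y \<noteq> T i" using E1_iff_projection v by blast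
  then have "\<sigma> {i} ` K v \<noteq> T i" using sigma_K[OF v(1) Y(1) i(1)] by simp
  then have "i \<notin> sp (K v)" using v(2) unfolding full_strip_def by blast
  moreover obtain y where "y \<in> Y" "\<sigma> {i} y \<noteq> \<one>" using i(1) supp_iff YS Y by auto
  then have "i \<in> sp (K v)"
    using supp_iff[OF K_subgroup K_sub_M] v(1) YS_sub_K[OF v(1) Y(1)] i(1) supp_sub[of Y] by blast
  ultimately show False by simp
qed

lemma T_ne_proper: "i \<in> {1..k} \<Longrightarrow> v \<in> V \<Longrightarrow> \<sigma> {i} ` K v \<subset> T i \<longleftrightarrow> \<sigma> {i} ` K v \<noteq> T i"
  using sigma_T K_sub_M by (auto simp: psubset_eq)

text \<open>The support of \<open>xs Y\<close> is the two-element support of \<open>Y\<close>, so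
  its minimum and maximum exhaust the coordinates tested in
  \<open>E1_iff_projection\<close>.\<close>

lemma graph_E1:
  assumes "v \<in> V" "Y \<in> YS"
  shows "edge v Y \<in> E1 \<longleftrightarrow> \<sigma> {Min (sp (xs Y))} ` K v \<subset> T_min S T k (xs Y) \<or>
    \<sigma> {Max (sp (xs Y))} ` K v \<subset> T_max S T k (xs Y)"
proof -
  note c2 = card2_min_max[OF YS(3)[OF assms(2)]]
  have in_sp: "Min (sp Y) \<in> sp Y" "Max (sp Y) \<in> sp Y" using c2(1) by (metis insertCI)+
  then have "Min (sp Y) \<in> {1..k}" "Max (sp Y) \<in> {1..k}" using supp_sub by blast+
  then show ?thesis
    using xs_supp[OF assms(2)] E1_iff_projection[OF assms] T_ne_proper assms(1) sigma_K[OF assms] in_sp c2(1)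
    by (metis insertE singletonD)
qed

lemma graph_E2:
  assumes "v \<in> V" "Y \<in> YS"
  shows "edge v Y \<in> E2 \<longleftrightarrow> involved_in S T k (xs Y) (K v)"
proof
  assume "edge v Y \<in> E2"
  then have "xs Y = KvY v Y" "sp (KvY v Y) = sp Y" using xs_eq E2_strip by auto
  then show "involved_in S T k (xs Y) (K v)"
    using block_involved[OF KvY_subgroup[OF assms(1)] assms(2)] K_eq[OF assms(1)] by simp
next
  assume inv: "involved_in S T k (xs Y) (K v)"
  have "full_strip S M T k (xs Y)" "card (sp (xs Y)) \<ge> 2"
    using xs_in[OF assms(2)] unfolding nontrivial_full_strips_in_def by auto
  from involved_strip[OF this assms(1) inv]
  obtain X where X: "X \<in> YS" "edge v X \<in> E2" "xs Y = KvY v X" .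
  then have "sp X = sp Y" using E2_strip(2)[OF X(2)] xs_supp[OF assms(2)] by simp
  then show "edge v Y \<in> E2" using supp_inj X assms(2) by metis
qed

lemma graph_iso:
  "graph2_iso (case_sum K xs) (Inl ` V \<union> Inr ` YS, E1, E2)
    (\<K> \<union> XS,
     {{L, X} |L X. L \<in> \<K> \<and> X \<in> XS \<and>
        (\<sigma> {Min (sp X)} ` L \<subset> T_min S T k X \<or> \<sigma> {Max (sp X)} ` L \<subset> T_max S T k X)},
     {{L, X} |L X. L \<in> \<K> \<and> X \<in> XS \<and> involved_in S T k X L})"
proof -
  let ?f = "case_sum K xs"
  have edge_image: "?f ` edge v Y = {K v, xs Y}" for v Y unfolding edge_def by simp
  have E: "\<exists>v\<in>V. \<exists>Y\<in>YS. e = edge v Y" if E: "edge_orbit E" and e: "e \<in> E" for E e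
  proof -
    obtain w Z where "E = {edge (\<alpha> g w) (cj g Z) |g. g \<in> H}"
      using E unfolding edge_orbit_def by blast
    then obtain v Y where "e = edge v Y" using e by blast
    then show ?thesis using e edge_orbit_in[OF E] by blast
  qed
  \<comment> \<open>One argument for both edge sets: \<open>R\<close> is the condition on a subgroup
    and a strip that defines the edges of the target graph.\<close>
  have image_E: "image ?f ` E = {{L, X} |L X. L \<in> \<K> \<and> X \<in> XS \<and> R L X}"
    if E': "edge_orbit E" and R: "\<And>v Y. v \<in> V \<Longrightarrow> Y \<in> YS \<Longrightarrow> edge v Y \<in> E \<longleftrightarrow> R (K v) (xs Y)" for E R
  proof
    show "image ?f ` E \<subseteq> {{L, X} |L X. L \<in> \<K> \<and> X \<in> XS \<and> R L X}"
    proof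
      fix e assume "e \<in> image ?f ` E"
      then obtain e' where e': "e' \<in> E" "e = ?f ` e'" by blast
      then obtain v Y where vY: "v \<in> V" "Y \<in> YS" "edge v Y \<in> E" "e = ?f ` edge v Y" using E[OF E'] by metis
      then have "e = {K v, xs Y}" "R (K v) (xs Y)" using edge_image R by auto
      moreover have "K v \<in> \<K>" "xs Y \<in> XS" using vY xs_in by simp_all
      ultimately show "e \<in> {{L, X} |L X. L \<in> \<K> \<and> X \<in> XS \<and> R L X}"
        by (intro CollectI exI[of _ "K v"] exI[of _ "xs Y"] conjI)
    qed
    show "{{L, X} |L X. L \<in> \<K> \<and> X \<in> XS \<and> R L X} \<subseteq> image ?f ` E"
    proof
      fix e assume "e \<in> {{L, X} |L X. L \<in> \<K> \<and> X \<in> XS \<and> R L X}"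
      then obtain L X where LX: "e = {L, X}" "L \<in> \<K>" "X \<in> XS" "R L X" by (elim CollectE exE conjE)
      obtain v where v: "v \<in> V" "L = K v" using LX(2) by (rule imageE) simp
      obtain Y where Y: "Y \<in> YS" "X = xs Y" using LX(3) unfolding XS_image by (rule imageE) simp
      have "edge v Y \<in> E" "e = ?f ` edge v Y" using R v Y LX edge_image by simp_all
      then show "e \<in> image ?f ` E" by (metis image_eqI)
    qed
  qed
  have xs_inj: "inj_on xs YS" by (rule inj_onI) (use supp_inj xs_supp in metis)
  \<comment> \<open>The target vertex set is an ordinary union, so injectivity also requires that no
    member of the system is itself one of the strips.\<close>
  have neq: "K v \<noteq> xs Y" if "v \<in> V" "Y \<in> YS" for v Y
    using K_not_strip[OF that(1)] xs_in[OF that(2)] unfolding nontrivial_full_strips_in_def by auto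
  have "inj_on ?f (Inl ` V \<union> Inr ` YS)"
  proof (rule inj_onI)
    fix p q assume pq: "p \<in> Inl ` V \<union> Inr ` YS" "q \<in> Inl ` V \<union> Inr ` YS" "?f p = ?f q"
    show "p = q"
    proof (cases p; cases q)
      fix v w assume "p = Inl v" "q = Inl w"
      then show ?thesis using pq inj_onD[OF K_inj, of v w] by auto
    next
      fix v Y assume "p = Inl v" "q = Inr Y"
      then show ?thesis using pq neq[of v Y] by auto
    next
      fix v Y assume "p = Inr Y" "q = Inl v"
      then show ?thesis using pq neq[of v Y] by auto
    next
      fix Y Z assume "p = Inr Y" "q = Inr Z"
      then show ?thesis using pq inj_onD[OF xs_inj, of Y Z] by auto
    qed
  qed
  moreover have "?f ` (Inl ` V \<union> Inr ` YS) = \<K> \<union> XS"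
    unfolding XS_image image_Un image_image by simp
  ultimately have "bij_betw ?f (Inl ` V \<union> Inr ` YS) (\<K> \<union> XS)" unfolding bij_betw_def by simp
  moreover have "image ?f ` E1 = {{L, X} |L X. L \<in> \<K> \<and> X \<in> XS \<and>
        (\<sigma> {Min (sp X)} ` L \<subset> T_min S T k X \<or> \<sigma> {Max (sp X)} ` L \<subset> T_max S T k X)}"
    by (rule image_E[OF edge_orbit_E1 graph_E1])
  moreover have "image ?f ` E2 = {{L, X} |L X. L \<in> \<K> \<and> X \<in> XS \<and> involved_in S T k X L}"
    by (rule image_E[OF edge_orbit_E2 graph_E2])
  ultimately show ?thesis unfolding graph2_iso_def by simp
qed

lemma XS_nonempty: "XS \<noteq> {}" using E2_strip(1)[OF base(6)] by blast

lemma KvY_edges: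
  assumes "g \<in> H" "v \<in> V" "Y \<in> YS"
  shows "edge_action S \<alpha> g (edge v1 Y1) = edge v Y \<Longrightarrow> KvY v Y = cj g L1"
    "edge_action S \<alpha> g (edge v2 Y1) = edge v Y \<Longrightarrow> KvY v Y = cj g X1"
  using KvY_E1[of v Y g] KvY_E2[of v Y g] assms(1)
    edge_orbit_closed[OF edge_orbit_E1 base(5) assms(1)] edge_orbit_closed[OF edge_orbit_E2 base(6) assms(1)]
  by (auto simp: edge_action_edge)

end

section \<open>From Cartesian systems to Cartesian decompositions\<close>

lemma Sym_group: "group (Sym \<Omega>)" by (rule group_BijGroup)

lemma Sym_carrier: "carrier (Sym \<Omega>) = Bij \<Omega>" by (simp add: BijGroup_def)

lemma Sym_apply:
  "g \<in> carrier (Sym \<Omega>) \<Longrightarrow> h \<in> carrier (Sym \<Omega>) \<Longrightarrow> x \<in> \<Omega> \<Longrightarrow> (g \<otimes>\<^bsub>Sym \<Omega>\<^esub> h) x = g (h x)"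
  by (simp add: BijGroup_def compose_eq)

lemma Sym_one_apply: "x \<in> \<Omega> \<Longrightarrow> \<one>\<^bsub>Sym \<Omega>\<^esub> x = x"
  by (simp add: BijGroup_def)

lemma Sym_in: "g \<in> carrier (Sym \<Omega>) \<Longrightarrow> x \<in> \<Omega> \<Longrightarrow> g x \<in> \<Omega>"
  using Bij_imp_funcset unfolding Sym_carrier by (metis PiE)

lemma Sym_inv_apply:
  assumes "g \<in> carrier (Sym \<Omega>)" "x \<in> \<Omega>"
  shows "(inv\<^bsub>Sym \<Omega>\<^esub> g) (g x) = x" "g ((inv\<^bsub>Sym \<Omega>\<^esub> g) x) = x"
proof -
  interpret group "Sym \<Omega>" by (rule Sym_group)
  show "(inv\<^bsub>Sym \<Omega>\<^esub> g) (g x) = x" using Sym_apply[of "inv\<^bsub>Sym \<Omega>\<^esub> g" \<Omega> g x] assms by (simp add: Sym_one_apply)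
  show "g ((inv\<^bsub>Sym \<Omega>\<^esub> g) x) = x" using Sym_apply[of g \<Omega> "inv\<^bsub>Sym \<Omega>\<^esub> g" x] assms by (simp add: Sym_one_apply)
qed

lemma Sym_image:
  assumes "g \<in> carrier (Sym \<Omega>)" "h \<in> carrier (Sym \<Omega>)" "U \<subseteq> \<Omega>"
  shows "(g \<otimes>\<^bsub>Sym \<Omega>\<^esub> h) ` U = g ` h ` U"
  unfolding image_image using Sym_apply[OF assms(1,2)] assms(3) by (intro image_cong refl) blast

lemma Sym_one_image:
  assumes "U \<subseteq> \<Omega>"
  shows "\<one>\<^bsub>Sym \<Omega>\<^esub> ` U = U"
proof -
  have "\<one>\<^bsub>Sym \<Omega>\<^esub> x = x" if "x \<in> U" for x
    using Sym_one_apply[of x \<Omega>] that assms by auto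
  then have "\<one>\<^bsub>Sym \<Omega>\<^esub> ` U = (\<lambda>x. x) ` U" by (rule image_cong[OF refl])
  then show ?thesis by simp
qed

text \<open>Independent of strips and graphs: any Cartesian system of a transitive group
  \<open>M\<close>. Equality with \<open>Sym \<Omega>\<close> is an assumption, so the group
  notation remains that of \<open>S\<close>.\<close>

locale cartesian_system_action = group S for S (structure) +
  fixes \<Omega> :: "'a set" and M :: "('a \<Rightarrow> 'a) set" and \<omega> :: 'a and \<K> :: "('a \<Rightarrow> 'a) set set"
  assumes S: "S = Sym \<Omega>"
    and M: "subgroup M S" "transitive_on \<Omega> M"
    and omega: "\<omega> \<in> \<Omega>"
    and system: "cartesian_system \<Omega> M \<omega> \<K>"
begin

lemma inv_mult_cancel: "q \<in> carrier S \<Longrightarrow> z \<in> carrier S \<Longrightarrow> inv q \<otimes> (q \<otimes> z) = z"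
  by (simp add: m_assoc[symmetric])

lemma mult_apply: "g \<in> carrier S \<Longrightarrow> h \<in> carrier S \<Longrightarrow> x \<in> \<Omega> \<Longrightarrow> (g \<otimes> h) x = g (h x)"
  using Sym_apply S by metis

lemma apply_in: "g \<in> carrier S \<Longrightarrow> x \<in> \<Omega> \<Longrightarrow> g x \<in> \<Omega>"
  using Sym_in S by metis

lemma inv_apply: "g \<in> carrier S \<Longrightarrow> x \<in> \<Omega> \<Longrightarrow> (inv g) (g x) = x"
    "g \<in> carrier S \<Longrightarrow> x \<in> \<Omega> \<Longrightarrow> g ((inv g) x) = x"
  using Sym_inv_apply S by metis+

lemma mult_image: "g \<in> carrier S \<Longrightarrow> h \<in> carrier S \<Longrightarrow> U \<subseteq> \<Omega> \<Longrightarrow> (g \<otimes> h) ` U = g ` h ` U"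
  using Sym_image S by metis

lemma M_car: "m \<in> M \<Longrightarrow> m \<in> carrier S" using subgroup.mem_carrier[OF M(1)] .

lemma M_mult: "m \<in> M \<Longrightarrow> n \<in> M \<Longrightarrow> m \<otimes> n \<in> M" using subgroup.m_closed[OF M(1)] .
lemma M_inv: "m \<in> M \<Longrightarrow> inv m \<in> M" using subgroup.m_inv_closed[OF M(1)] .
lemma M_one: "\<one> \<in> M" using subgroup.one_closed[OF M(1)] .

lemma K_sub: "L \<in> \<K> \<Longrightarrow> subgroup L S" "L \<in> \<K> \<Longrightarrow> L \<subset> M"
  using system S unfolding cartesian_system_def by auto

lemma K_fin: "finite \<K>" "\<K> \<noteq> {}" using system unfolding cartesian_system_def by auto

lemma K_fact: "L \<in> \<K> \<Longrightarrow> L <#> (M \<inter> \<Inter>(\<K> - {L})) = M"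
  using system S unfolding cartesian_system_def by auto

lemma K_inter: "\<Inter>\<K> = {m \<in> M. m \<omega> = \<omega>}"
  using system unfolding cartesian_system_def point_stab_def stabilizer_def by simp

lemma stab_sub: "L \<in> \<K> \<Longrightarrow> m \<in> M \<Longrightarrow> m \<omega> = \<omega> \<Longrightarrow> m \<in> L"
  using K_inter by blast

definition blk :: "('a \<Rightarrow> 'a) set \<Rightarrow> 'a set" where "blk L = {x \<omega> |x. x \<in> L}"

definition part :: "('a \<Rightarrow> 'a) set \<Rightarrow> 'a set set" where "part L = (\<lambda>m. m ` blk L) ` M"

lemma part_iff: "U \<in> part L \<longleftrightarrow> (\<exists>m\<in>M. U = m ` blk L)"
  by (simp add: part_def image_iff)

lemma decomp_eq: "decomp_of M \<omega> \<K> = part ` \<K>"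
  unfolding decomp_of_def part_def blk_def by auto

lemma blk_sub: "L \<subseteq> carrier S \<Longrightarrow> blk L \<subseteq> \<Omega>"
  using apply_in omega unfolding blk_def by auto

lemma K_car: "L \<in> \<K> \<Longrightarrow> L \<subseteq> carrier S" using K_sub(1) subgroup.subset by metis

lemma reach: "z \<in> \<Omega> \<Longrightarrow> \<exists>m\<in>M. z = m \<omega>"
  using M(2) omega unfolding transitive_on_def by metis

text \<open>Every member of the system contains the point stabiliser, so whether \<open>m\<close>
  lies in \<open>L\<close> depends only on the point \<open>m \<omega>\<close>.\<close>

lemma blk_mem:
  assumes L: "L \<in> \<K>" and m: "m \<in> M"
  shows "m \<omega> \<in> blk L \<longleftrightarrow> m \<in> L"
proof
  assume "m \<omega> \<in> blk L"
  then obtain x where x: "x \<in> L" "m \<omega> = x \<omega>" unfolding blk_def by auto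
  then have xM: "x \<in> M" using K_sub(2)[OF L] by auto
  have "(inv x \<otimes> m) \<omega> = \<omega>"
    using x mult_apply[of "inv x" m \<omega>] inv_apply(1)[of x \<omega>] M_car xM m omega by simp
  then have "inv x \<otimes> m \<in> L" using stab_sub[OF L] M_mult M_inv xM m by simp
  then have "x \<otimes> (inv x \<otimes> m) \<in> L" using x subgroup.m_closed[OF K_sub(1)[OF L]] by simp
  then show "m \<in> L" using M_car xM m by (simp add: m_assoc[symmetric])
qed (auto simp: blk_def)

text \<open>By transitivity every point is some \<open>n \<omega>\<close>, so this turns statements
  about points and blocks into membership in left cosets of \<open>L\<close>.\<close>

lemma coset_mem:
  assumes L: "L \<in> \<K>" and m: "m \<in> M" and n: "n \<in> M"
  shows "n \<omega> \<in> m ` blk L \<longleftrightarrow> inv m \<otimes> n \<in> L"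
proof -
  have "n \<omega> \<in> m ` blk L \<longleftrightarrow> (inv m \<otimes> n) \<omega> \<in> blk L"
  proof
    assume "n \<omega> \<in> m ` blk L"
    then obtain z where z: "z \<in> blk L" "n \<omega> = m z" by auto
    then have "z \<in> \<Omega>" using blk_sub K_car L by blast
    then show "(inv m \<otimes> n) \<omega> \<in> blk L"
      using z mult_apply[of "inv m" n \<omega>] inv_apply(1)[of m z] M_car m n omega by simp
  next
    assume "(inv m \<otimes> n) \<omega> \<in> blk L"
    moreover have "n \<omega> = m ((inv m \<otimes> n) \<omega>)"
      using mult_apply[of "inv m" n \<omega>] inv_apply(2)[of m "n \<omega>"] M_car m n omega apply_in by simp
    ultimately show "n \<omega> \<in> m ` blk L" by (rule image_eqI[rotated])
  qed
  then show ?thesis using blk_mem[OF L] M_mult M_inv m n by simp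
qed

lemma coset_sub: "L \<in> \<K> \<Longrightarrow> m \<in> M \<Longrightarrow> m ` blk L \<subseteq> \<Omega>"
  using blk_sub K_car apply_in M_car by blast

lemma coset_eqI:
  assumes L: "L \<in> \<K>" and m: "m \<in> M" "n \<in> M" and mn: "inv m \<otimes> n \<in> L"
  shows "m ` blk L = n ` blk L"
proof -
  note sL = K_sub(1)[OF L]
  have car: "m \<in> carrier S" "n \<in> carrier S" using m M_car by auto
  have "z \<in> m ` blk L \<longleftrightarrow> z \<in> n ` blk L" if "z \<in> \<Omega>" for z
  proof -
    obtain p where p: "p \<in> M" "z = p \<omega>" using reach \<open>z \<in> \<Omega>\<close> by blast
    have pc: "p \<in> carrier S" using p M_car by auto
    have e1: "inv m \<otimes> p = (inv m \<otimes> n) \<otimes> (inv n \<otimes> p)"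
    proof -
      have "(inv m \<otimes> n) \<otimes> (inv n \<otimes> p) = inv m \<otimes> ((n \<otimes> inv n) \<otimes> p)"
        using car pc by (simp only: m_assoc inv_closed m_closed)
      then show ?thesis using car pc by simp
    qed
    have e2: "inv n \<otimes> p = inv (inv m \<otimes> n) \<otimes> (inv m \<otimes> p)"
      unfolding e1 by (rule inv_mult_cancel[symmetric]) (use car pc in auto)
    have "inv m \<otimes> p \<in> L \<longleftrightarrow> inv n \<otimes> p \<in> L"
      using e1 e2 mn subgroup.m_closed[OF sL] subgroup.m_inv_closed[OF sL] by metis
    then show ?thesis using coset_mem[OF L] m p by simp
  qed
  then show ?thesis using coset_sub[OF L] m by blast
qed

lemma coset_self: "L \<in> \<K> \<Longrightarrow> m \<in> M \<Longrightarrow> m \<omega> \<in> m ` blk L"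
  using coset_mem[of L m m] M_car subgroup.one_closed[OF K_sub(1)] by simp

lemma part_partition:
  assumes L: "L \<in> \<K>"
  shows "partition_on \<Omega> (part L)" "part L \<noteq> {\<Omega>}"
proof -
  show "partition_on \<Omega> (part L)"
  proof (rule partition_onI)
    show "\<Union>(part L) = \<Omega>"
    proof
      show "\<Union>(part L) \<subseteq> \<Omega>" using coset_sub[OF L] unfolding part_def by blast
      show "\<Omega> \<subseteq> \<Union>(part L)"
      proof
        fix z assume "z \<in> \<Omega>"
        then obtain m where "m \<in> M" "z = m \<omega>" using reach by blast
        then show "z \<in> \<Union>(part L)" using coset_self[OF L] unfolding part_def by blast
      qed
    qed
  next
    fix p q assume pq: "p \<in> part L" "q \<in> part L" "p \<noteq> q"
    then obtain m n where mn: "m \<in> M" "n \<in> M" "p = m ` blk L" "q = n ` blk L" unfolding part_def by blast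
    have "z \<notin> q" if "z \<in> p" for z
    proof
      assume "z \<in> q"
      have "z \<in> \<Omega>" using that mn coset_sub[OF L] by blast
      then obtain r where r: "r \<in> M" "z = r \<omega>" using reach by blast
      then have "inv m \<otimes> r \<in> L" "inv n \<otimes> r \<in> L" using coset_mem[OF L] mn that \<open>z \<in> q\<close> by auto
      then have "m ` blk L = r ` blk L" "n ` blk L = r ` blk L" using coset_eqI[OF L] mn r by auto
      then show False using pq mn by simp
    qed
    then show "disjnt p q" unfolding disjnt_def by blast
  next
    show "{} \<notin> part L" using coset_self[OF L] unfolding part_def by blast
  qed
  show "part L \<noteq> {\<Omega>}"
  proof
    assume "part L = {\<Omega>}"
    moreover have "\<one> ` blk L \<in> part L" using M_one unfolding part_def by blast
    ultimately have *: "\<one> ` blk L = \<Omega>" by simp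
    have "m \<in> L" if m: "m \<in> M" for m
    proof -
      have "m \<omega> \<in> \<one> ` blk L" using * apply_in[OF M_car[OF m] omega] by simp
      then show ?thesis using coset_mem[OF L M_one m] M_car[OF m] by simp
    qed
    then show False using K_sub(2)[OF L] by blast
  qed
qed

lemma common_coset:
  assumes f: "\<And>L. L \<in> \<K> \<Longrightarrow> f L \<in> M"
  shows "\<exists>m\<in>M. \<forall>L\<in>\<K>. inv (f L) \<otimes> m \<in> L"
proof -
  have "\<exists>m\<in>M. \<forall>L\<in>J. inv (f L) \<otimes> m \<in> L" if "finite J" "J \<subseteq> \<K>" for J
    using that
  proof (induction J)
    case empty
    then show ?case using M_one by auto
  next
    case (insert L J)
    then obtain m where m: "m \<in> M" "\<And>N. N \<in> J \<Longrightarrow> inv (f N) \<otimes> m \<in> N" by auto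
    have L: "L \<in> \<K>" using insert by simp
    \<comment> \<open>Write this element as \<open>l \<otimes> p\<close> with \<open>p\<close> in
      all other members and replace \<open>m\<close> by \<open>m \<otimes> inv p\<close>: the cosets
      of members of \<open>J\<close> already reached are not left, and modulo \<open>L\<close> only
      \<open>l\<close> remains.\<close>
    have "inv (f L) \<otimes> m \<in> L <#> (M \<inter> \<Inter>(\<K> - {L}))"
      unfolding K_fact[OF L] using M_mult M_inv f L m by simp
    then obtain l p where lp: "l \<in> L" "p \<in> M" "p \<in> \<Inter>(\<K> - {L})" "inv (f L) \<otimes> m = l \<otimes> p"
      unfolding set_mult_def by blast
    have car: "l \<in> carrier S" "p \<in> carrier S" "m \<in> carrier S"
      using lp(1) K_car[OF L] M_car[OF lp(2)] M_car[OF m(1)] by auto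
    have fc: "f N \<in> carrier S" if "N \<in> \<K>" for N using M_car f that by simp
    have "inv (f N) \<otimes> (m \<otimes> inv p) \<in> N" if N: "N \<in> insert L J" for N
    proof -
      have NK: "N \<in> \<K>" using N insert.prems by auto
      have eq: "inv (f N) \<otimes> (m \<otimes> inv p) = (inv (f N) \<otimes> m) \<otimes> inv p"
        using car fc[OF NK] by (simp add: m_assoc)
      show ?thesis
      proof (cases "N = L")
        case True
        have "(inv (f L) \<otimes> m) \<otimes> inv p = l" unfolding lp(4) using car by (simp add: m_assoc)
        then show ?thesis using eq lp(1) True by simp
      next
        case False
        then have "p \<in> N" "N \<in> J" using lp(3) NK N by auto
        then show ?thesis
          unfolding eq using m(2) subgroup.m_closed[OF K_sub(1)[OF NK]] subgroup.m_inv_closed[OF K_sub(1)[OF NK]]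
          by simp
      qed
    qed
    then show ?case using M_mult[OF m(1) M_inv[OF lp(2)]] by blast
  qed
  then show ?thesis using K_fin(1) by blast
qed

text \<open>By \<open>common_coset\<close> any choice of blocks consists of translates by one and
  the same \<open>m\<close>. A point \<open>n \<omega>\<close> in all of them has
  \<open>inv m \<otimes> n\<close> in the point stabiliser, so it is
  \<open>m \<omega>\<close>.\<close>

lemma decomposition: "cartesian_decomposition \<Omega> (part ` \<K>)"
proof -
  have "card (\<Inter>\<Gamma>\<in>part ` \<K>. \<gamma> \<Gamma>) = 1" if g: "\<forall>\<Gamma>\<in>part ` \<K>. \<gamma> \<Gamma> \<in> \<Gamma>" for \<gamma>
  proof -
    have "\<forall>L\<in>\<K>. \<exists>m. m \<in> M \<and> \<gamma> (part L) = m ` blk L"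
    proof
      fix L assume "L \<in> \<K>"
      then have "\<gamma> (part L) \<in> part L" using g by simp
      then show "\<exists>m. m \<in> M \<and> \<gamma> (part L) = m ` blk L" unfolding part_iff[of _ L] by blast
    qed
    from bchoice[OF this] obtain f where f: "\<And>L. L \<in> \<K> \<Longrightarrow> f L \<in> M" "\<And>L. L \<in> \<K> \<Longrightarrow> \<gamma> (part L) = f L ` blk L"
      by auto
    obtain m where m: "m \<in> M" "\<And>L. L \<in> \<K> \<Longrightarrow> inv (f L) \<otimes> m \<in> L" using common_coset[of f] f(1) by blast
    have eq: "\<gamma> (part L) = m ` blk L" if "L \<in> \<K>" for L
      using f coset_eqI[OF that f(1)[OF that] m(1) m(2)[OF that]] that by simp
    have "z \<in> (\<Inter>\<Gamma>\<in>part ` \<K>. \<gamma> \<Gamma>) \<longleftrightarrow> z = m \<omega>" for z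
    proof
      assume "z \<in> (\<Inter>\<Gamma>\<in>part ` \<K>. \<gamma> \<Gamma>)"
      then have z: "z \<in> m ` blk L" if "L \<in> \<K>" for L using eq that by auto
      obtain L0 where "L0 \<in> \<K>" using K_fin(2) by auto
      then have "z \<in> \<Omega>" using z coset_sub m(1) by blast
      then obtain n where n: "n \<in> M" "z = n \<omega>" using reach by blast
      then have "inv m \<otimes> n \<in> \<Inter>\<K>" using z coset_mem m(1) by blast
      then have "(inv m \<otimes> n) \<omega> = \<omega>" using K_inter by simp
      then have "(inv m) (n \<omega>) = \<omega>" using mult_apply[of "inv m" n \<omega>] M_car m n omega by simp
      then show "z = m \<omega>" using inv_apply(2)[of m "n \<omega>"] M_car m n omega apply_in by simp
    next
      assume "z = m \<omega>"
      then show "z \<in> (\<Inter>\<Gamma>\<in>part ` \<K>. \<gamma> \<Gamma>)" using eq coset_self m(1) by simp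
    qed
    then have "(\<Inter>\<Gamma>\<in>part ` \<K>. \<gamma> \<Gamma>) = {m \<omega>}" by blast
    then show ?thesis by simp
  qed
  then show ?thesis unfolding cartesian_decomposition_def using K_fin part_partition by auto
qed

text \<open>An element preserving the block sends \<open>\<omega>\<close> into it and so lies in
  \<open>L\<close> by \<open>blk_mem\<close>.\<close>

lemma set_stab_blk:
  assumes L: "L \<in> \<K>"
  shows "set_stab \<Omega> M (blk L) = L"
proof -
  have one: "\<one> ` blk L = blk L" using blk_sub[OF K_car[OF L]] S Sym_one_image by metis
  have "m ` blk L = blk L \<longleftrightarrow> m \<in> L" if m: "m \<in> M" for m
  proof
    assume "m ` blk L = blk L"
    then show "m \<in> L" using coset_self[OF L m] blk_mem[OF L m] by simp
  next
    assume "m \<in> L"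
    then have "inv \<one> \<otimes> m \<in> L" using M_car[OF m] by simp
    then show "m ` blk L = blk L" using coset_eqI[OF L M_one m] one by simp
  qed
  then show ?thesis using K_sub(2)[OF L] unfolding set_stab_def stabilizer_def by auto
qed

lemma blk_in_part: "L \<in> \<K> \<Longrightarrow> blk L \<in> part L" "L \<in> \<K> \<Longrightarrow> \<omega> \<in> blk L"
proof -
  assume L: "L \<in> \<K>"
  have "\<one> ` blk L = blk L" using blk_sub[OF K_car[OF L]] S Sym_one_image by metis
  then show "blk L \<in> part L" using M_one unfolding part_def by force
  have "\<one> \<omega> = \<omega>" using Sym_one_apply[OF omega] S by simp
  then show "\<omega> \<in> blk L" using blk_mem[OF L M_one] subgroup.one_closed[OF K_sub(1)[OF L]] by simp
qed

text \<open>\<open>CD_1S\<close> and \<open>decomp_graph\<close> refer to the system recovered from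
  a decomposition; this allows them to be evaluated on \<open>\<K>\<close> itself.\<close>

lemma system_of_decomp: "system_of \<Omega> M \<omega> (decomp_of M \<omega> \<K>) = \<K>"
proof -
  have uniq: "\<gamma> = blk L" if "L \<in> \<K>" "\<gamma> \<in> part L" "\<omega> \<in> \<gamma>" for L \<gamma>
    using part_partition(1)[OF that(1)] blk_in_part[OF that(1)] that(2,3)
    unfolding partition_on_def disjoint_def by blast
  show ?thesis
  proof
    show "system_of \<Omega> M \<omega> (decomp_of M \<omega> \<K>) \<subseteq> \<K>"
    proof
      fix N assume "N \<in> system_of \<Omega> M \<omega> (decomp_of M \<omega> \<K>)"
      then obtain L \<gamma> where "L \<in> \<K>" "\<gamma> \<in> part L" "\<omega> \<in> \<gamma>" "N = set_stab \<Omega> M \<gamma>"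
        unfolding system_of_def decomp_eq by blast
      then show "N \<in> \<K>" using uniq[of L \<gamma>] set_stab_blk[of L] by simp
    qed
    show "\<K> \<subseteq> system_of \<Omega> M \<omega> (decomp_of M \<omega> \<K>)"
    proof
      fix L assume L: "L \<in> \<K>"
      show "L \<in> system_of \<Omega> M \<omega> (decomp_of M \<omega> \<K>)"
        unfolding system_of_def decomp_eq
        using set_stab_blk[OF L] blk_in_part[OF L] L by (intro CollectI exI[of _ "blk L"] exI[of _ "part L"]) simp
    qed
  qed
qed

lemma image_part_M:
  assumes L: "L \<in> \<K>" and m: "m \<in> M"
  shows "image (image m) (part L) = part L"
proof -
  have sub: "image (image n) (part L) \<subseteq> part L" if n: "n \<in> M" for n
  proof
    fix U assume "U \<in> image (image n) (part L)"
    then obtain p where p: "p \<in> M" "U = n ` p ` blk L" unfolding part_def by blast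
    then have "U = (n \<otimes> p) ` blk L" using mult_image[of n p] M_car n blk_sub[OF K_car[OF L]] by simp
    then show "U \<in> part L" using M_mult[OF n p(1)] unfolding part_def by blast
  qed
  have "part L \<subseteq> image (image m) (part L)"
  proof
    fix U assume U: "U \<in> part L"
    then have "U \<subseteq> \<Omega>" using coset_sub[OF L] unfolding part_def by blast
    then have "U = m ` (inv m) ` U"
      using inv_apply(2)[OF M_car[OF m]] unfolding image_image by (simp add: subset_iff cong: image_cong)
    moreover have "(inv m) ` U \<in> part L" using sub[OF M_inv[OF m]] U by blast
    ultimately show "U \<in> image (image m) (part L)" by (rule image_eqI)
  qed
  then show ?thesis using sub[OF m] by blast
qed

lemma blk_conj:
  assumes L: "L \<subseteq> carrier S" and h: "h \<in> carrier S" "h \<omega> = \<omega>"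
  shows "blk (conj_by S h L) = h ` blk L"
proof -
  have ih: "(inv h) \<omega> = \<omega>" using inv_apply(1)[OF h(1) omega] h(2) by simp
  have "(h \<otimes> x \<otimes> inv h) \<omega> = h (x \<omega>)" if "x \<in> L" for x
  proof -
    have x: "x \<in> carrier S" using that L by auto
    then show ?thesis
      using mult_apply[of "h \<otimes> x" "inv h" \<omega>] mult_apply[of h x \<omega>] h omega ih by simp
  qed
  then show ?thesis unfolding blk_def conj_by_image by (auto simp: image_iff) (metis+)
qed

text \<open>As \<open>h\<close> fixes \<open>\<omega>\<close>, it maps the orbit of
  \<open>\<omega>\<close> under \<open>L\<close> to the orbit under the conjugate of
  \<open>L\<close>; as it normalises \<open>M\<close>, translates go to translates.\<close>

lemma image_part_conj:
  assumes L: "L \<in> \<K>" and h: "h \<in> carrier S" "h \<omega> = \<omega>" and hM: "conj_by S h M = M"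
  shows "image (image h) (part L) = part (conj_by S h L)"
proof -
  have Lc: "L \<subseteq> carrier S" using K_car[OF L] .
  have "h ` m ` blk L = (h \<otimes> m \<otimes> inv h) ` blk (conj_by S h L)" if m: "m \<in> M" for m
  proof -
    have mc: "m \<in> carrier S" using M_car m by simp
    have "(h \<otimes> m \<otimes> inv h) ` h ` blk L = (h \<otimes> m \<otimes> inv h \<otimes> h) ` blk L"
      using mult_image[of "h \<otimes> m \<otimes> inv h" h "blk L"] mc h blk_sub[OF Lc] by simp
    also have "h \<otimes> m \<otimes> inv h \<otimes> h = h \<otimes> m" using mc h by (simp add: m_assoc)
    also have "(h \<otimes> m) ` blk L = h ` m ` blk L" using mult_image mc h blk_sub[OF Lc] by simp
    finally show ?thesis using blk_conj[OF Lc h] by simp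
  qed
  then have "(\<lambda>m. h ` m ` blk L) ` M = (\<lambda>m. (h \<otimes> m \<otimes> inv h) ` blk (conj_by S h L)) ` M"
    by (rule image_cong[OF refl])
  moreover have "image (image h) (part L) = (\<lambda>m. h ` m ` blk L) ` M"
    unfolding part_def by (rule image_image)
  ultimately have "image (image h) (part L) = (\<lambda>m. (h \<otimes> m \<otimes> inv h) ` blk (conj_by S h L)) ` M" by simp
  also have "\<dots> = (\<lambda>n. n ` blk (conj_by S h L)) ` conj_by S h M"
    unfolding conj_by_image image_image ..
  finally show ?thesis unfolding hM part_def .
qed

text \<open>Elements of \<open>M\<close> fix every partition, and elements fixing
  \<open>\<omega>\<close> act on partitions as they do on the members of the system by conjugation.
  Transitivity of \<open>M\<close> makes every element of \<open>G\<close> a product of these two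
  kinds.\<close>

lemma decomp_CD_tr:
  assumes G: "subgroup G S" "M \<subseteq> G" "\<And>g. g \<in> G \<Longrightarrow> conj_by S g M = M"
    and inv: "\<And>h. h \<in> G \<Longrightarrow> h \<omega> = \<omega> \<Longrightarrow> conj_by S h ` \<K> = \<K>"
    and tr: "\<And>L N. L \<in> \<K> \<Longrightarrow> N \<in> \<K> \<Longrightarrow> \<exists>h\<in>G. h \<omega> = \<omega> \<and> conj_by S h L = N"
  shows "decomp_of M \<omega> \<K> \<in> CD_tr \<Omega> G"
proof -
  have part_sub: "U \<subseteq> \<Omega>" if "L \<in> \<K>" "U \<in> part L" for L U
    using that coset_sub unfolding part_def by blast
  have inv_E: "image (image (image g)) (part ` \<K>) = part ` \<K>" if g: "g \<in> G" for g
  proof -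
    have gc: "g \<in> carrier S" using subgroup.mem_carrier[OF G(1) g] .
    obtain m where m: "m \<in> M" "g \<omega> = m \<omega>" using reach apply_in[OF gc omega] by metis
    \<comment> \<open>\<open>m\<close> is chosen to agree with \<open>g\<close> at
      \<open>\<omega>\<close>, so \<open>h\<close> fixes \<open>\<omega>\<close>.\<close>
    define h where "h = inv m \<otimes> g"
    have mc: "m \<in> carrier S" using M_car m by simp
    have h: "h \<in> G" "h \<in> carrier S" "h \<omega> = \<omega>" "g = m \<otimes> h"
      unfolding h_def
      using subgroup.m_closed[OF G(1)] subgroup.m_inv_closed[OF G(1)] G(2) m g gc mc
        mult_apply[of "inv m" g \<omega>] inv_apply(1)[of m \<omega>] omega
      by (auto simp: m_assoc[symmetric])
    have "image (image g) (part L) = part (conj_by S h L)" if L: "L \<in> \<K>" for L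
    proof -
      have L': "conj_by S h L \<in> \<K>" using inv[OF h(1,3)] L by blast
      have "image (image g) (part L) = (\<lambda>U. m ` h ` U) ` part L"
        unfolding h(4) by (rule image_cong[OF refl], rule mult_image[OF mc h(2) part_sub[OF L]])
      also have "\<dots> = image (image m) (image (image h) (part L))" by (simp only: image_image)
      finally show ?thesis using image_part_conj[OF L h(2,3) G(3)[OF h(1)]] image_part_M[OF L' m(1)] by simp
    qed
    then have "(\<lambda>L. image (image g) (part L)) ` \<K> = (\<lambda>L. part (conj_by S h L)) ` \<K>"
      by (rule image_cong[OF refl])
    then have "image (image (image g)) (part ` \<K>) = part ` conj_by S h ` \<K>"
      by (simp only: image_image)
    then show ?thesis using inv[OF h(1,3)] by simp
  qed
  have "\<exists>g\<in>G. image (image g) \<Gamma> = \<Delta>" if GD: "\<Gamma> \<in> part ` \<K>" "\<Delta> \<in> part ` \<K>" for \<Gamma> \<Delta>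
  proof -
    obtain L N where LN: "L \<in> \<K>" "N \<in> \<K>" "\<Gamma> = part L" "\<Delta> = part N" using GD by blast
    obtain h where h: "h \<in> G" "h \<omega> = \<omega>" "conj_by S h L = N" using tr LN by blast
    have "image (image h) \<Gamma> = \<Delta>"
      using image_part_conj[OF LN(1) subgroup.mem_carrier[OF G(1) h(1)] h(2) G(3)[OF h(1)]] LN h(3) by simp
    then show ?thesis using h(1) by blast
  qed
  then show ?thesis
    unfolding CD_tr_def decomp_eq using decomposition inv_E by (intro CollectI conjI ballI) simp_all
qed

end

section \<open>The strips of the point stabiliser\<close>

context group begin

lemma conj_by_eqI:
  assumes "subgroup H G" "L \<subseteq> carrier G" "\<And>g. g \<in> H \<Longrightarrow> conj_by G g L \<subseteq> L" "g \<in> H"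
  shows "conj_by G g L = L"
proof
  show "conj_by G g L \<subseteq> L" using assms by simp
  have g: "g \<in> carrier G" using subgroup.mem_carrier[OF assms(1,4)] .
  have "conj_by G g (conj_by G (inv g) L) \<subseteq> conj_by G g L"
    using assms(3)[OF subgroup.m_inv_closed[OF assms(1,4)]] unfolding conj_by_image by (rule image_mono)
  then show "L \<subseteq> conj_by G g L" using conj_by_inv'[OF g assms(2)] by simp
qed

lemma normal_conj_by:
  assumes "subgroup H G" "N \<lhd> G\<lparr>carrier := H\<rparr>" "g \<in> H"
  shows "conj_by G g N = N"
proof (rule conj_by_eqI[OF assms(1) _ _ assms(3)])
  interpret N: normal N "G\<lparr>carrier := H\<rparr>" by fact
  show "N \<subseteq> carrier G" using N.subset subgroup.subset[OF assms(1)] by simp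
  show "conj_by G g N \<subseteq> N" if "g \<in> H" for g
    using N.inv_op_closed2[of g] that m_inv_consistent[OF assms(1) that] unfolding conj_by_image by auto
qed

lemma conj_iso:
  assumes "g \<in> carrier G" "subgroup N G"
  shows "(\<lambda>x. g \<otimes> x \<otimes> inv g) \<in> iso (G\<lparr>carrier := N\<rparr>) (G\<lparr>carrier := conj_by G g N\<rparr>)"
proof -
  note N = subgroup.mem_carrier[OF assms(2)]
  have "inj_on (\<lambda>x. g \<otimes> x \<otimes> inv g) N"
    using conj_inj[OF assms(1)] subgroup.subset[OF assms(2)] by (rule inj_on_subset)
  then show ?thesis
    unfolding iso_def hom_def bij_betw_def using conj_mult[OF assms(1)] N by (auto simp: conj_by_image)
qed

end

context direct_factors begin

text \<open>Conjugation by \<open>g\<close> is an automorphism of \<open>M\<close>, so it preserves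
  the set of simple normal subgroups, which \<open>T\<close> enumerates without repetition.\<close>

lemma conj_permutes_factors:
  assumes T: "bij_betw T {1..k} {N. N \<lhd> S\<lparr>carrier := M\<rparr> \<and> simple_group (S\<lparr>carrier := N\<rparr>)}"
    and g: "g \<in> carrier S" "conj_by S g M = M"
  shows "\<exists>\<pi>. permutes_factors g \<pi>"
proof -
  let ?\<phi> = "\<lambda>x. g \<otimes> x \<otimes> inv g"
  have "\<exists>j. j \<in> {1..k} \<and> conj_by S g (T i) = T j" if i: "i \<in> {1..k}" for i
  proof -
    have Ti: "T i \<lhd> S\<lparr>carrier := M\<rparr>" "simple_group (S\<lparr>carrier := T i\<rparr>)"
      using T i unfolding bij_betw_def by auto
    note gM = subgroup_imp_group[OF M_subgroup]
    have "?\<phi> \<in> iso (S\<lparr>carrier := M\<rparr>) (S\<lparr>carrier := M\<rparr>)" using conj_iso[OF g(1) M_subgroup] g(2) by simp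
    then have "?\<phi> ` T i \<lhd> S\<lparr>carrier := M\<rparr>" using iso_normal_subgroup gM Ti(1) by blast
    moreover have "simple_group (S\<lparr>carrier := conj_by S g (T i)\<rparr>)"
      using simple_group.iso_simple[OF Ti(2) _ conj_iso[OF g(1) T_subgroup[OF i]]]
        subgroup_imp_group[OF conj_by_subgroup[OF g(1) T_subgroup[OF i]]] by blast
    ultimately have "conj_by S g (T i) \<in> T ` {1..k}"
      using T unfolding bij_betw_def conj_by_image by simp
    then show ?thesis by blast
  qed
  then have "\<forall>i\<in>{1..k}. \<exists>j. j \<in> {1..k} \<and> conj_by S g (T i) = T j" by blast
  from bchoice[OF this] obtain \<pi> where
    pi: "\<forall>i\<in>{1..k}. \<pi> i \<in> {1..k} \<and> conj_by S g (T i) = T (\<pi> i)" by blast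
  have "inj_on \<pi> {1..k}"
  proof (rule inj_onI)
    fix i j assume ij: "i \<in> {1..k}" "j \<in> {1..k}" "\<pi> i = \<pi> j"
    then have "conj_by S g (T i) = conj_by S g (T j)" using pi by simp
    then have "T i = T j"
      using conj_by_inv[OF g(1)] subgroup.subset[OF T_subgroup] ij(1,2) by metis
    then show "i = j" using T ij unfolding bij_betw_def inj_on_def by blast
  qed
  moreover have "\<pi> ` {1..k} \<subseteq> {1..k}" using pi by blast
  ultimately have "bij_betw \<pi> {1..k} {1..k}" unfolding bij_betw_def using endo_inj_surj by blast
  then show ?thesis unfolding permutes_factors_def using pi g(1) by blast
qed

text \<open>\<open>P J\<close> is a non-trivial normal subgroup of \<open>G\<close> inside
  \<open>M\<close>, so minimality makes it equal to \<open>M\<close>; a factor outside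
  \<open>J\<close> would meet it trivially.\<close>

lemma invariant_factors_all:
  assumes G: "subgroup G S" "minimal_normal (S\<lparr>carrier := G\<rparr>) M"
    and T: "\<And>i. i \<in> {1..k} \<Longrightarrow> T i \<noteq> {\<one>}"
    and J: "J \<subseteq> {1..k}" "J \<noteq> {}" "\<And>g. g \<in> G \<Longrightarrow> conj_by S g (P J) \<subseteq> P J"
  shows "J = {1..k}"
proof -
  have MG: "M \<subseteq> G" using G(2) normal_imp_subgroup subgroup.subset unfolding minimal_normal_def by fastforce
  have "P J \<lhd> S\<lparr>carrier := G\<rparr>"
  proof (rule group.normal_invI[OF subgroup_imp_group[OF G(1)]])
    show "subgroup (P J) (S\<lparr>carrier := G\<rparr>)"
      using subgroup_incl[OF P_subgroup[OF J(1)] G(1)] P_sub_M[OF J(1)] MG by blast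
    fix x h assume xh: "x \<in> carrier (S\<lparr>carrier := G\<rparr>)" "h \<in> P J"
    then have "x \<otimes> h \<otimes> inv x \<in> P J" using J(3) unfolding conj_by_image by auto
    then show "x \<otimes>\<^bsub>S\<lparr>carrier := G\<rparr>\<^esub> h \<otimes>\<^bsub>S\<lparr>carrier := G\<rparr>\<^esub> inv\<^bsub>S\<lparr>carrier := G\<rparr>\<^esub> x \<in> P J"
      using m_inv_consistent[OF G(1)] xh by simp
  qed
  then have alt: "P J = {\<one>} \<or> P J = M"
    using G(2) P_sub_M[OF J(1)] unfolding minimal_normal_def by simp
  obtain j where j: "j \<in> J" using J(2) by blast
  have "P J \<noteq> {\<one>}"
    using T_sub_P[OF j] T[of j] j J(1) subgroup.one_closed[OF T_subgroup[of j]] by blast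
  then have PM: "P J = M" using alt by simp
  have "i \<in> J" if i: "i \<in> {1..k}" for i
  proof (rule ccontr)
    assume "i \<notin> J"
    then have "P {i} \<inter> P J = {\<one>}" using P_disjoint[of "{i}" J] i J(1) by simp
    then have "T i \<subseteq> {\<one>}" using PM P_singleton[OF i] P_sub_M[of "{i}"] i by auto
    then show False using T[OF i] subgroup.one_closed[OF T_subgroup[OF i]] by blast
  qed
  then show ?thesis using J(1) by blast
qed

text \<open>Reconciles a given family of disjoint strips with the set of all involved ones. As
  supports cover all indices, an involved \<open>X\<close> meets the support of some
  \<open>Z\<close> in the family. Its support then lies in that of \<open>Z\<close>; since
  \<open>X\<close> lies in \<open>D\<close>, it lies in \<open>Z\<close>; and a common coordinate
  has the same image for both, so \<open>X = Z\<close>.\<close>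

lemma strips_of_product:
  assumes fin: "finite M"
    and strips: "\<And>Y. Y \<in> \<S> \<Longrightarrow> strip S M T k Y \<and> card (sp Y) = 2"
    and disj: "\<And>Y Z. Y \<in> \<S> \<Longrightarrow> Z \<in> \<S> \<Longrightarrow> Y \<noteq> Z \<Longrightarrow> sp Y \<inter> sp Z = {}"
    and D: "D = generate S (\<Union>Y\<in>\<S>. Y)" "sp D = {1..k}"
  shows "factor_blocks S T k M \<S> sp"
    "{Y. strip S M T k Y \<and> Y \<noteq> {\<one>} \<and> involved_in S T k Y D} = \<S>"
proof -
  have Y: "subgroup Y S" "Y \<subseteq> M" "Y \<subseteq> P (sp Y)" if "Y \<in> \<S>" for Y
    using strips[OF that] sigma_supp[of Y] unfolding strip_def by auto
  have DM: "D \<subseteq> M" unfolding D(1) using Y(2) by (intro generate_subgroup_incl[OF _ M_subgroup]) auto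
  let ?U = "\<Union>Y\<in>\<S>. sp Y"
  have U: "?U \<subseteq> {1..k}" using supp_sub by blast
  have "Y \<subseteq> P ?U" if "Y \<in> \<S>" for Y using Y(3)[OF that] P_mono[of "sp Y" ?U] that by blast
  then have "D \<subseteq> P ?U" unfolding D(1) by (intro generate_subgroup_incl[OF _ P_subgroup[OF U]]) auto
  moreover have "D \<noteq> {}" unfolding D(1) using generate.one by blast
  ultimately have cover: "?U = {1..k}" using supp_subset_iff[OF DM U] D(2) U by blast
  have "inj_on sp \<S>"
  proof (rule inj_onI, rule ccontr)
    fix Y Z assume "Y \<in> \<S>" "Z \<in> \<S>" "sp Y = sp Z" "Y \<noteq> Z"
    then have "sp Y = {}" using disj[of Y Z] by simp
    then show False using strips[OF \<open>Y \<in> \<S>\<close>] by simp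
  qed
  moreover have "finite (sp ` \<S>)"
  proof (rule finite_subset)
    show "sp ` \<S> \<subseteq> Pow {1..k}" using supp_sub by (intro image_subsetI PowI)
    show "finite (Pow {1..k})" by simp
  qed
  ultimately have "finite \<S>" by (metis finite_imageD)
  then show fb: "factor_blocks S T k M \<S> sp"
    using cover disj by unfold_locales auto
  interpret factor_blocks S T k M \<S> sp by (rule fb)
  have Dp: "D = block_prod (\<lambda>Y. Y)" using generate_eq_block_prod[of "\<lambda>Y. Y"] Y(1,3) D(1) by simp
  show "{Y. strip S M T k Y \<and> Y \<noteq> {\<one>} \<and> involved_in S T k Y D} = \<S>"
  proof
    show "{Y. strip S M T k Y \<and> Y \<noteq> {\<one>} \<and> involved_in S T k Y D} \<subseteq> \<S>"
    proof
      fix X assume "X \<in> {Y. strip S M T k Y \<and> Y \<noteq> {\<one>} \<and> involved_in S T k Y D}"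
      then have X: "strip S M T k X" "X \<noteq> {\<one>}" "involved_in S T k X D" "subgroup X S" "X \<subseteq> M"
        unfolding strip_def by auto
      then obtain i where i: "i \<in> sp X" using supp_empty_iff by blast
      then obtain Z where Z: "i \<in> sp Z" "Z \<in> \<S>" using supp_sub cover by blast
      have XZ: "sp X \<subseteq> sp Z" "\<sigma> (sp X) ` Z = X"
        using strip_involved_block[of "\<lambda>Y. Y" X i Z, OF fin _ _ X(1) _ i Z] Y X(3) Dp by auto
      have "X \<subseteq> D"
        using involved_iff[OF X(4,5) block_prod_subgroup[of "\<lambda>Y. Y"] block_prod_sub_M] X(3) Y(1) Dp by simp
      have "X \<subseteq> Z"
      proof
        fix x assume x: "x \<in> X"
        then have "x \<in> P (sp Z)" using sigma_supp[OF X(5)] P_mono[OF XZ(1)] by blast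
        then have "\<sigma> (sp Z) x = x" using sigma_id[OF supp_sub] by simp
        moreover have "\<sigma> (sp Z) x \<in> Z" using \<open>X \<subseteq> D\<close> x Z(2) Dp unfolding block_prod_def by blast
        ultimately show "x \<in> Z" by simp
      qed
      moreover have "\<sigma> {i} ` X = \<sigma> {i} ` Z"
        using sigma_image_sigma[OF _ supp_sub Y(2)[OF Z(2)], of "{i}" X] i XZ(2) by simp
      ultimately have "X = Z" using strip_subset_eq[OF fin _ Z(1)] strips[OF Z(2)] by simp
      then show "X \<in> \<S>" using Z by simp
    qed
    show "\<S> \<subseteq> {Y. strip S M T k Y \<and> Y \<noteq> {\<one>} \<and> involved_in S T k Y D}"
    proof
      fix Z assume Z: "Z \<in> \<S>"
      have "Z \<noteq> {\<one>}"
        using strips[OF Z] supp_empty_iff[OF Y(1,2)[OF Z]] by (metis card.empty zero_neq_numeral)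
      moreover have "involved_in S T k Z D"
        using block_involved[of "\<lambda>Y. Y" Z] Y Z Dp by simp
      ultimately show "Z \<in> {Y. strip S M T k Y \<and> Y \<noteq> {\<one>} \<and> involved_in S T k Y D}"
        using strips[OF Z] by simp
    qed
  qed
qed

end

context factor_blocks begin

lemma card_blocks:
  assumes "\<And>b. b \<in> B \<Longrightarrow> card (\<beta> b) = n"
  shows "n * card B = k"
proof -
  have "card (\<Union>b\<in>B. \<beta> b) = (\<Sum>b\<in>B. card (\<beta> b))"
    using block_disj finite_B finite_subset[OF block_sub] by (intro card_UN_disjoint) simp_all
  then show ?thesis using assms cover by (simp add: mult.commute)
qed

text \<open>Suppose the support \<open>{i, j}\<close> straddled two blocks. An element of the
  component at \<open>i\<close> with non-trivial \<open>i\<close>-coordinate projects into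
  \<open>X\<close> with trivial \<open>j\<close>-coordinate, and injectivity of that coordinate on
  \<open>X\<close> makes the projection trivial, a contradiction.\<close>

lemma strip_meet_block:
  assumes fin: "finite M" and X: "strip S M T k X" "card (sp X) = 2"
    and B: "\<And>b. b \<in> B \<Longrightarrow> subgroup (L b) S" "\<And>b. b \<in> B \<Longrightarrow> L b \<subseteq> P (\<beta> b)"
      "\<And>b. b \<in> B \<Longrightarrow> sp (L b) = \<beta> b" "\<And>b. b \<in> B \<Longrightarrow> card (\<beta> b) = 2"
    and sub: "\<sigma> (sp X) ` block_prod L \<subseteq> X"
  shows "\<exists>b\<in>B. sp X = \<beta> b"
proof -
  obtain i j where ij: "sp X = {i, j}" "i \<noteq> j" using X(2) unfolding card_2_iff by blast
  have ijk: "i \<in> {1..k}" "j \<in> {1..k}" using supp_sub[of X] ij by auto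
  obtain b where b: "b \<in> B" "i \<in> \<beta> b" using cover ijk by blast
  have Lb: "L b \<subseteq> M" "L b \<subseteq> block_prod L"
    using B(2)[OF b(1)] P_sub_M[OF block_sub[OF b(1)]] part_sub_block_prod[OF B(1,2) b(1)] by auto
  have "j \<in> \<beta> b"
  proof (rule ccontr)
    assume j: "j \<notin> \<beta> b"
    have "i \<in> sp (L b)" using B(3) b by simp
    then obtain y where y: "y \<in> L b" "\<sigma> {i} y \<noteq> \<one>" using supp_iff[OF B(1)[OF b(1)] Lb(1)] by blast
    have yM: "y \<in> M" using y Lb by blast
    have x: "\<sigma> (sp X) y \<in> X" using y Lb(2) sub by blast
    have "\<sigma> {j} y = \<one>"
      using sigma_disjoint[of "{j}" "\<beta> b" y] B(2)[OF b(1)] y block_sub[OF b(1)] ijk j by auto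
    then have "\<sigma> {j} (\<sigma> (sp X) y) = \<one>" using sigma_sigma[OF _ supp_sub yM, of "{j}" X] ij ijk by simp
    moreover have "inj_on (\<sigma> {j}) X" "subgroup X S" using X(1) strip_iff_inj[OF fin] ij by auto
    ultimately have "\<sigma> (sp X) y = \<one>"
      using inj_onD[of "\<sigma> {j}" X "\<sigma> (sp X) y" \<one>] x sigma_one[of "{j}"] ijk subgroup.one_closed by auto
    then have "\<sigma> {i} (\<sigma> (sp X) y) = \<one>" using sigma_one[of "{i}"] ijk by simp
    then show False using y sigma_sigma[OF _ supp_sub yM, of "{i}" X] ij ijk by simp
  qed
  then have "sp X \<subseteq> \<beta> b" using ij b by simp
  moreover have "finite (\<beta> b)" using block_sub[OF b(1)] finite_subset by blast
  ultimately have "sp X = \<beta> b" using card_subset_eq[of "\<beta> b" "sp X"] X(2) B(4)[OF b(1)] by simp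
  then show ?thesis using b by blast
qed

end

section \<open>Point stabilisers\<close>

lemma point_stab_eq: "point_stab \<Omega> G \<omega> = {g \<in> G. g \<omega> = \<omega>}"
  unfolding point_stab_def stabilizer_def by simp

lemma point_stab_subgroup:
  assumes "subgroup G (Sym \<Omega>)" "\<omega> \<in> \<Omega>"
  shows "subgroup (point_stab \<Omega> G \<omega>) (Sym \<Omega>)"
proof -
  interpret group "Sym \<Omega>" by (rule Sym_group)
  note car = subgroup.mem_carrier[OF assms(1)]
  show ?thesis unfolding point_stab_eq
  proof (rule subgroupI)
    show "{g \<in> G. g \<omega> = \<omega>} \<subseteq> carrier (Sym \<Omega>)" using car by blast
    show "{g \<in> G. g \<omega> = \<omega>} \<noteq> {}" using subgroup.one_closed[OF assms(1)] Sym_one_apply[OF assms(2)] by blast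
    show "inv\<^bsub>Sym \<Omega>\<^esub> g \<in> {g \<in> G. g \<omega> = \<omega>}" if "g \<in> {g \<in> G. g \<omega> = \<omega>}" for g
      using that Sym_inv_apply(1)[OF car assms(2), of g] subgroup.m_inv_closed[OF assms(1)] by auto
    show "g \<otimes>\<^bsub>Sym \<Omega>\<^esub> h \<in> {g \<in> G. g \<omega> = \<omega>}" if "g \<in> {g \<in> G. g \<omega> = \<omega>}" "h \<in> {g \<in> G. g \<omega> = \<omega>}" for g h
      using that Sym_apply[OF car car assms(2), of g h] subgroup.m_closed[OF assms(1)] by auto
  qed
qed

lemma point_stab_conj:
  assumes G: "subgroup G (Sym \<Omega>)" "\<omega> \<in> \<Omega>" and M: "M \<subseteq> G" "\<And>g. g \<in> G \<Longrightarrow> conj_by (Sym \<Omega>) g M = M"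
    and g: "g \<in> point_stab \<Omega> G \<omega>"
  shows "conj_by (Sym \<Omega>) g (point_stab \<Omega> M \<omega>) = point_stab \<Omega> M \<omega>"
proof -
  interpret group "Sym \<Omega>" by (rule Sym_group)
  note car = subgroup.mem_carrier[OF G(1)]
  show ?thesis
  proof (rule conj_by_eqI[OF point_stab_subgroup[OF G] _ _ g])
    show "point_stab \<Omega> M \<omega> \<subseteq> carrier (Sym \<Omega>)" unfolding point_stab_eq using M(1) car by blast
    fix h assume h: "h \<in> point_stab \<Omega> G \<omega>"
    then have hG: "h \<in> G" "h \<omega> = \<omega>" unfolding point_stab_eq by auto
    show "conj_by (Sym \<Omega>) h (point_stab \<Omega> M \<omega>) \<subseteq> point_stab \<Omega> M \<omega>"
    proof
      fix z assume "z \<in> conj_by (Sym \<Omega>) h (point_stab \<Omega> M \<omega>)"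
      then obtain m where m: "m \<in> M" "m \<omega> = \<omega>" "z = h \<otimes>\<^bsub>Sym \<Omega>\<^esub> m \<otimes>\<^bsub>Sym \<Omega>\<^esub> inv\<^bsub>Sym \<Omega>\<^esub> h"
        unfolding conj_by_image point_stab_eq by auto
      have "z \<in> M" using M(2)[OF hG(1)] m unfolding conj_by_image by blast
      moreover have "h \<in> carrier (Sym \<Omega>)" "m \<in> carrier (Sym \<Omega>)" using car hG m M(1) by auto
      then have "z \<omega> = \<omega>"
        using m hG Sym_inv_apply(1)[of h \<Omega> \<omega>] Sym_apply[of "h \<otimes>\<^bsub>Sym \<Omega>\<^esub> m" \<Omega> "inv\<^bsub>Sym \<Omega>\<^esub> h" \<omega>]
          Sym_apply[of h \<Omega> m \<omega>] G(2) by simp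
      ultimately show "z \<in> point_stab \<Omega> M \<omega>" unfolding point_stab_eq by simp
    qed
  qed
qed

section \<open>The theorem\<close>

text \<open>The choice \<open>j = 1\<close> becomes a quantification over every \<open>Y1\<close>
  with the support of \<open>X1\<close> and over all base vertices. Independence of \<open>g\<close>
  is expressed by letting any admissible element replace the one selected by \<open>SOME\<close> in
  \<open>K_part\<close>.\<close>

theorem mainTheorem6:
  fixes \<Omega> :: "'a set" and \<omega> :: 'a
    and S :: "('a \<Rightarrow> 'a) monoid"
    and G M G\<^sub>\<omega> M\<^sub>\<omega> :: "('a \<Rightarrow> 'a) set"
    and T :: "nat \<Rightarrow> ('a \<Rightarrow> 'a) set" and k :: nat
    and YS :: "('a \<Rightarrow> 'a) set set"
    and X1 A1 B1 :: "('a \<Rightarrow> 'a) set"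
    and V :: "'v set" and E1 E2 :: "('v + ('a \<Rightarrow> 'a) set) set set"
    and \<alpha> :: "('a \<Rightarrow> 'a) \<Rightarrow> 'v \<Rightarrow> 'v"
  assumes S: "S = Sym \<Omega>"
    and G: "subgroup G S" "finite G"
    and M: "plinth \<Omega> G M" "\<not> comm_group (S\<lparr>carrier := M\<rparr>)"
    and T: "bij_betw T {1..k} {N. N \<lhd> S\<lparr>carrier := M\<rparr> \<and> simple_group (S\<lparr>carrier := N\<rparr>)}"
      "\<forall>i\<in>{1..k}. \<not> comm_group (S\<lparr>carrier := T i\<rparr>)"
      "is_direct_product S {1..k} T M"
    and \<omega>: "\<omega> \<in> \<Omega>"
    and stabs: "G\<^sub>\<omega> = point_stab \<Omega> G \<omega>" "M\<^sub>\<omega> = point_stab \<Omega> M \<omega>"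
    and M\<^sub>\<omega>_strips: "\<exists>\<S>. (\<forall>Y\<in>\<S>. strip S M T k Y \<and> card (supp S T k Y) = 2) \<and>
      (\<forall>Y\<in>\<S>. \<forall>Z\<in>\<S>. Y \<noteq> Z \<longrightarrow> supp S T k Y \<inter> supp S T k Z = {}) \<and>
      is_direct_product S \<S> (\<lambda>Y. Y) M\<^sub>\<omega>"
    and YS: "YS = {Y. strip S M T k Y \<and> Y \<noteq> {\<one>\<^bsub>S\<^esub>} \<and> involved_in S T k Y M\<^sub>\<omega>}"
    and i: "full_strip S M T k X1" "card (supp S T k X1) = 2"
    and ii: "subgroup A1 S" "A1 \<subset> T_min S T k X1" "subgroup B1 S" "B1 \<subset> T_max S T k X1"
    and iii: "\<exists>g\<in>G\<^sub>\<omega>. conj_by S g A1 = B1"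
    and iv: "X1 <#>\<^bsub>S\<^esub> (A1 <#>\<^bsub>S\<^esub> B1) = T_min S T k X1 <#>\<^bsub>S\<^esub> T_max S T k X1"
      "X1 \<inter> (A1 <#>\<^bsub>S\<^esub> B1) = sigma S T k (supp S T k X1) ` M\<^sub>\<omega>"
    and v: "normalizer_in S G\<^sub>\<omega> (T_min S T k X1 <#>\<^bsub>S\<^esub> T_max S T k X1) = normalizer_in S G\<^sub>\<omega> X1"
      "normalizer_in S G\<^sub>\<omega> X1 = normalizer_in S G\<^sub>\<omega> (A1 <#>\<^bsub>S\<^esub> B1)"
    and bipartite: "E1 \<union> E2 \<subseteq> {edge v Y |v Y. v \<in> V \<and> Y \<in> YS}" "E1 \<inter> E2 = {}"
    and action: "group_action (S\<lparr>carrier := G\<^sub>\<omega>\<rparr>) V \<alpha>"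
      "\<forall>g\<in>G\<^sub>\<omega>. edge_action S \<alpha> g ` (E1 \<union> E2) = E1 \<union> E2"
    and orbits: "V \<in> orbits (S\<lparr>carrier := G\<^sub>\<omega>\<rparr>) V \<alpha>"
      "YS \<in> orbits (S\<lparr>carrier := G\<^sub>\<omega>\<rparr>) YS (conj_by S)"
      "E1 \<in> orbits (S\<lparr>carrier := G\<^sub>\<omega>\<rparr>) (E1 \<union> E2) (edge_action S \<alpha>)"
      "E2 \<in> orbits (S\<lparr>carrier := G\<^sub>\<omega>\<rparr>) (E1 \<union> E2) (edge_action S \<alpha>)"
    and degrees: "\<forall>Y\<in>YS. card (incident_edges E1 Y) = 1 \<or> card (incident_edges E1 Y) = 2"
      "\<forall>Y\<in>YS. card (incident_edges E2 Y) = 1"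
    and two_edges: "(\<forall>Y\<in>YS. card (incident_edges E1 Y) = 2) \<longrightarrow>
      (\<forall>v\<in>V. \<forall>Y\<in>YS. edge v Y \<in> E1 \<longrightarrow>
        stabilizer (S\<lparr>carrier := G\<^sub>\<omega>\<rparr>) (edge_action S \<alpha>) (edge v Y) =
          normalizer_in S G\<^sub>\<omega> (T_min S T k Y) \<inter> normalizer_in S G\<^sub>\<omega> (T_max S T k Y))"
  shows "2 * card YS = k \<and>
    (\<exists>Y\<in>YS. supp S T k X1 = supp S T k Y) \<and>
    (\<forall>Y1\<in>YS. \<forall>v1\<in>V. \<forall>v2\<in>V.
      supp S T k X1 = supp S T k Y1 \<and> edge v1 Y1 \<in> E1 \<and> edge v2 Y1 \<in> E2 \<longrightarrow>
      (let L1 = (if card (incident_edges E1 Y1) = 2 then A1 <#>\<^bsub>S\<^esub> T_max S T k Y1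
                 else A1 <#>\<^bsub>S\<^esub> B1);
           KvY = K_part S T k G\<^sub>\<omega> \<alpha> E1 E2 (edge v1 Y1) L1 (edge v2 Y1) X1;
           K = (\<lambda>v. generate S (\<Union>Y\<in>YS. KvY v Y));
           \<K> = K ` V;
           XS = nontrivial_full_strips_in S M T k \<K>;
           \<E> = decomp_of M \<omega> \<K>
       in
         (\<forall>v\<in>V. \<forall>Y\<in>YS. \<forall>g\<in>G\<^sub>\<omega>.
           (edge_action S \<alpha> g (edge v1 Y1) = edge v Y \<longrightarrow> KvY v Y = conj_by S g L1) \<and>
           (edge_action S \<alpha> g (edge v2 Y1) = edge v Y \<longrightarrow> KvY v Y = conj_by S g X1)) \<and>
         cartesian_system \<Omega> M \<omega> \<K> \<and>
         (\<forall>g\<in>G\<^sub>\<omega>. conj_by S g ` \<K> = \<K>) \<and>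
         (bij_betw K V \<K> \<and> (\<forall>g\<in>G\<^sub>\<omega>. \<forall>v\<in>V. K (\<alpha> g v) = conj_by S g (K v))) \<and>
         (\<forall>L\<in>\<K>. \<forall>N\<in>\<K>. \<exists>g\<in>G\<^sub>\<omega>. conj_by S g L = N) \<and>
         \<E> \<in> CD_1S \<Omega> G M T k \<omega> \<and>
         (\<forall>Y\<in>YS. \<exists>!Z. Z \<in> XS \<and> supp S T k Z = supp S T k Y) \<and>
         graph2_iso (case_sum K (\<lambda>Y. THE Z. Z \<in> XS \<and> supp S T k Z = supp S T k Y))
           (Inl ` V \<union> Inr ` YS, E1, E2) (decomp_graph \<Omega> M T k \<omega> \<E>)))"
proof -
  interpret S: group S unfolding S by (rule Sym_group)
  interpret df: direct_factors S T k M by unfold_locales (rule T(3))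
  have min: "minimal_normal (S\<lparr>carrier := G\<rparr>) M" and M_tr: "transitive_on \<Omega> M"
    using M(1) unfolding plinth_def S by auto
  have M_normal: "M \<lhd> S\<lparr>carrier := G\<rparr>" using min unfolding minimal_normal_def by simp
  have MG: "M \<subseteq> G" using normal_imp_subgroup[OF M_normal] subgroup.subset by fastforce
  have finM: "finite M" using MG G(2) finite_subset by blast
  have G_car: "g \<in> carrier S" if "g \<in> G" for g using subgroup.mem_carrier[OF G(1) that] .
  have G_conj_M: "conj_by S g M = M" if "g \<in> G" for g using S.normal_conj_by[OF G(1) M_normal that] .
  have G_perm: "\<exists>\<pi>. df.permutes_factors g \<pi>" if "g \<in> G" for g
    using df.conj_permutes_factors[OF T(1) G_car G_conj_M] that by blast
  have H_eq: "G\<^sub>\<omega> = {g \<in> G. g \<omega> = \<omega>}" and D_eq: "M\<^sub>\<omega> = {m \<in> M. m \<omega> = \<omega>}"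
    unfolding stabs point_stab_eq by simp_all
  have H_sub: "subgroup G\<^sub>\<omega> S" and H_G: "G\<^sub>\<omega> \<subseteq> G"
    using point_stab_subgroup[of G \<Omega> \<omega>] G(1) \<omega> H_eq unfolding S stabs by auto
  have D_sub: "subgroup M\<^sub>\<omega> S" and D_M: "M\<^sub>\<omega> \<subseteq> M"
    using point_stab_subgroup[of M \<Omega> \<omega>] df.M_subgroup \<omega> D_eq unfolding S stabs by auto
  have D_conj: "conj_by S g M\<^sub>\<omega> = M\<^sub>\<omega>" if "g \<in> G\<^sub>\<omega>" for g
    unfolding S stabs by (rule point_stab_conj[of G \<Omega> \<omega> M g])
      (use G(1) \<omega> MG G_conj_M that in \<open>simp_all add: S stabs\<close>)
  have T_ne: "T i \<noteq> {\<one>\<^bsub>S\<^esub>}" if "i \<in> {1..k}" for i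
  proof -
    have "simple_group (S\<lparr>carrier := T i\<rparr>)" using T(1) that unfolding bij_betw_def by blast
    from simple_group.simple_not_triv[OF this] show ?thesis by simp
  qed

  obtain \<S> where strips: "\<And>Y. Y \<in> \<S> \<Longrightarrow> strip S M T k Y \<and> card (supp S T k Y) = 2"
    and strips_disj: "\<And>Y Z. Y \<in> \<S> \<Longrightarrow> Z \<in> \<S> \<Longrightarrow> Y \<noteq> Z \<Longrightarrow> supp S T k Y \<inter> supp S T k Z = {}"
    and strips_prod: "M\<^sub>\<omega> = generate S (\<Union>Y\<in>\<S>. Y)"
    using M\<^sub>\<omega>_strips unfolding is_direct_product_def by metis
  have YS_ne: "YS \<noteq> {}" using orbits(2) unfolding orbits_def by blast
  \<comment> \<open>\<open>YS\<close> is an orbit, hence non-empty, and a non-trivial involved strip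
    is contained in the stabiliser.\<close>
  have D_ne: "M\<^sub>\<omega> \<noteq> {\<one>\<^bsub>S\<^esub>}"
  proof
    assume D1: "M\<^sub>\<omega> = {\<one>\<^bsub>S\<^esub>}"
    obtain Y where Y: "strip S M T k Y" "Y \<noteq> {\<one>\<^bsub>S\<^esub>}" "involved_in S T k Y M\<^sub>\<omega>" using YS_ne YS by blast
    then have "Y \<subseteq> {\<one>\<^bsub>S\<^esub>}" "subgroup Y S"
      using df.involved_sigma(2)[of Y "M\<^sub>\<omega>"] D_M D1 unfolding strip_def by auto
    then show False using Y(2) subgroup.one_closed by blast
  qed
  \<comment> \<open>The stabiliser \<open>G\<^sub>\<omega>\<close> normalises
    \<open>M\<^sub>\<omega>\<close> and so preserves its support; \<open>M\<close> normalises each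
    factor; and \<open>g = m h\<close> with \<open>m\<close> in \<open>M\<close> and
    \<open>h\<close> in \<open>G\<^sub>\<omega>\<close>. Hence the product over the support is
    invariant under \<open>G\<close>.\<close>
  have supp_D: "supp S T k M\<^sub>\<omega> = {1..k}"
  proof (rule df.invariant_factors_all[OF G(1) min T_ne df.supp_sub])
    show "supp S T k M\<^sub>\<omega> \<noteq> {}" using df.supp_empty_iff[OF D_sub D_M] D_ne by simp
    fix g assume g: "g \<in> G"
    have gc: "g \<in> carrier S" using G_car[OF g] .
    have "g \<omega> \<in> \<Omega>" using Sym_in[of g \<Omega> \<omega>] gc \<omega> unfolding S by simp
    then obtain m where m: "m \<in> M" "m \<omega> = g \<omega>" using M_tr \<omega> unfolding transitive_on_def by blast
    have mc: "m \<in> carrier S" using df.M_carrier[OF m(1)] .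
    define h where "h = inv\<^bsub>S\<^esub> m \<otimes>\<^bsub>S\<^esub> g"
    have "h \<omega> = (inv\<^bsub>S\<^esub> m) (m \<omega>)"
      unfolding h_def using Sym_apply[of "inv\<^bsub>S\<^esub> m" \<Omega> g \<omega>] S.inv_closed[OF mc] gc \<omega> m(2) unfolding S by simp
    then have "h \<omega> = \<omega>" using Sym_inv_apply(1)[of m \<Omega> \<omega>] mc \<omega> unfolding S by simp
    moreover have "h \<in> G" unfolding h_def
      using subgroup.m_closed[OF G(1) subgroup.m_inv_closed[OF G(1)] g] m(1) MG by blast
    ultimately have h: "h \<in> G\<^sub>\<omega>" "h \<in> G" unfolding H_eq by auto
    obtain \<pi> where pi: "df.permutes_factors h \<pi>" using G_perm[OF h(2)] by blast
    have "\<pi> ` supp S T k M\<^sub>\<omega> = supp S T k M\<^sub>\<omega>" using df.conj_supp[OF pi D_sub D_M] D_conj[OF h(1)] by simp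
    then have hP: "conj_by S h (df.P (supp S T k M\<^sub>\<omega>)) = df.P (supp S T k M\<^sub>\<omega>)"
      using df.conj_P[OF pi df.supp_sub] by simp
    have "conj_by S m (T i) = T i" if "i \<in> {1..k}" for i
      using S.normal_conj_by[OF df.M_subgroup _ m(1), of "T i"] T(1) that unfolding bij_betw_def by blast
    then have "df.permutes_factors m id" unfolding df.permutes_factors_def using mc by simp
    then have mP: "conj_by S m (df.P (supp S T k M\<^sub>\<omega>)) = df.P (supp S T k M\<^sub>\<omega>)"
      using df.conj_P[OF _ df.supp_sub, of m id] by simp
    have "g = m \<otimes>\<^bsub>S\<^esub> h" unfolding h_def using mc gc by (simp add: S.m_assoc[symmetric])
    then have "conj_by S g (df.P (supp S T k M\<^sub>\<omega>)) = df.P (supp S T k M\<^sub>\<omega>)"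
      using S.conj_by_comp[OF mc G_car[OF h(2)] subgroup.subset[OF df.P_subgroup[OF df.supp_sub]]] hP mP by simp
    then show "conj_by S g (df.P (supp S T k M\<^sub>\<omega>)) \<subseteq> df.P (supp S T k M\<^sub>\<omega>)" by simp
  qed
  note prod = df.strips_of_product[OF finM strips strips_disj strips_prod supp_D]
  have YS_eq: "YS = \<S>" unfolding YS by (rule prod(2))
  have blocks: "factor_blocks S T k M YS (supp S T k)" unfolding YS_eq by (rule prod(1))
  interpret fb: factor_blocks S T k M YS "supp S T k" by (rule blocks)
  have YS_strip: "subgroup Y S" "Y \<subseteq> M" "card (supp S T k Y) = 2" "Y \<subseteq> df.P (supp S T k Y)" if "Y \<in> YS" for Y
    using strips[of Y] that df.sigma_supp[of Y] unfolding YS_eq strip_def by auto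
  have D_gen: "M\<^sub>\<omega> = generate S (\<Union>Y\<in>YS. Y)" unfolding YS_eq by (rule strips_prod)
  have card_YS: "2 * card YS = k" by (rule fb.card_blocks) (rule YS_strip(3))
  \<comment> \<open>By (iv) the projection of \<open>M\<^sub>\<omega>\<close> to the support of
    \<open>X1\<close> lies in \<open>X1\<close>, as \<open>strip_meet_block\<close>
    requires.\<close>
  have supp_X1: "\<exists>Y\<in>YS. supp S T k X1 = supp S T k Y"
  proof (rule fb.strip_meet_block[OF finM _ i(2), of "\<lambda>Y. Y"])
    show "strip S M T k X1" using i(1) unfolding full_strip_def by simp
    have "M\<^sub>\<omega> = fb.block_prod (\<lambda>Y. Y)"
      using fb.generate_eq_block_prod[of "\<lambda>Y. Y"] YS_strip(1,4) D_gen by simp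
    then show "sigma S T k (supp S T k X1) ` fb.block_prod (\<lambda>Y. Y) \<subseteq> X1" using iv(2) by blast
  qed (use YS_strip in auto)
  show ?thesis
  proof (intro conjI ballI impI card_YS supp_X1, goal_cases)
    case (1 Y1 v1 v2)
    then have base: "Y1 \<in> YS" "v1 \<in> V" "v2 \<in> V" "supp S T k X1 = supp S T k Y1"
      "edge v1 Y1 \<in> E1" "edge v2 Y1 \<in> E2" by simp_all
    interpret C: construction S T k M YS "G\<^sub>\<omega>" "M\<^sub>\<omega>" X1 A1 B1 V E1 E2 \<alpha> Y1 v1 v2
    proof (rule construction.intro[OF blocks construction_axioms.intro])
      show "finite G\<^sub>\<omega>" using H_G G(2) finite_subset by blast
      show "\<exists>\<pi>. df.permutes_factors g \<pi>" if "g \<in> G\<^sub>\<omega>" for g using G_perm H_G that by blast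
      show "conj_by S g M\<^sub>\<omega> = M\<^sub>\<omega>" if "g \<in> G\<^sub>\<omega>" for g using D_conj[OF that] .
      show "subgroup Y S" "Y \<subseteq> M" "card (supp S T k Y) = 2" if "Y \<in> YS" for Y
        using YS_strip[OF that] by simp_all
    qed (fact finM H_sub D_gen i(1) ii iv v bipartite action(1) orbits degrees two_edges base)+
    have L1: "(if card (incident_edges E1 Y1) = 2 then A1 <#>\<^bsub>S\<^esub> T_max S T k Y1 else A1 <#>\<^bsub>S\<^esub> B1) = C.L1"
      unfolding C.L1_def C.two_def base(4) ..
    have K: "(\<lambda>v. generate S (\<Union>Y\<in>YS. C.KvY v Y)) = C.K" unfolding C.K_def[abs_def] ..
    have xs: "(\<lambda>Y. THE Z. Z \<in> C.XS \<and> supp S T k Z = supp S T k Y) = C.xs" unfolding C.xs_def[abs_def] ..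
    have cs: "cartesian_system \<Omega> M \<omega> (C.K ` V)"
      using C.K_system C.K_Inter unfolding cartesian_system_def S stabs by simp
    interpret CS: cartesian_system_action S \<Omega> M \<omega> "C.K ` V"
      by (intro cartesian_system_action.intro cartesian_system_action_axioms.intro
          S.group_axioms S df.M_subgroup M_tr \<omega> cs)
    have "decomp_of M \<omega> (C.K ` V) \<in> CD_tr \<Omega> G"
    proof (rule CS.decomp_CD_tr[OF G(1) MG G_conj_M])
      show "conj_by S h ` C.K ` V = C.K ` V" if "h \<in> G" "h \<omega> = \<omega>" for h
        using C.K_invariant[of h] that unfolding H_eq by simp
      show "\<exists>h\<in>G. h \<omega> = \<omega> \<and> conj_by S h L = N" if "L \<in> C.K ` V" "N \<in> C.K ` V" for L N
        using C.K_transitive[OF that] unfolding H_eq by blast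
    qed
    moreover have "F_proj \<Omega> M T k \<omega> (decomp_of M \<omega> (C.K ` V)) i =
        {sigma S T k {i} ` L |L. L \<in> C.K ` V \<and> sigma S T k {i} ` L \<noteq> T i}" for i
      unfolding F_proj_def S[symmetric] CS.system_of_decomp ..
    ultimately have CD: "decomp_of M \<omega> (C.K ` V) \<in> CD_1S \<Omega> G M T k \<omega>"
      unfolding CD_1S_def S[symmetric] using CS.system_of_decomp C.card_F C.XS_nonempty by simp
    have graph: "graph2_iso (case_sum C.K C.xs) (Inl ` V \<union> Inr ` YS, E1, E2)
        (decomp_graph \<Omega> M T k \<omega> (decomp_of M \<omega> (C.K ` V)))"
      unfolding decomp_graph_def Let_def S[symmetric] CS.system_of_decomp by (rule C.graph_iso)
    show ?case
      unfolding Let_def L1 C.KvY_def[symmetric] K C.K_def[symmetric] xs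
      using C.KvY_edges cs C.K_invariant inj_on_imp_bij_betw[OF C.K_inj] C.K_conj C.K_transitive CD C.XS_ex1 graph
      by (intro conjI ballI impI) simp_all
  qed
qed

end
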